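(* For every $d \in \mathbb{N}$ there exist constants $c > 0$ and $C > 0$ such that the following holds. Let $G = (U,V,E)$ be a finite bipartite graph of VC-dimension at most $d$ such that the part $V$ has $n$ vertices and no two vertices of $V$ are twins. Then $G$ contains an induced subgraph $F = (U',V',E')$ with $U' \subseteq U$, $V' \subseteq V$ and $|U'| = |V'| \geq C n^{c}$ that is isomorphic to either (i) a matching, (ii) a co-matching, or (iii) a half-graph.
   Context: Twins are two vertices with exactly the same set of neighbours. The VC-dimension of a set system $(X,\mathcal{F})$ (with $X$ finite, $\mathcal{F}$ a family of subsets of $X$) is the largest size of a set $Y \subseteq X$ that is shattered, i.e. $|\{Y \cap S : S \in \mathcal{F}\}| = 2^{|Y|}$. The VC-dimension of a graph $G$ is the VC-dimension of its neighbourhood system $(V(G), \{N(v) : v \in V(G)\})$. For bipartite graphs with parts $u_1,\dots,u_k$ and $v_1,\dots,v_k$: the matching has $u_i \sim v_j$ iff $i=j$; the co-matching has $u_i \sim v_j$ iff $i \neq j$; the half-graph has $u_i \sim v_j$ iff $i \leq j$. The statement of the paper writes the size bound as $|U'|=|V'| \in \Omega(n^c)$, with constants depending only on $d$.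
   Formalization: The part U is assumed nonempty (with U empty and V a single vertex the claim fails, as |U'| = 0 < C); the constants are stated for graphs on a given vertex type, and those for graphs on the natural numbers serve every finite graph up to isomorphism. *)

theory Defs
  imports Complex_Main
begin

text \<open>
  A bipartite graph is a triple \<open>(U, V, E)\<close> of its two parts and its set of
  undirected edges, each edge being the two-element set of its end points.
\<close>

type_synonym 'a bigraph = "'a set \<times> 'a set \<times> 'a set set"

fun finite_bipartite_graph :: "'a bigraph \<Rightarrow> bool" where
  "finite_bipartite_graph (U, V, E) \<longleftrightarrow>
     finite U \<and> finite V \<and> U \<inter> V = {} \<and> E \<subseteq> {{u, v} | u v. u \<in> U \<and> v \<in> V}"

fun verts :: "'a bigraph \<Rightarrow> 'a set" where
  "verts (U, V, E) = U \<union> V"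

fun adjacent :: "'a bigraph \<Rightarrow> 'a \<Rightarrow> 'a \<Rightarrow> bool" where
  "adjacent (U, V, E) x y \<longleftrightarrow> {x, y} \<in> E"

definition neighbours :: "'a bigraph \<Rightarrow> 'a \<Rightarrow> 'a set" where
  "neighbours G x = {y \<in> verts G. adjacent G x y}"

definition twins :: "'a bigraph \<Rightarrow> 'a \<Rightarrow> 'a \<Rightarrow> bool" where
  "twins G x y \<longleftrightarrow> x \<noteq> y \<and> neighbours G x = neighbours G y"

definition shattered :: "'a set set \<Rightarrow> 'a set \<Rightarrow> bool" where
  "shattered \<F> Y \<longleftrightarrow> card {Y \<inter> S | S. S \<in> \<F>} = 2 ^ card Y"

text \<open>
  The maximum is over a finite nonempty set whenever \<open>X\<close> is finite and \<open>\<F>\<close> is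
  nonempty (the empty set is then shattered); otherwise the value is unspecified.
\<close>

definition vc_dim :: "'a set \<Rightarrow> 'a set set \<Rightarrow> nat" where
  "vc_dim X \<F> = Max {card Y | Y. Y \<subseteq> X \<and> shattered \<F> Y}"

definition graph_vc_dim :: "'a bigraph \<Rightarrow> nat" where
  "graph_vc_dim G = vc_dim (verts G) {neighbours G x | x. x \<in> verts G}"

fun induced_subgraph :: "'a bigraph \<Rightarrow> 'a bigraph \<Rightarrow> bool" where
  "induced_subgraph (U', V', E') (U, V, E) \<longleftrightarrow>
     U' \<subseteq> U \<and> V' \<subseteq> V \<and> E' = {e \<in> E. e \<subseteq> U' \<union> V'}"

text \<open>
  Isomorphisms map first part to first part and second part to second part.
\<close>

fun isomorphic :: "'a bigraph \<Rightarrow> 'b bigraph \<Rightarrow> bool" where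
  "isomorphic (U, V, E) (U', V', E') \<longleftrightarrow>
     (\<exists>f. bij_betw f (U \<union> V) (U' \<union> V') \<and> f ` U = U' \<and> f ` V = V' \<and>
          (\<forall>x\<in>U \<union> V. \<forall>y\<in>U \<union> V.
             adjacent (U, V, E) x y \<longleftrightarrow> adjacent (U', V', E') (f x) (f y)))"

text \<open>
  The bipartite graph with parts \<open>u\<^sub>1, \<dots>, u\<^sub>k\<close> and \<open>v\<^sub>1, \<dots>, v\<^sub>k\<close> in which
  \<open>u\<^sub>i\<close> and \<open>v\<^sub>j\<close> are adjacent iff \<open>R i j\<close>; here \<open>u\<^sub>i\<close> is \<open>Inl i\<close> and \<open>v\<^sub>j\<close> is \<open>Inr j\<close>.
\<close>

definition index_bigraph :: "(nat \<Rightarrow> nat \<Rightarrow> bool) \<Rightarrow> nat \<Rightarrow> (nat + nat) bigraph" where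
  "index_bigraph R k =
     (Inl ` {1..k}, Inr ` {1..k}, {{Inl i, Inr j} | i j. i \<in> {1..k} \<and> j \<in> {1..k} \<and> R i j})"

definition matching :: "nat \<Rightarrow> (nat + nat) bigraph" where
  "matching = index_bigraph (\<lambda>i j. i = j)"

definition co_matching :: "nat \<Rightarrow> (nat + nat) bigraph" where
  "co_matching = index_bigraph (\<lambda>i j. i \<noteq> j)"

definition half_graph :: "nat \<Rightarrow> (nat + nat) bigraph" where
  "half_graph = index_bigraph (\<lambda>i j. i \<le> j)"

end

theory Submission
  imports Defs
begin

text \<open>
  Choose a minimal set \<open>u\<^sub>1, \<dots>, u\<^sub>k\<close> of vertices of \<open>U\<close> that still distinguishes the vertices of \<open>V\<close>;
  by the Sauer--Shelah lemma \<open>k\<close> is polynomial in \<open>n\<close>. Minimality gives for each \<open>i\<close> two vertices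
  \<open>v\<^sub>i\<close>, \<open>w\<^sub>i\<close> of \<open>V\<close> that differ only at \<open>u\<^sub>i\<close>. The adjacency matrix of the \<open>v\<^sub>i\<close> and \<open>u\<^sub>j\<close> has two
  triangles, each defining a graph on the indices of bounded VC-dimension. Two applications of the
  Erdos--Hajnal property for bounded VC-dimension (Nguyen, Scott, Seymour) make both triangles
  constant on polynomially many indices, which leaves a matching, a co-matching (with \<open>w\<^sub>i\<close> in place
  of \<open>v\<^sub>i\<close>) or a half-graph.

  The Erdos--Hajnal property is proved by induction on the largest \<open>e\<close> such that all \<open>2\<^sup>e\<close> patterns
  over some \<open>e\<close> vertices are realised many times (\<open>robust\<close>). If large subsets realise all patterns of length \<open>e\<close>
  but length \<open>e + 1\<close> fails, then some large set is nearly pure to almost every vertex. Extracting such sets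
  repeatedly, while the density decreases from \<open>y\<close> to \<open>y\<^sup>2\<close>, yields either a very sparse or very dense set,
  or a sequence of \<open>k\<close> pairwise nearly pure blocks of relative size polynomial in \<open>1 / k\<close>; nesting these
  sequences gives a blockade so long that its union contains a very sparse or very dense set.
\<close>

section \<open>The Sauer--Shelah bound\<close>

text \<open>The sequences found at successive levels may be sparse at one level and dense at the
  next, so neither kind can be nested alone. The remedy is borrowed from cographs, where the sizes
  of a largest clique and a largest independent set multiply to at least the order of the graph:
  each set carries one sparse and one dense sequence, and the product of their lengths is at least
  polynomial in its size. Relative bounds on the edges between blocks would worsen whenever a block
  shrinks. Hence one absolute number \<open>t\<close> serves as robustness threshold at length
  \<open>e + 1\<close>, as threshold for being split and as degree bound between blocks throughout
  the recursion, and it is chosen below the size of the smallest block. The complement is the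
  pointwise negation of the relation, loops included, so that every notion passes to complements
  without corrections. The constant 1 / 100 only has to be small enough for numerical factors to be
  absorbed by powers.\<close>

definition nbs :: "('v \<Rightarrow> 'v \<Rightarrow> bool) \<Rightarrow> 'v \<Rightarrow> 'v set \<Rightarrow> 'v set" where
  "nbs E v S = {w \<in> S. E v w}"

text \<open>VC-dimension below \<open>D\<close> of the neighbourhood system on \<open>V\<close>,
  stated as a missing trace for each \<open>Y\<close> so that no maximum is involved. At
  \<open>D = 0\<close> it forces \<open>V\<close> to be empty, since the empty set has the same
  trace at every vertex.\<close>

definition no_shatter :: "('v \<Rightarrow> 'v \<Rightarrow> bool) \<Rightarrow> 'v set \<Rightarrow> nat \<Rightarrow> bool" where
  "no_shatter E V D \<longleftrightarrow> (\<forall>Y\<subseteq>V. card Y = D \<longrightarrow> (\<exists>P\<subseteq>Y. \<forall>v\<in>V. nbs E v Y \<noteq> P))"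

lemma finite_nbs [simp]: "finite S \<Longrightarrow> finite (nbs E v S)"
  by (simp add: nbs_def)

lemma nbs_subset: "nbs E v S \<subseteq> S"
  by (auto simp: nbs_def)

lemma no_shatterD:
  assumes "no_shatter E V D" "Y \<subseteq> V" "card Y = D"
  obtains P where "P \<subseteq> Y" "\<And>v. v \<in> V \<Longrightarrow> nbs E v Y \<noteq> P"
  using assms(1)[unfolded no_shatter_def, rule_format, OF assms(2,3)] by blast

lemma no_shatterI:
  assumes "\<And>Y. Y \<subseteq> V \<Longrightarrow> card Y = D \<Longrightarrow> \<exists>P\<subseteq>Y. \<forall>v\<in>V. nbs E v Y \<noteq> P"
  shows "no_shatter E V D"
  unfolding no_shatter_def using assms by simp

lemma no_shatter_subset:
  assumes "no_shatter E V D" "W \<subseteq> V" shows "no_shatter E W D"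
proof (rule no_shatterI)
  fix Y assume "Y \<subseteq> W" "card Y = D"
  then obtain P where "P \<subseteq> Y" "\<And>v. v \<in> V \<Longrightarrow> nbs E v Y \<noteq> P"
    using no_shatterD[OF assms(1), of Y] assms(2) by (metis subset_trans)
  then show "\<exists>P\<subseteq>Y. \<forall>v\<in>W. nbs E v Y \<noteq> P" using assms(2) by (intro exI[of _ P]) auto
qed

lemma no_shatter_compl:
  assumes "no_shatter E V D" shows "no_shatter (\<lambda>a b. \<not> E a b) V D"
proof (rule no_shatterI)
  fix Y assume Y: "Y \<subseteq> V" "card Y = D"
  obtain P where P: "P \<subseteq> Y" "\<And>v. v \<in> V \<Longrightarrow> nbs E v Y \<noteq> P"
    using no_shatterD[OF assms Y] by metis
  have "nbs (\<lambda>a b. \<not> E a b) v Y = Y - nbs E v Y" for v by (auto simp: nbs_def)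
  moreover have "Y - nbs E v Y \<noteq> Y - P" if "v \<in> V" for v
    using P(1) P(2)[OF that] nbs_subset[of E v Y] by blast
  ultimately show "\<exists>P\<subseteq>Y. \<forall>v\<in>V. nbs (\<lambda>a b. \<not> E a b) v Y \<noteq> P"
    by (intro exI[of _ "Y - P"]) simp
qed

definition shatters :: "'a set set \<Rightarrow> 'a set \<Rightarrow> bool" where
  "shatters F S \<longleftrightarrow> (\<forall>P\<subseteq>S. \<exists>A\<in>F. A \<inter> S = P)"

lemma shatters_mono: "shatters F S \<Longrightarrow> T \<subseteq> S \<Longrightarrow> shatters F T"
  unfolding shatters_def
proof (intro allI impI)
  fix P assume *: "\<forall>P\<subseteq>S. \<exists>A\<in>F. A \<inter> S = P" "T \<subseteq> S" "P \<subseteq> T"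
  then obtain A where A: "A \<in> F" "A \<inter> S = P" by (meson order_trans)
  then have "A \<inter> T = P" using *(2,3) by blast
  then show "\<exists>A\<in>F. A \<inter> T = P" using A by blast
qed

text \<open>Pajor's form of the Sauer--Shelah lemma: counting the shattered sets themselves lets the
  induction run. Removing \<open>x\<close> from all members merges the pairs \<open>A\<close>,
  \<open>insert x A\<close>; these pairs are recorded by \<open>F2\<close>, and whatever
  \<open>F2\<close> shatters can be enlarged by \<open>x\<close>.\<close>

lemma pajor:
  fixes X :: "'a set"
  assumes "finite X" "F \<subseteq> Pow X"
  shows "card F \<le> card {S \<in> Pow X. shatters F S}"
  using assms
proof (induction X arbitrary: F rule: finite_induct)
  case empty
  show ?case
  proof (cases "F = {}")
    case False
    then have F: "F = {{}}" using empty by auto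
    have "{S \<in> Pow ({} :: 'a set). shatters {{}} S} = {{}}" by (auto simp: shatters_def)
    then have "card {S \<in> Pow ({} :: 'a set). shatters {{}} S} = card {{} :: 'a set}" by (rule arg_cong)
    then show ?thesis unfolding F by simp
  qed simp
next
  case (insert x X)
  define F1 where "F1 = (\<lambda>A. A - {x}) ` F"
  define F2 where "F2 = {A \<in> F. x \<notin> A \<and> insert x A \<in> F}"
  define Fx where "Fx = {A \<in> F. x \<in> A}"
  define Fn where "Fn = {A \<in> F. x \<notin> A}"
  have finF: "finite F" by (rule finite_subset[OF insert.prems]) (use insert.hyps(1) in simp)
  have F1: "F1 \<subseteq> Pow X" and F2: "F2 \<subseteq> Pow X" using insert.prems by (auto simp: F1_def F2_def)
  have c1: "card F = card Fx + card Fn"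
  proof -
    have "F = Fx \<union> Fn" "Fx \<inter> Fn = {}" by (auto simp: Fx_def Fn_def)
    then show ?thesis using finF by (metis card_Un_disjoint finite_Un)
  qed
  have c2: "card Fx = card ((\<lambda>A. A - {x}) ` Fx)"
    by (rule card_image[symmetric]) (auto simp: inj_on_def Fx_def)
  have c3: "F1 = (\<lambda>A. A - {x}) ` Fx \<union> Fn"
  proof -
    have "F = Fx \<union> Fn" by (auto simp: Fx_def Fn_def)
    moreover have "(\<lambda>A. A - {x}) ` Fn = Fn" 
    proof -
      have "(\<lambda>A. A - {x}) ` Fn = (\<lambda>A. A) ` Fn" by (rule image_cong) (auto simp: Fn_def)
      then show ?thesis by simp
    qed
    ultimately show ?thesis by (metis F1_def image_Un)
  qed
  have inter: "(\<lambda>A. A - {x}) ` Fx \<inter> Fn = F2"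
  proof (intro equalityI subsetI)
    fix B assume "B \<in> (\<lambda>A. A - {x}) ` Fx \<inter> Fn"
    then obtain A where "A \<in> F" "x \<in> A" "B = A - {x}" "B \<in> F" by (auto simp: Fx_def Fn_def)
    then show "B \<in> F2" by (simp add: F2_def insert_absorb)
  next
    fix B assume "B \<in> F2"
    then have "B \<in> Fn" "insert x B \<in> Fx" "B = insert x B - {x}" by (auto simp: F2_def Fn_def Fx_def)
    then show "B \<in> (\<lambda>A. A - {x}) ` Fx \<inter> Fn" by blast
  qed
  have "finite ((\<lambda>A. A - {x}) ` Fx)" "finite Fn" using finF by (auto simp: Fx_def Fn_def)
  from card_Un_Int[OF this] have card: "card F = card F1 + card F2"
    by (simp only: c1 c2 c3 inter)
  let ?S1 = "{S \<in> Pow X. shatters F1 S}" and ?S2 = "{S \<in> Pow X. shatters F2 S}"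
  have sub1: "shatters F S" if S: "S \<subseteq> X" "shatters F1 S" for S
    unfolding shatters_def
  proof (intro allI impI)
    fix P assume "P \<subseteq> S"
    then obtain A where "A \<in> F" "(A - {x}) \<inter> S = P" using S(2) unfolding shatters_def F1_def by blast
    moreover have "x \<notin> S" using S(1) insert.hyps(2) by blast
    ultimately have "A \<inter> S = P" "A \<in> F" by blast+
    then show "\<exists>A\<in>F. A \<inter> S = P" by blast
  qed
  have sub2: "shatters F (insert x S)" if S: "S \<subseteq> X" "shatters F2 S" for S
    unfolding shatters_def
  proof (intro allI impI)
    fix P assume P: "P \<subseteq> insert x S"
    then have "P - {x} \<subseteq> S" by auto
    then obtain A where A: "A \<in> F2" "A \<inter> S = P - {x}" using S(2) unfolding shatters_def by blast
    show "\<exists>A\<in>F. A \<inter> insert x S = P"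
    proof (cases "x \<in> P")
      case True
      have "insert x A \<inter> insert x S = insert x (A \<inter> S)" by blast
      also have "\<dots> = P" using A(2) True by (simp add: insert_absorb)
      finally show ?thesis using A(1) unfolding F2_def by blast
    next
      case False
      have "A \<inter> insert x S = A \<inter> S" using A(1) by (auto simp: F2_def)
      also have "\<dots> = P" using A(2) False by simp
      finally show ?thesis using A(1) unfolding F2_def by blast
    qed
  qed
  have inj: "inj_on (insert x) ?S2"
  proof (rule inj_onI)
    fix S T assume "S \<in> ?S2" "T \<in> ?S2" "insert x S = insert x T"
    moreover from this have "x \<notin> S" "x \<notin> T" using insert.hyps(2) by blast+
    ultimately show "S = T" by (metis Diff_insert_absorb)
  qed
  have "card F \<le> card ?S1 + card ?S2"
    unfolding card by (rule add_mono[OF insert.IH[OF F1] insert.IH[OF F2]])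
  also have "\<dots> = card ?S1 + card (insert x ` ?S2)" by (simp only: card_image[OF inj])
  also have "\<dots> = card (?S1 \<union> insert x ` ?S2)"
  proof (rule card_Un_disjoint[symmetric])
    show "?S1 \<inter> insert x ` ?S2 = {}" using insert.hyps(2) by blast
    have "finite (Pow X)" using insert.hyps(1) by (simp only: finite_Pow_iff)
    then have fin: "finite {S \<in> Pow X. Q S}" for Q by (rule rev_finite_subset) blast
    show "finite ?S1" by (rule fin)
    show "finite (insert x ` ?S2)" by (rule finite_imageI, rule fin)
  qed
  also have "\<dots> \<le> card {S \<in> Pow (insert x X). shatters F S}"
  proof (rule card_mono)
    show "?S1 \<union> insert x ` ?S2 \<subseteq> {S \<in> Pow (insert x X). shatters F S}"
    proof (intro Un_least subsetI)
      fix S assume "S \<in> ?S1"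
      then show "S \<in> {S \<in> Pow (insert x X). shatters F S}" using sub1[of S] by simp blast
    next
      fix S' assume "S' \<in> insert x ` ?S2"
      then obtain S where "S' = insert x S" "S \<subseteq> X" "shatters F2 S" by blast
      then show "S' \<in> {S \<in> Pow (insert x X). shatters F S}" using sub2[of S] by simp blast
    qed
    show "finite {S \<in> Pow (insert x X). shatters F S}"
    proof (rule rev_finite_subset)
      show "finite (Pow (insert x X))" using insert.hyps(1) by (simp only: finite_Pow_iff finite_insert)
      show "{S \<in> Pow (insert x X). shatters F S} \<subseteq> Pow (insert x X)" by (rule Collect_restrict)
    qed
  qed
  finally show ?case .
qed

text \<open>Crude but sufficient: a set of at most \<open>Suc D\<close> elements arises from one of
  at most \<open>D\<close> by inserting one element or nothing, which \<open>g\<close> encodes by an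
  option.\<close>

lemma card_small_subsets:
  fixes Z :: "'a set"
  assumes "finite Z"
  shows "card {S \<in> Pow Z. card S \<le> D} \<le> (card Z + 1) ^ D"
proof (induction D)
  case 0
  have "S = {}" if "S \<subseteq> Z" "card S \<le> 0" for S
    using that finite_subset[OF that(1) assms] by simp
  then have "{S \<in> Pow Z. card S \<le> 0} = {{}}" by (intro equalityI subsetI) simp_all
  then show ?case by simp
next
  case (Suc D)
  define g :: "'a option \<times> 'a set \<Rightarrow> 'a set" where "g = (\<lambda>(q, S). case q of None \<Rightarrow> S | Some x \<Rightarrow> insert x S)"
  let ?T = "\<lambda>D. {S \<in> Pow Z. card S \<le> D}"
  have fin: "finite (insert None (Some ` Z) \<times> ?T D)" using assms by auto
  have "?T (Suc D) \<subseteq> g ` (insert None (Some ` Z) \<times> ?T D)"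
  proof
    fix S assume S: "S \<in> ?T (Suc D)"
    show "S \<in> g ` (insert None (Some ` Z) \<times> ?T D)"
    proof (cases "card S \<le> D")
      case True
      then have "(None, S) \<in> insert None (Some ` Z) \<times> ?T D" using S by auto
      then show ?thesis by (force simp: g_def)
    next
      case False
      then obtain x where x: "x \<in> S" by fastforce
      have "finite S" using S assms finite_subset by auto
      then have "card (S - {x}) \<le> D" using S x card_Diff_singleton[OF x] by auto
      then have "(Some x, S - {x}) \<in> insert None (Some ` Z) \<times> ?T D" using S x by auto
      moreover have "S = g (Some x, S - {x})" using x by (auto simp: g_def)
      ultimately show ?thesis by blast
    qed
  qed
  then have "card (?T (Suc D)) \<le> card (insert None (Some ` Z) \<times> ?T D)"
    using fin by (meson card_image_le card_mono finite_imageI order_trans)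
  also have "\<dots> = (card Z + 1) * card (?T D)"
    using assms by (simp add: card_cartesian_product card_image)
  also have "\<dots> \<le> (card Z + 1) * (card Z + 1) ^ D" using Suc by (intro mult_left_mono) auto
  finally show ?case by simp
qed

lemma card_le_of_not_shatters:
  assumes "finite X" "F \<subseteq> Pow X" "\<And>S. S \<subseteq> X \<Longrightarrow> card S = D \<Longrightarrow> \<not> shatters F S"
  shows "card F \<le> (card X + 1) ^ D"
proof -
  have "card S \<le> D" if "S \<subseteq> X" "shatters F S" for S
  proof (rule ccontr)
    assume "\<not> card S \<le> D"
    then obtain T where "T \<subseteq> S" "card T = D" by (meson nat_le_linear obtain_subset_with_card_n)
    then show False using assms(3)[of T] shatters_mono that by (meson order_trans)
  qed
  then have "card {S \<in> Pow X. shatters F S} \<le> card {S \<in> Pow X. card S \<le> D}"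
    using assms(1) by (intro card_mono) auto
  then show ?thesis using pajor[OF assms(1,2)] card_small_subsets[OF assms(1), of D] by linarith
qed

lemma card_traces:
  assumes "finite V" "Z \<subseteq> V" "no_shatter E V D"
  shows "card ((\<lambda>u. nbs E u Z) ` V) \<le> (card Z + 1) ^ D"
proof (rule card_le_of_not_shatters)
  show "finite Z" using assms finite_subset by blast
  show "(\<lambda>u. nbs E u Z) ` V \<subseteq> Pow Z" by (auto simp: nbs_def)
  fix S assume S: "S \<subseteq> Z" "card S = D"
  then have "S \<subseteq> V" using assms(2) by blast
  obtain P where P: "P \<subseteq> S" "\<And>v. v \<in> V \<Longrightarrow> nbs E v S \<noteq> P"
    using no_shatterD[OF assms(3) \<open>S \<subseteq> V\<close> S(2)] by metis
  have "nbs E v Z \<inter> S = nbs E v S" for v using S by (auto simp: nbs_def)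
  then show "\<not> shatters ((\<lambda>u. nbs E u Z) ` V) S" unfolding shatters_def using P by blast
qed

section \<open>Nets of vertices\<close>

definition differ :: "('v \<Rightarrow> 'v \<Rightarrow> bool) \<Rightarrow> 'v set \<Rightarrow> 'v \<Rightarrow> 'v \<Rightarrow> 'v set" where
  "differ E V x y = {u \<in> V. E x u \<noteq> E y u}"

definition separated :: "('v \<Rightarrow> 'v \<Rightarrow> bool) \<Rightarrow> 'v set \<Rightarrow> real \<Rightarrow> 'v set \<Rightarrow> bool" where
  "separated E V \<eta> P \<longleftrightarrow> P \<subseteq> V \<and>
    (\<forall>x\<in>P. \<forall>y\<in>P. x \<noteq> y \<longrightarrow> \<eta> * real (card V) < real (card (differ E V x y)))"

text \<open>Union bound over uniformly random lists of length \<open>r\<close>: a list misses the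
  vertices that tell a given pair apart with probability at most \<open>(1 - \<eta>) ^ r\<close>.
  Lists with repetition make the choices independent and easy to count.\<close>

lemma distinguishing_sample:
  assumes V: "finite V" and P: "separated E V \<eta> P" "finite P" and \<eta>: "0 < \<eta>" "\<eta> \<le> 1"
    and small: "real (card P) ^ 2 * (1 - \<eta>) ^ r < 1" and ne: "V \<noteq> {}"
  obtains Q where "Q \<subseteq> V" "card Q \<le> r" "\<And>x y. x \<in> P \<Longrightarrow> y \<in> P \<Longrightarrow> x \<noteq> y \<Longrightarrow> \<exists>u\<in>Q. E x u \<noteq> E y u"
proof -
  define L where "L A = {xs. set xs \<subseteq> A \<and> length xs = r}" for A :: "'a set"
  define pairs where "pairs = {z \<in> P \<times> P. fst z \<noteq> snd z}"
  define bad where "bad z = L (V - differ E V (fst z) (snd z))" for z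
  have finL: "finite (L A)" and cardL: "card (L A) = card A ^ r" if "finite A" for A
    unfolding L_def using that by (simp_all add: finite_lists_length_eq card_lists_length_eq)
  have finp: "finite pairs" unfolding pairs_def using P(2) by simp
  have cardp: "card pairs \<le> card P ^ 2"
  proof -
    have "card pairs \<le> card (P \<times> P)" unfolding pairs_def using P(2) by (intro card_mono) auto
    then show ?thesis by (simp add: card_cartesian_product power2_eq_square)
  qed
  have nV: "0 < real (card V)" using V ne by (simp add: card_gt_0_iff)
  have bad: "real (card (bad z)) \<le> (1 - \<eta>) ^ r * real (card V) ^ r" if z: "z \<in> pairs" for z
  proof -
    have d: "\<eta> * real (card V) < real (card (differ E V (fst z) (snd z)))"
      using z P(1) unfolding pairs_def separated_def by auto
    have sub: "differ E V (fst z) (snd z) \<subseteq> V" by (auto simp: differ_def)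
    then have "real (card (V - differ E V (fst z) (snd z))) = real (card V) - real (card (differ E V (fst z) (snd z)))"
      using V by (simp add: card_Diff_subset finite_subset of_nat_diff card_mono)
    then have "real (card (V - differ E V (fst z) (snd z))) \<le> (1 - \<eta>) * real (card V)"
      using d by (simp add: algebra_simps)
    then have "real (card (V - differ E V (fst z) (snd z))) ^ r \<le> ((1 - \<eta>) * real (card V)) ^ r"
      by (intro power_mono) auto
    then show ?thesis unfolding bad_def using V by (simp add: cardL power_mult_distrib)
  qed
  have "real (card (\<Union>z\<in>pairs. bad z)) \<le> (\<Sum>z\<in>pairs. real (card (bad z)))"
    using card_UN_le[OF finp, of bad] by (metis of_nat_le_iff of_nat_sum)
  also have "\<dots> \<le> (\<Sum>z\<in>pairs. (1 - \<eta>) ^ r * real (card V) ^ r)"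
    using bad by (rule sum_mono)
  also have "\<dots> = real (card pairs) * ((1 - \<eta>) ^ r * real (card V) ^ r)" by simp
  also have "\<dots> \<le> real (card P) ^ 2 * ((1 - \<eta>) ^ r * real (card V) ^ r)"
  proof (rule mult_right_mono)
    show "real (card pairs) \<le> real (card P) ^ 2" using cardp by (metis of_nat_le_iff of_nat_power)
  qed (use \<eta> in simp)
  also have "\<dots> = (real (card P) ^ 2 * (1 - \<eta>) ^ r) * real (card V) ^ r" by simp
  also have "\<dots> < 1 * real (card V) ^ r" using small nV by (intro mult_strict_right_mono) auto
  also have "\<dots> = real (card (L V))" using cardL[OF V] by simp
  finally have "card (\<Union>z\<in>pairs. bad z) < card (L V)" by simp
  then have "\<not> L V \<subseteq> (\<Union>z\<in>pairs. bad z)"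
    using finp finL V by (metis (no_types, lifting) bad_def card_mono finite_Diff finite_UN not_less)
  then obtain xs where xs: "xs \<in> L V" "\<And>z. z \<in> pairs \<Longrightarrow> xs \<notin> bad z" by auto
  show thesis
  proof (rule that[of "set xs"])
    show "set xs \<subseteq> V" using xs(1) by (simp add: L_def)
    show "card (set xs) \<le> r" using xs(1) card_length[of xs] by (simp add: L_def)
    fix x y assume "x \<in> P" "y \<in> P" "x \<noteq> y"
    then have "(x, y) \<in> pairs" by (simp add: pairs_def)
    from xs(2)[OF this] xs(1) show "\<exists>u\<in>set xs. E x u \<noteq> E y u"
      unfolding bad_def L_def differ_def by auto
  qed
qed

text \<open>A packing bound in the style of Haussler: a short sample distinguishes all points of
  \<open>P\<close>, and the Sauer--Shelah bound limits the number of traces on that sample.\<close>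

lemma separated_card_less:
  assumes V: "finite V" and nosh: "no_shatter E V D" and P: "separated E V \<eta> P"
    and \<eta>: "0 < \<eta>" "\<eta> \<le> 1" and q: "(4 * real D + 4) / \<eta> \<le> real q" and ne: "V \<noteq> {}"
  shows "card P < q ^ (2 * D)"
proof (rule ccontr)
  assume "\<not> ?thesis"
  \<comment> \<open>The sample length must grow with the number of pairs, so the set is first cut
    down to exactly \<open>q ^ (2 * D)\<close> points.\<close>
  then obtain P' where P': "P' \<subseteq> P" "card P' = q ^ (2 * D)"
    by (meson not_less obtain_subset_with_card_n)
  have sep: "separated E V \<eta> P'" using P P'(1) unfolding separated_def by (meson subset_iff)
  then have PV: "P' \<subseteq> V" by (simp add: separated_def)
  have D: "0 < D"
  proof (rule ccontr)
    assume "\<not> 0 < D"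
    then show False using no_shatterD[OF nosh, of "{}"] ne by (auto simp: nbs_def)
  qed
  have "4 * real D + 4 \<le> real q * \<eta>" using q \<eta> by (simp add: field_simps)
  moreover have "real q * \<eta> \<le> real q" using \<eta> by (simp add: mult_left_le)
  ultimately have q4: "4 * real D + 4 \<le> real q" by linarith
  \<comment> \<open>Makes \<open>\<eta> * r\<close> at least \<open>4 * D * q\<close>. Then
    \<open>(1 + z / n) ^ n \<le> exp z\<close> with \<open>n = 4 * D\<close> beats the squared size
    \<open>q ^ (4 * D)\<close> without logarithms, while \<open>r + 1\<close> stays below
    \<open>q ^ 2\<close>.\<close>
  define x where "x = 4 * real D * real q / \<eta>"
  define r where "r = nat \<lceil>x\<rceil>"
  have x0: "0 \<le> x" using \<eta> by (simp add: x_def)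
  have r: "x \<le> real r" "real r < x + 1" unfolding r_def using x0 by linarith+
  have q0: "0 < real q" using q4 by simp
  have e1: "1 - \<eta> \<le> exp (- \<eta>)" using exp_ge_add_one_self[of "- \<eta>"] by simp
  have e2: "(1 - \<eta>) ^ r \<le> exp (- (\<eta> * real r))"
  proof -
    have "(1 - \<eta>) ^ r \<le> exp (- \<eta>) ^ r" using e1 \<eta> by (intro power_mono) auto
    also have "\<dots> = exp (real r * (- \<eta>))" by (simp only: exp_of_nat_mult)
    finally show ?thesis by (simp add: mult.commute)
  qed
  have e3: "real q \<le> \<eta> * real r / real (4 * D)"
  proof -
    have "x * \<eta> \<le> real r * \<eta>" using r(1) \<eta> by (intro mult_right_mono) auto
    then have "4 * real D * real q \<le> real r * \<eta>" using \<eta> by (simp add: x_def)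
    then show ?thesis using D by (simp add: field_simps)
  qed
  have e4: "real q ^ (4 * D) < exp (\<eta> * real r)"
  proof -
    have "real q ^ (4 * D) < (1 + \<eta> * real r / real (4 * D)) ^ (4 * D)"
      using e3 q0 D by (intro power_strict_mono) auto
    also have "\<dots> \<le> exp (\<eta> * real r)"
      using D \<eta> by (intro exp_ge_one_plus_x_over_n_power_n) (auto intro: order_trans[of _ 0])
    finally show ?thesis .
  qed
  have small: "real (card P') ^ 2 * (1 - \<eta>) ^ r < 1"
  proof -
    have "real (card P') ^ 2 = real q ^ (4 * D)" unfolding P'(2) by (simp add: power_mult[symmetric] mult.commute)
    then have "real (card P') ^ 2 * (1 - \<eta>) ^ r \<le> real q ^ (4 * D) * exp (- (\<eta> * real r))"
      using e2 by (simp add: mult_left_mono)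
    also have "\<dots> < exp (\<eta> * real r) * exp (- (\<eta> * real r))"
      using e4 by (intro mult_strict_right_mono) auto
    also have "\<dots> = 1" by (simp add: exp_minus)
    finally show ?thesis .
  qed
  have finP: "finite P'" using PV V finite_subset by blast
  obtain Q where Q: "Q \<subseteq> V" "card Q \<le> r" "\<And>x y. x \<in> P' \<Longrightarrow> y \<in> P' \<Longrightarrow> x \<noteq> y \<Longrightarrow> \<exists>u\<in>Q. E x u \<noteq> E y u"
    using distinguishing_sample[OF V sep finP \<eta> small ne] by metis
  have "inj_on (\<lambda>u. nbs E u Q) P'"
  proof (rule inj_onI, rule ccontr)
    fix a b assume ab: "a \<in> P'" "b \<in> P'" "nbs E a Q = nbs E b Q" "a \<noteq> b"
    obtain u where "u \<in> Q" "E a u \<noteq> E b u" using Q(3)[OF ab(1,2,4)] by blast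
    then show False using ab(3) by (auto simp: nbs_def)
  qed
  then have "card P' = card ((\<lambda>u. nbs E u Q) ` P')" by (simp add: card_image)
  also have "\<dots> \<le> card ((\<lambda>u. nbs E u Q) ` V)" using V PV by (intro card_mono) auto
  also have "\<dots> \<le> (card Q + 1) ^ D" by (rule card_traces[OF V Q(1) nosh])
  also have "\<dots> \<le> (r + 1) ^ D" using Q(2) by (intro power_mono) auto
  also have "\<dots> < (q ^ 2) ^ D"
  proof (rule power_strict_mono)
    have "x + 2 < real q * real q"
    proof -
      have "(4 * real D + 4) / \<eta> * real q \<le> real q * real q" using q q0 by (intro mult_right_mono) auto
      moreover have "(4 * real D + 4) / \<eta> * real q = x + 4 * real q / \<eta>" by (simp add: x_def add_divide_distrib algebra_simps)
      moreover have "4 * real q \<le> 4 * real q / \<eta>" using \<eta> q0 by (simp add: field_simps)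
      ultimately show ?thesis using q4 by linarith
    qed
    then have "real r + 1 < real q * real q" using r by linarith
    then have "real (r + 1) < real (q ^ 2)" by (simp add: power2_eq_square)
    then show "r + 1 < q ^ 2" by (simp only: of_nat_less_iff)
  qed (use D in auto)
  finally show False using P'(2) by (simp add: power_mult)
qed

text \<open>A separated set of maximal size is a net, since a vertex far from all its points could
  be added.\<close>

lemma net:
  assumes V: "finite V" and nosh: "no_shatter E V D"
    and \<eta>: "0 < \<eta>" "\<eta> \<le> 1" and q: "(4 * real D + 4) / \<eta> \<le> real q" and ne: "V \<noteq> {}"
  obtains Z where "Z \<subseteq> V" "card Z \<le> q ^ (2 * D)"
    "\<And>z. z \<in> V \<Longrightarrow> \<exists>z'\<in>Z. real (card (differ E V z z')) \<le> \<eta> * real (card V)"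
proof -
  define F where "F = {P. separated E V \<eta> P}"
  have FV: "F \<subseteq> Pow V" by (auto simp: F_def separated_def)
  have "{} \<in> F" by (simp add: F_def separated_def)
  moreover have finF: "finite F" using FV V finite_subset by (metis finite_Pow_iff)
  ultimately obtain Z where Z: "Z \<in> F" "\<And>P. P \<in> F \<Longrightarrow> card P \<le> card Z"
    using Max_in[of "card ` F"] Max_ge[of "card ` F"] by (metis (no_types, lifting) empty_iff finite_imageI image_iff)
  have ZV: "Z \<subseteq> V" and finZ: "finite Z" using Z(1) FV V finite_subset by blast+
  have sepZ: "separated E V \<eta> Z" using Z(1) by (simp add: F_def)
  have sym: "differ E V x y = differ E V y x" for x y by (auto simp: differ_def)
  show thesis
  proof (rule that[OF ZV])
    show "card Z \<le> q ^ (2 * D)" using separated_card_less[OF V nosh sepZ \<eta> q ne] by simp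
    fix z assume z: "z \<in> V"
    show "\<exists>z'\<in>Z. real (card (differ E V z z')) \<le> \<eta> * real (card V)"
    proof (rule ccontr)
      assume "\<not> ?thesis"
      then have far: "\<eta> * real (card V) < real (card (differ E V z z'))" if "z' \<in> Z" for z'
        using that by (meson not_le)
      have "z \<notin> Z"
      proof
        assume "z \<in> Z"
        from far[OF this] show False using \<eta> by (simp add: differ_def mult_less_0_iff)
      qed
      have "separated E V \<eta> (insert z Z)"
        unfolding separated_def
      proof (intro conjI ballI impI)
        show "insert z Z \<subseteq> V" using z ZV by blast
        fix x y assume xy: "x \<in> insert z Z" "y \<in> insert z Z" "x \<noteq> y"
        show "\<eta> * real (card V) < real (card (differ E V x y))"
        proof (cases "x = z")
          case True then show ?thesis using far[of y] xy by auto
        next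
          case False
          show ?thesis
          proof (cases "y = z")
            case True then show ?thesis using far[of x] xy sym[of x y] by auto
          next
            case False
            then show ?thesis using sepZ xy \<open>x \<noteq> z\<close> unfolding separated_def by auto
          qed
        qed
      qed
      then have "card (insert z Z) \<le> card Z" using Z(2) by (simp add: F_def)
      then show False using \<open>z \<notin> Z\<close> finZ by simp
    qed
  qed
qed

section \<open>Rich sets and splitting\<close>

definition pattern_class :: "('v \<Rightarrow> 'v \<Rightarrow> bool) \<Rightarrow> 'v list \<Rightarrow> bool list \<Rightarrow> 'v set \<Rightarrow> 'v set" where
  "pattern_class E zs bs W = {u \<in> W. list_all2 (\<lambda>z b. E z u = b) zs bs}"

text \<open>The threshold \<open>\<tau>\<close> is an absolute count and not a share of
  \<open>W\<close>, so that failing to be robust passes to subsets. The list may repeat vertices,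
  but a positive \<open>\<tau>\<close> already makes it distinct.\<close>

definition robust :: "('v \<Rightarrow> 'v \<Rightarrow> bool) \<Rightarrow> real \<Rightarrow> nat \<Rightarrow> 'v set \<Rightarrow> bool" where
  "robust E \<tau> e W \<longleftrightarrow> (\<exists>zs. length zs = e \<and> set zs \<subseteq> W \<and>
     (\<forall>bs. length bs = e \<longrightarrow> \<tau> \<le> real (card (pattern_class E zs bs W))))"

lemma robust_mono:
  assumes "robust E \<tau> e W" "W \<subseteq> W'" "finite W'" "\<tau>' \<le> \<tau>"
  shows "robust E \<tau>' e W'"
proof -
  obtain zs where zs: "length zs = e" "set zs \<subseteq> W"
    "\<And>bs. length bs = e \<Longrightarrow> \<tau> \<le> real (card (pattern_class E zs bs W))"
    using assms(1) unfolding robust_def by blast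
  have "\<tau>' \<le> real (card (pattern_class E zs bs W'))" if "length bs = e" for bs
  proof -
    have "card (pattern_class E zs bs W) \<le> card (pattern_class E zs bs W')"
      using assms(2,3) by (intro card_mono) (auto simp: pattern_class_def)
    then show ?thesis using zs(3)[OF that] assms(4) by linarith
  qed
  then show ?thesis using zs assms(2) unfolding robust_def by blast
qed

lemma pattern_class_compl:
  "length zs = length bs \<Longrightarrow> pattern_class (\<lambda>a b. \<not> E a b) zs bs W = pattern_class E zs (map Not bs) W"
  by (auto simp: pattern_class_def list_all2_conv_all_nth)

lemma robust_compl:
  assumes "robust (\<lambda>a b. \<not> E a b) \<tau> e W" shows "robust E \<tau> e W"
proof -
  obtain zs where zs: "length zs = e" "set zs \<subseteq> W"
    "\<And>bs. length bs = e \<Longrightarrow> \<tau> \<le> real (card (pattern_class (\<lambda>a b. \<not> E a b) zs bs W))"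
    using assms unfolding robust_def by blast
  have "\<tau> \<le> real (card (pattern_class E zs bs W))" if "length bs = e" for bs
    using zs(3)[of "map Not bs"] that zs(1) pattern_class_compl[of zs "map Not bs" E W]
    by (simp add: comp_def)
  then show ?thesis using zs unfolding robust_def by blast
qed

definition cell :: "('v \<Rightarrow> 'v \<Rightarrow> bool) \<Rightarrow> 'v set \<Rightarrow> 'v set \<Rightarrow> 'v set \<Rightarrow> 'v set" where
  "cell E Z W T = {u \<in> W. nbs E u Z = T}"

definition splits :: "('v \<Rightarrow> 'v \<Rightarrow> bool) \<Rightarrow> real \<Rightarrow> 'v \<Rightarrow> 'v set \<Rightarrow> bool" where
  "splits E t v b \<longleftrightarrow> t \<le> real (card (nbs E v b)) \<and> t \<le> real (card (b - nbs E v b))"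

text \<open>
  If every large trace class over a net were split by many vertices, some \<open>v\<close> would split classes covering
  much of \<open>W\<close>. A robust tuple of their union can be moved to net points; each pattern over those then
  contains a whole class split by \<open>v\<close>, so prepending \<open>v\<close> gives a robust tuple of length \<open>e + 1\<close>.
\<close>

lemma split:
  assumes W: "finite W" "W \<noteq> {}" and sym: "symp E" and nosh: "no_shatter E W D"
    and p: "0 < p" "p \<le> 1" and \<kappa>: "0 < \<kappa>" "\<kappa> \<le> 1"
    and rich: "\<And>W'. W' \<subseteq> W \<Longrightarrow> p / 2 * real (card W) \<le> real (card W') \<Longrightarrow> robust E (\<kappa> * real (card W')) e W'"
    and notrob: "\<not> robust E t (Suc e) W"
    and q: "(4 * real D + 4) * (2 * (real e + 1)) / (\<kappa> * p) \<le> real q"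
  obtains b where "b \<subseteq> W" "real (card W) \<le> real (card b) * (2 * (real q ^ (2 * D) + 1) ^ D)"
    "real (card {v \<in> W. splits E t v b}) \<le> p * real (card W)"
proof -
  \<comment> \<open>Moving one point of a tuple to the net changes adjacency at no more than
    \<open>\<eta> * n\<close> vertices. For all \<open>e\<close> points this stays below
    \<open>\<kappa> * (p / 2 * n)\<close>, the guaranteed size of a pattern class.\<close>
  define \<eta> where "\<eta> = \<kappa> * p / (2 * (real e + 1))"
  have kp: "0 < \<kappa> * p" "\<kappa> * p \<le> 1" using p \<kappa> by (auto simp: mult_le_one)
  have \<eta>: "0 < \<eta>" "\<eta> \<le> 1" unfolding \<eta>_def using kp by (auto simp: field_simps)
  have "(4 * real D + 4) / \<eta> \<le> real q" using q by (simp add: \<eta>_def)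
  then obtain Z where Z: "Z \<subseteq> W" "card Z \<le> q ^ (2 * D)"
    "\<And>z. z \<in> W \<Longrightarrow> \<exists>z'\<in>Z. real (card (differ E W z z')) \<le> \<eta> * real (card W)"
    using net[OF W(1) nosh \<eta> _ W(2)] by metis
  define T where "T = (\<lambda>u. nbs E u Z) ` W"
  define N where "N = (real q ^ (2 * D) + 1) ^ D"
  define n where "n = real (card W)"
  have n0: "0 < n" unfolding n_def using W by (simp add: card_gt_0_iff)
  have N0: "0 < N" unfolding N_def by (intro zero_less_power add_nonneg_pos) auto
  have finT: "finite T" using W by (simp add: T_def)
  have cT: "real (card T) \<le> N"
  proof -
    have "card T \<le> (card Z + 1) ^ D" unfolding T_def by (rule card_traces[OF W(1) Z(1) nosh])
    also have "\<dots> \<le> (q ^ (2 * D) + 1) ^ D" using Z(2) by (intro power_mono) auto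
    finally have "real (card T) \<le> real ((q ^ (2 * D) + 1) ^ D)" by (simp only: of_nat_le_iff)
    then show ?thesis by (simp add: N_def add.commute)
  qed
  have fincell: "finite (cell E Z W \<tau>)" for \<tau> using W by (simp add: cell_def)
  have cellW: "cell E Z W \<tau> \<subseteq> W" for \<tau> by (auto simp: cell_def)
  have disj: "cell E Z W \<tau> \<inter> cell E Z W \<tau>' = {}" if "\<tau> \<noteq> \<tau>'" for \<tau> \<tau>'
    using that by (auto simp: cell_def)
  have Wsum: "n = (\<Sum>\<tau>\<in>T. real (card (cell E Z W \<tau>)))"
  proof -
    have "W = (\<Union>\<tau>\<in>T. cell E Z W \<tau>)" by (auto simp: cell_def T_def)
    then have "card W = (\<Sum>\<tau>\<in>T. card (cell E Z W \<tau>))"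
      using card_UN_disjoint[OF finT, of "cell E Z W"] fincell disj by auto
    then show ?thesis by (simp add: n_def)
  qed
  \<comment> \<open>There are at most \<open>N\<close> classes, so those smaller than
    \<open>n / (2 * N)\<close> cover at most half of \<open>W\<close>.\<close>
  define big where "big = {\<tau>\<in>T. n \<le> real (card (cell E Z W \<tau>)) * (2 * N)}"
  have finbig: "finite big" using finT by (simp add: big_def)
  have bigsum: "n / 2 \<le> (\<Sum>\<tau>\<in>big. real (card (cell E Z W \<tau>)))"
  proof -
    have "(\<Sum>\<tau>\<in>T - big. real (card (cell E Z W \<tau>))) \<le> (\<Sum>\<tau>\<in>T - big. n / (2 * N))"
      using N0 by (intro sum_mono) (auto simp: big_def field_simps)
    also have "\<dots> = real (card (T - big)) * (n / (2 * N))" by simp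
    also have "\<dots> \<le> N * (n / (2 * N))"
    proof (rule mult_right_mono)
      have "card (T - big) \<le> card T" using finT by (intro card_mono) auto
      then show "real (card (T - big)) \<le> N" using cT by linarith
    qed (use n0 N0 in simp)
    also have "\<dots> = n / 2" using N0 by simp
    finally have "(\<Sum>\<tau>\<in>T - big. real (card (cell E Z W \<tau>))) \<le> n / 2" .
    moreover have "(\<Sum>\<tau>\<in>T. real (card (cell E Z W \<tau>))) =
      (\<Sum>\<tau>\<in>T - big. real (card (cell E Z W \<tau>))) + (\<Sum>\<tau>\<in>big. real (card (cell E Z W \<tau>)))"
      using finT by (intro sum.subset_diff) (auto simp: big_def)
    ultimately show ?thesis using Wsum by linarith
  qed
  have "\<exists>\<tau>\<in>big. real (card {v \<in> W. splits E t v (cell E Z W \<tau>)}) \<le> p * n"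
  proof (rule ccontr)
    assume "\<not> ?thesis"
    then have many: "p * n < real (card {v \<in> W. splits E t v (cell E Z W \<tau>)})" if "\<tau> \<in> big" for \<tau>
      using that by (meson not_le)
    define B where "B v = {\<tau>\<in>big. splits E t v (cell E Z W \<tau>)}" for v
    have finB: "finite (B v)" for v using finbig by (simp add: B_def)
    \<comment> \<open>Double counting of pairs of a class and a vertex splitting it, weighted by the
      size of the class: an average vertex splits classes of total size at least
      \<open>p / 2 * n\<close>.\<close>
    have "\<exists>v\<in>W. p / 2 * n \<le> (\<Sum>\<tau>\<in>B v. real (card (cell E Z W \<tau>)))"
    proof (rule ccontr)
      assume "\<not> ?thesis"
      then have less: "(\<Sum>\<tau>\<in>B v. real (card (cell E Z W \<tau>))) < p / 2 * n" if "v \<in> W" for v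
        using that by (meson not_le)
      have "p * n * (n / 2) \<le> p * n * (\<Sum>\<tau>\<in>big. real (card (cell E Z W \<tau>)))"
        using bigsum p n0 by (intro mult_left_mono) auto
      also have "\<dots> = (\<Sum>\<tau>\<in>big. p * n * real (card (cell E Z W \<tau>)))" by (rule sum_distrib_left)
      also have "\<dots> \<le> (\<Sum>\<tau>\<in>big. real (card {v \<in> W. splits E t v (cell E Z W \<tau>)}) * real (card (cell E Z W \<tau>)))"
        using many by (intro sum_mono mult_right_mono) (auto intro: less_imp_le)
      also have "\<dots> = (\<Sum>\<tau>\<in>big. \<Sum>v\<in>{v \<in> W. splits E t v (cell E Z W \<tau>)}. real (card (cell E Z W \<tau>)))"
        by simp
      also have "\<dots> = (\<Sum>v\<in>W. \<Sum>\<tau>\<in>B v. real (card (cell E Z W \<tau>)))"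
        unfolding B_def using finbig W(1) by (intro sum.swap_restrict) auto
      also have "\<dots> < (\<Sum>v\<in>W. p / 2 * n)" using W less by (intro sum_strict_mono) auto
      also have "\<dots> = n * (p / 2 * n)" by (simp add: n_def)
      finally show False by (simp add: field_simps)
    qed
    then obtain v where v: "v \<in> W" "p / 2 * n \<le> (\<Sum>\<tau>\<in>B v. real (card (cell E Z W \<tau>)))" by blast
    define Wv where "Wv = (\<Union>\<tau>\<in>B v. cell E Z W \<tau>)"
    have WvW: "Wv \<subseteq> W" using cellW by (auto simp: Wv_def)
    have finWv: "finite Wv" using WvW W(1) finite_subset by blast
    have "card Wv = (\<Sum>\<tau>\<in>B v. card (cell E Z W \<tau>))"
      unfolding Wv_def using finB fincell disj by (intro card_UN_disjoint) auto
    then have cWv: "p / 2 * n \<le> real (card Wv)" using v(2) by simp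
    have "robust E (\<kappa> * real (card Wv)) e Wv" using rich[OF WvW] cWv by (simp add: n_def)
    then obtain zs where zs: "length zs = e" "set zs \<subseteq> Wv"
      "\<And>bs. length bs = e \<Longrightarrow> \<kappa> * real (card Wv) \<le> real (card (pattern_class E zs bs Wv))"
      unfolding robust_def by blast
    have "\<forall>z\<in>W. \<exists>z'. z' \<in> Z \<and> real (card (differ E W z z')) \<le> \<eta> * n" using Z(3) by (auto simp: n_def)
    then obtain f where f: "\<And>z. z \<in> W \<Longrightarrow> f z \<in> Z \<and> real (card (differ E W z (f z))) \<le> \<eta> * n"
      using bchoice[of W] by metis
    define zs' where "zs' = map f zs"
    have zsW: "set zs \<subseteq> W" using zs(2) WvW by blast
    have zs'Z: "set zs' \<subseteq> Z" using zsW f by (auto simp: zs'_def)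
    have contains: "\<exists>\<tau>\<in>B v. cell E Z W \<tau> \<subseteq> pattern_class E zs' bs W" if bs: "length bs = e" for bs
    proof -
      define X where "X = (\<Union>z\<in>set zs. differ E W z (f z))"
      have finX: "finite X" unfolding X_def differ_def using W(1) by auto
      have "card X \<le> (\<Sum>z\<in>set zs. card (differ E W z (f z)))" unfolding X_def by (intro card_UN_le) simp
      then have "real (card X) \<le> (\<Sum>z\<in>set zs. real (card (differ E W z (f z))))"
        by (metis of_nat_le_iff of_nat_sum)
      also have "\<dots> \<le> (\<Sum>z\<in>set zs. \<eta> * n)" using f zsW by (intro sum_mono) auto
      also have "\<dots> = real (card (set zs)) * (\<eta> * n)" by simp
      also have "\<dots> \<le> real e * (\<eta> * n)"
        using zs(1) card_length[of zs] \<eta> n0 by (intro mult_right_mono) auto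
      also have "\<dots> < (real e + 1) * (\<eta> * n)" using \<eta> n0 by (intro mult_strict_right_mono) auto
      also have "\<dots> = \<kappa> * (p / 2 * n)" by (simp add: \<eta>_def field_simps)
      also have "\<dots> \<le> \<kappa> * real (card Wv)" using cWv \<kappa> by (intro mult_left_mono) auto
      also have "\<dots> \<le> real (card (pattern_class E zs bs Wv))" by (rule zs(3)[OF bs])
      finally have "card X < card (pattern_class E zs bs Wv)" by simp
      then have "\<not> pattern_class E zs bs Wv \<subseteq> X" using card_mono[OF finX] by (meson not_le)
      then obtain u where u: "u \<in> pattern_class E zs bs Wv" "u \<notin> X" by blast
      then have uWv: "u \<in> Wv" by (simp add: pattern_class_def)
      then obtain \<tau> where \<tau>: "\<tau> \<in> B v" "u \<in> cell E Z W \<tau>" by (auto simp: Wv_def)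
      \<comment> \<open>Outside \<open>X\<close>, the vertex \<open>u\<close> is related alike to
        the tuple and to the moved tuple. The latter lies in the net, on which the whole class of
        \<open>u\<close> agrees with \<open>u\<close>.\<close>
      have "cell E Z W \<tau> \<subseteq> pattern_class E zs' bs W"
      proof
        fix w assume w: "w \<in> cell E Z W \<tau>"
        have eq: "E (f z) w = E z u" if z: "z \<in> set zs" for z
        proof -
          have "z \<in> W" using z zsW by blast
          then have fz: "f z \<in> Z" using f by blast
          have "nbs E w Z = nbs E u Z" using w \<tau>(2) by (simp add: cell_def)
          then have "E w (f z) = E u (f z)" using fz by (auto simp: nbs_def)
          moreover have "E z u = E (f z) u" using u(2) z uWv WvW by (auto simp: X_def differ_def)
          ultimately show ?thesis using sym by (metis sympD)
        qed
        have "list_all2 (\<lambda>z b. E z u = b) zs bs" using u(1) by (simp add: pattern_class_def)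
        then have "list_all2 (\<lambda>z b. E z w = b) zs' bs"
          unfolding zs'_def list_all2_conv_all_nth using eq by (auto simp: nth_mem)
        then show "w \<in> pattern_class E zs' bs W" using w cellW by (auto simp: pattern_class_def)
      qed
      then show ?thesis using \<tau>(1) by blast
    qed
    have "robust E t (Suc e) W"
      unfolding robust_def
    proof (intro exI[of _ "v # zs'"] conjI allI impI)
      show "length (v # zs') = Suc e" using zs(1) by (simp add: zs'_def)
      show "set (v # zs') \<subseteq> W" using v(1) zs'Z Z(1) by auto
      fix bs :: "bool list" assume "length bs = Suc e"
      then obtain c cs where bs: "bs = c # cs" "length cs = e" by (auto simp: length_Suc_conv)
      obtain \<tau> where \<tau>: "\<tau> \<in> B v" "cell E Z W \<tau> \<subseteq> pattern_class E zs' cs W" using contains[OF bs(2)] by blast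
      let ?A = "cell E Z W \<tau>"
      have spl: "splits E t v ?A" using \<tau>(1) by (simp add: B_def)
      have "(if c then nbs E v ?A else ?A - nbs E v ?A) \<subseteq> pattern_class E (v # zs') bs W"
        using \<tau>(2) cellW unfolding pattern_class_def nbs_def bs(1) by auto
      then have "card (if c then nbs E v ?A else ?A - nbs E v ?A) \<le> card (pattern_class E (v # zs') bs W)"
        using W(1) by (intro card_mono) (auto simp: pattern_class_def)
      then show "t \<le> real (card (pattern_class E (v # zs') bs W))"
        using spl unfolding splits_def by (cases c) auto
    qed
    then show False using notrob by blast
  qed
  then obtain \<tau> where \<tau>: "\<tau> \<in> big" "real (card {v \<in> W. splits E t v (cell E Z W \<tau>)}) \<le> p * n" by blast
  show thesis
  proof (rule that[OF cellW[of \<tau>]])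
    show "real (card W) \<le> real (card (cell E Z W \<tau>)) * (2 * (real q ^ (2 * D) + 1) ^ D)"
      using \<tau>(1) by (simp add: big_def n_def N_def)
    show "real (card {v \<in> W. splits E t v (cell E Z W \<tau>)}) \<le> p * real (card W)"
      using \<tau>(2) by (simp add: n_def)
  qed
qed

section \<open>Restricted sets\<close>

definition sparse :: "('v \<Rightarrow> 'v \<Rightarrow> bool) \<Rightarrow> real \<Rightarrow> 'v set \<Rightarrow> bool" where
  "sparse E y S \<longleftrightarrow> (\<forall>v\<in>S. real (card (nbs E v S)) \<le> y * real (card S))"

definition restricted :: "('v \<Rightarrow> 'v \<Rightarrow> bool) \<Rightarrow> real \<Rightarrow> 'v set \<Rightarrow> bool" where
  "restricted E y S \<longleftrightarrow> sparse E y S \<or> sparse (\<lambda>a b. \<not> E a b) y S"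

lemma sparse_mono: "sparse E y S \<Longrightarrow> y \<le> y' \<Longrightarrow> sparse E y' S"
  unfolding sparse_def by (meson mult_right_mono of_nat_0_le_iff order_trans)

lemma restricted_mono: "restricted E y S \<Longrightarrow> y \<le> y' \<Longrightarrow> restricted E y' S"
  unfolding restricted_def using sparse_mono by blast

lemma restricted_compl: "restricted (\<lambda>a b. \<not> E a b) y S \<longleftrightarrow> restricted E y S"
  by (auto simp: restricted_def)

text \<open>Exactly one of \<open>E\<close> and its negation has a loop at \<open>w\<close>, so the
  other is empty on \<open>{w}\<close>. This witness disposes of all size bounds that are at most
  1.\<close>

lemma restricted_singleton: "0 \<le> y \<Longrightarrow> restricted E y {w}"
proof -
  assume y: "0 \<le> y"
  have *: "nbs F w {w} = (if F w w then {w} else {})" for F :: "'a \<Rightarrow> 'a \<Rightarrow> bool" by (auto simp: nbs_def)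
  show ?thesis using y by (cases "E w w") (simp_all add: restricted_def sparse_def *)
qed

text \<open>The polynomial Roedl property (a set of relative size polynomial in
  \<open>\<epsilon>\<close> that is nearly empty or nearly complete), granted only where
  \<open>e\<close>-tuples fail to be robust. One exponent \<open>C\<close> gives both the threshold
  and the size bound. The property is vacuous at \<open>e = 0\<close>; at \<open>e = D\<close> and
  for symmetric \<open>E\<close>, failure of robustness follows from \<open>no_shatter\<close>,
  which is where the induction ends.\<close>

definition rank_bound :: "('v \<Rightarrow> 'v \<Rightarrow> bool) \<Rightarrow> nat \<Rightarrow> nat \<Rightarrow> nat \<Rightarrow> bool" where
  "rank_bound E D e C \<longleftrightarrow> (\<forall>\<epsilon> V. 0 < \<epsilon> \<longrightarrow> \<epsilon> \<le> 1 / 100 \<longrightarrow> finite V \<longrightarrow> V \<noteq> {} \<longrightarrow> no_shatter E V D \<longrightarrow>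
     \<not> robust E (\<epsilon> ^ C * real (card V)) e V \<longrightarrow>
     (\<exists>S\<subseteq>V. restricted E \<epsilon> S \<and> \<epsilon> ^ C * real (card V) \<le> real (card S)))"

lemma rank_boundD:
  assumes "rank_bound E D e C" "0 < \<epsilon>" "\<epsilon> \<le> 1 / 100" "finite V" "V \<noteq> {}" "no_shatter E V D"
    "\<not> robust E (\<epsilon> ^ C * real (card V)) e V"
  obtains S where "S \<subseteq> V" "restricted E \<epsilon> S" "\<epsilon> ^ C * real (card V) \<le> real (card S)"
  using assms(1)[unfolded rank_bound_def, rule_format, OF assms(2-7)] by blast

lemma rank_bound_compl:
  assumes "rank_bound E D e C" shows "rank_bound (\<lambda>a b. \<not> E a b) D e C"
  unfolding rank_bound_def
proof (intro allI impI)
  fix \<epsilon> :: real and V :: "'a set"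
  assume a: "0 < \<epsilon>" "\<epsilon> \<le> 1 / 100" "finite V" "V \<noteq> {}" "no_shatter (\<lambda>a b. \<not> E a b) V D"
    "\<not> robust (\<lambda>a b. \<not> E a b) (\<epsilon> ^ C * real (card V)) e V"
  have "no_shatter E V D" using no_shatter_compl[OF a(5)] by simp
  moreover have "\<not> robust E (\<epsilon> ^ C * real (card V)) e V"
    using a(6) robust_compl[of "\<lambda>a b. \<not> E a b"] by auto
  ultimately obtain S where "S \<subseteq> V" "restricted E \<epsilon> S" "\<epsilon> ^ C * real (card V) \<le> real (card S)"
    using rank_boundD[OF assms a(1-4)] by metis
  then show "\<exists>S\<subseteq>V. restricted (\<lambda>a b. \<not> E a b) \<epsilon> S \<and> \<epsilon> ^ C * real (card V) \<le> real (card S)"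
    unfolding restricted_compl by blast
qed

text \<open>All that the recursion assumes about a set. Since \<open>t\<close> does not scale with
  \<open>W\<close>, it is inherited by subsets; it also passes to the complement, so that each
  sparse argument covers the dense case.\<close>

definition admissible :: "nat \<Rightarrow> nat \<Rightarrow> nat \<Rightarrow> real \<Rightarrow> ('v \<Rightarrow> 'v \<Rightarrow> bool) \<Rightarrow> 'v set \<Rightarrow> bool" where
  "admissible D e C t E W \<longleftrightarrow> finite W \<and> symp E \<and> rank_bound E D e C \<and> no_shatter E W D \<and>
     \<not> robust E t (Suc e) W"

lemma admissible_subset: "admissible D e C t E W \<Longrightarrow> S \<subseteq> W \<Longrightarrow> admissible D e C t E S"
  unfolding admissible_def using robust_mono[of E t "Suc e" S W t] no_shatter_subset[of E W D S]
  by (auto dest: finite_subset)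

lemma admissible_compl:
  assumes "admissible D e C t E W" shows "admissible D e C t (\<lambda>a b. \<not> E a b) W"
  using assms unfolding admissible_def
  using rank_bound_compl[of E D e C] no_shatter_compl[of E W D] robust_compl[of E t "Suc e" W]
  by (auto simp: symp_def)

text \<open>Turns the bound of \<open>split\<close> at \<open>p = y\<close> and
  \<open>\<kappa> = y ^ a\<close> into a single power of \<open>1 / y\<close>: as
  \<open>1 / y\<close> is at least 2, a factor 2 costs one power and the factor \<open>2 * K\<close>
  costs \<open>2 * K\<close> powers.\<close>

lemma split_power:
  assumes y: "0 < y" "y \<le> 1 / 100" and W: "finite W" "W \<noteq> {}" and sym: "symp E" and nosh: "no_shatter E W D"
    and rich: "\<And>W'. W' \<subseteq> W \<Longrightarrow> y / 2 * real (card W) \<le> real (card W') \<Longrightarrow> robust E (y ^ a * real (card W')) e W'"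
    and notrob: "\<not> robust E t (Suc e) W"
    and K: "K = 8 * (D + 1) * (e + 1)" and M: "M = 2 * K + a + 1" and B: "B = 1 + (1 + 2 * D * M) * D"
  obtains b where "b \<subseteq> W" "y ^ B * real (card W) \<le> real (card b)"
    "real (card {v \<in> W. splits E t v b}) \<le> y * real (card W)"
proof -
  define x where "x = 1 / y"
  have x: "2 \<le> x" "1 \<le> x" using y by (auto simp: x_def field_simps)
  define X where "X = (4 * real D + 4) * (2 * (real e + 1)) / (y ^ a * y)"
  have X: "X = real K * x ^ (a + 1)" using y by (simp add: X_def K x_def field_simps power_divide)
  define q where "q = nat \<lceil>X\<rceil>"
  have X0: "0 \<le> X" using X x by simp
  have q: "X \<le> real q" "real q \<le> X + 1" unfolding q_def using X0 by linarith+
  obtain b where b: "b \<subseteq> W" "real (card W) \<le> real (card b) * (2 * (real q ^ (2 * D) + 1) ^ D)"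
    "real (card {v \<in> W. splits E t v b}) \<le> y * real (card W)"
    using split[OF W sym nosh y(1) _ _ _ rich notrob q(1)[unfolded X_def]] y power_le_one[of y a] by auto
  have K1: "1 \<le> real K" by (simp add: K)
  have x1: "1 \<le> x ^ j" for j using x(2) by (rule one_le_power)
  have "real q \<le> 2 * (real K * x ^ (a + 1))"
  proof -
    have "1 * 1 \<le> real K * x ^ (a + 1)" using K1 x1[of "a + 1"] by (intro mult_mono) auto
    then show ?thesis using q(2) X by linarith
  qed
  also have "\<dots> = real (2 * K) * x ^ (a + 1)" by simp
  also have "\<dots> \<le> x ^ (2 * K) * x ^ (a + 1)"
  proof (rule mult_right_mono)
    have "real (2 * K) \<le> 2 ^ (2 * K)" using of_nat_less_two_power[of "2 * K", where 'a = real] by linarith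
    also have "\<dots> \<le> x ^ (2 * K)" using x by (intro power_mono) auto
    finally show "real (2 * K) \<le> x ^ (2 * K)" .
  qed (use x1[of "a + 1"] in linarith)
  also have "\<dots> = x ^ M" by (simp add: M power_add)
  finally have "real q ^ (2 * D) \<le> (x ^ M) ^ (2 * D)" by (intro power_mono) auto
  also have "\<dots> = x ^ (2 * D * M)" by (simp add: power_mult[symmetric] mult.commute)
  finally have "real q ^ (2 * D) + 1 \<le> 2 * x ^ (2 * D * M)" using x1[of "2 * D * M"] by linarith
  also have "\<dots> \<le> x * x ^ (2 * D * M)" using x x1[of "2 * D * M"] by (intro mult_right_mono) auto
  also have "\<dots> = x ^ (1 + 2 * D * M)" by simp
  finally have "(real q ^ (2 * D) + 1) ^ D \<le> (x ^ (1 + 2 * D * M)) ^ D" by (intro power_mono) auto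
  then have "2 * (real q ^ (2 * D) + 1) ^ D \<le> x * (x ^ (1 + 2 * D * M)) ^ D"
    using x by (intro mult_mono) auto
  also have "\<dots> = x ^ B" by (simp only: B power_add power_mult power_one_right)
  finally have "real (card b) * (2 * (real q ^ (2 * D) + 1) ^ D) \<le> real (card b) * x ^ B"
    by (intro mult_left_mono) auto
  then have "real (card W) \<le> real (card b) * x ^ B" using b(2) by linarith
  then have "y ^ B * real (card W) \<le> real (card b)"
    using y by (simp add: x_def power_divide field_simps)
  then show thesis using that b(1,3) by blast
qed

text \<open>If some large subset has no robust \<open>e\<close>-tuple, the rank bound is applied at
  \<open>y\<^sup>2\<close> instead of \<open>y\<close>, which is the gain in density that the later
  iteration lives on. Otherwise all large subsets are rich and \<open>split_power\<close> applies
  with \<open>a = 2 * C\<close>.\<close>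

lemma dichotomy:
  fixes D e C :: nat
  obtains B :: nat where "2 \<le> B" "\<And>y E (W :: 'v set) t. 0 < y \<Longrightarrow> y \<le> 1 / 100 \<Longrightarrow> W \<noteq> {} \<Longrightarrow> admissible D e C t E W \<Longrightarrow>
    (\<exists>S\<subseteq>W. restricted E (y\<^sup>2) S \<and> y ^ B * real (card W) \<le> real (card S)) \<or>
    (\<exists>b\<subseteq>W. card b = nat \<lceil>y ^ B * real (card W)\<rceil> \<and> real (card {v \<in> W. splits E t v b}) \<le> y * real (card W))"
proof -
  define K where "K = 8 * (D + 1) * (e + 1)"
  define M where "M = 2 * K + 2 * C + 1"
  define B0 where "B0 = 1 + (1 + 2 * D * M) * D"
  define B where "B = B0 + 2 * C + 2"
  show thesis
  proof (rule that[of B])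
    show "2 \<le> B" by (simp add: B_def)
    fix y :: real and E and W :: "'v set" and t
    assume y: "0 < y" "y \<le> 1 / 100" and ne: "W \<noteq> {}" and adm: "admissible D e C t E W"
    have W: "finite W" and sym: "symp E" and rb: "rank_bound E D e C" and nosh: "no_shatter E W D"
      and notrob: "\<not> robust E t (Suc e) W" using adm by (auto simp: admissible_def)
    have n0: "0 < real (card W)" using W ne by (simp add: card_gt_0_iff)
    have y1: "y \<le> 1" using y by simp
    show "(\<exists>S\<subseteq>W. restricted E (y\<^sup>2) S \<and> y ^ B * real (card W) \<le> real (card S)) \<or>
      (\<exists>b\<subseteq>W. card b = nat \<lceil>y ^ B * real (card W)\<rceil> \<and> real (card {v \<in> W. splits E t v b}) \<le> y * real (card W))"
    proof (cases "\<exists>W'\<subseteq>W. y / 2 * real (card W) \<le> real (card W') \<and> \<not> robust E (y ^ (2 * C) * real (card W')) e W'")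
      case True
      then obtain W' where W': "W' \<subseteq> W" "y / 2 * real (card W) \<le> real (card W')"
        "\<not> robust E ((y\<^sup>2) ^ C * real (card W')) e W'" by (auto simp: power_mult)
      have fW': "finite W'" using W' W finite_subset by blast
      have "0 < real (card W')" using W'(2) n0 y by (smt (verit) divide_pos_pos mult_pos_pos)
      then have ne': "W' \<noteq> {}" by auto
      have y2: "0 < y\<^sup>2" "y\<^sup>2 \<le> 1 / 100"
      proof -
        have "y\<^sup>2 \<le> y" unfolding power2_eq_square using y y1 by (intro mult_left_le) auto
        then show "y\<^sup>2 \<le> 1 / 100" using y by linarith
      qed (use y in simp)
      obtain S where S: "S \<subseteq> W'" "restricted E (y\<^sup>2) S" "(y\<^sup>2) ^ C * real (card W') \<le> real (card S)"
        using rank_boundD[OF rb y2 fW' ne' no_shatter_subset[OF nosh W'(1)] W'(3)] by metis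
      have "y ^ B \<le> y ^ (2 * C + 2)" using y y1 by (intro power_decreasing) (auto simp: B_def)
      also have "\<dots> = y ^ (2 * C) * (y * y)" by (simp add: power_add power2_eq_square)
      also have "\<dots> \<le> y ^ (2 * C) * (y / 2)"
        using y by (intro mult_left_mono) (auto simp: mult_left_le field_simps)
      finally have "y ^ B * real (card W) \<le> y ^ (2 * C) * (y / 2) * real (card W)" by (intro mult_right_mono) auto
      also have "\<dots> = y ^ (2 * C) * (y / 2 * real (card W))" by simp
      also have "\<dots> \<le> y ^ (2 * C) * real (card W')" using W'(2) y by (intro mult_left_mono) auto
      also have "\<dots> \<le> real (card S)" using S(3) by (simp add: power_mult)
      finally show ?thesis using S W'(1) by blast
    next
      case False
      then have rich: "robust E (y ^ (2 * C) * real (card W')) e W'"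
        if "W' \<subseteq> W" "y / 2 * real (card W) \<le> real (card W')" for W' using that by blast
      obtain b where b: "b \<subseteq> W" "y ^ B0 * real (card W) \<le> real (card b)"
        "real (card {v \<in> W. splits E t v b}) \<le> y * real (card W)"
        using split_power[OF y W ne sym nosh rich notrob K_def M_def B0_def] by metis
      have "y ^ B * real (card W) \<le> y ^ B0 * real (card W)"
        using y y1 by (intro mult_right_mono power_decreasing) (auto simp: B_def)
      then have "nat \<lceil>y ^ B * real (card W)\<rceil> \<le> card b" using b(2) by linarith
      \<comment> \<open>An exact size also bounds the set from above, so that removing it later
        costs little. Passing to a subset can only lower the number of vertices that split
        it.\<close>
      then obtain b' where b': "b' \<subseteq> b" "card b' = nat \<lceil>y ^ B * real (card W)\<rceil>"
        by (meson obtain_subset_with_card_n)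
      have finb: "finite b" using b(1) W finite_subset by blast
      have "splits E t v b" if s: "splits E t v b'" for v
      proof -
        have "card (nbs E v b') \<le> card (nbs E v b)" "card (b' - nbs E v b') \<le> card (b - nbs E v b)"
          using finb b'(1) by (auto intro!: card_mono simp: nbs_def)
        then show ?thesis using s unfolding splits_def by linarith
      qed
      then have "card {v \<in> W. splits E t v b'} \<le> card {v \<in> W. splits E t v b}"
        using W by (intro card_mono) auto
      then have "real (card {v \<in> W. splits E t v b'}) \<le> y * real (card W)" using b(3) by linarith
      moreover have "b' \<subseteq> W" using b' b by blast
      ultimately show ?thesis using b'(2) by blast
    qed
  qed
qed

section \<open>Sparse blockades\<close>

text \<open>Only degrees from later blocks into earlier ones are bounded, as a greedy construction
  provides them; the other direction is recovered on average by counting edges. The bound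
  \<open>t\<close> is absolute, so that blocks may be replaced by subsets.\<close>

definition blockade :: "('v \<Rightarrow> 'v \<Rightarrow> bool) \<Rightarrow> real \<Rightarrow> real \<Rightarrow> 'v set list \<Rightarrow> 'v set \<Rightarrow> bool" where
  "blockade E t s Ls W \<longleftrightarrow> (\<forall>A\<in>set Ls. A \<subseteq> W \<and> s \<le> real (card A)) \<and>
     sorted_wrt (\<lambda>A B. A \<inter> B = {} \<and> (\<forall>v\<in>B. real (card (nbs E v A)) \<le> t)) Ls"

lemma blockade_mono: "blockade E t s Ls W \<Longrightarrow> W \<subseteq> W' \<Longrightarrow> s' \<le> s \<Longrightarrow> blockade E t s' Ls W'"
  unfolding blockade_def by (meson order_trans)

lemma edge_count_sym:
  assumes "symp E" "finite X" "finite Y"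
  shows "(\<Sum>v\<in>X. card (nbs E v Y)) = (\<Sum>u\<in>Y. card (nbs E u X))"
proof -
  have "(\<Sum>v\<in>X. card (nbs E v Y)) = (\<Sum>v\<in>X. \<Sum>u | u \<in> Y \<and> E v u. 1)" by (simp add: nbs_def)
  also have "\<dots> = (\<Sum>u\<in>Y. \<Sum>v | v \<in> X \<and> E v u. 1)" using assms(2,3) by (rule sum.swap_restrict)
  also have "\<dots> = (\<Sum>u\<in>Y. card (nbs E u X))"
  proof (rule sum.cong)
    fix u
    have "{v. v \<in> X \<and> E v u} = nbs E u X" using sympD[OF assms(1)] by (auto simp: nbs_def)
    then show "(\<Sum>v | v \<in> X \<and> E v u. 1) = card (nbs E u X)" by simp
  qed simp
  finally show ?thesis .
qed

text \<open>Start of the iteration, where no density is known yet: without \<open>b\<close> and the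
  vertices that split it, at least half of \<open>W\<close> remains, and at least half of the
  remainder is nearly pure to \<open>b\<close> in the same sense.\<close>

lemma homogeneous_pair:
  assumes ne: "W \<noteq> {}" and adm: "admissible D e C t E W" and B: "2 \<le> B"
    and dich: "(\<exists>S\<subseteq>W. restricted E ((1 / 100)\<^sup>2) S \<and> (1 / 100) ^ B * real (card W) \<le> real (card S)) \<or>
      (\<exists>b\<subseteq>W. card b = nat \<lceil>(1 / 100) ^ B * real (card W)\<rceil> \<and>
        real (card {v \<in> W. splits E t v b}) \<le> 1 / 100 * real (card W))"
  shows "(\<exists>S\<subseteq>W. restricted E (1 / 100) S \<and> (1 / 100) ^ B * real (card W) \<le> real (card S)) \<or>
    (\<exists>Ls. length Ls = 2 \<and> (blockade E t ((1 / 100) ^ B * real (card W)) Ls W \<or>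
      blockade (\<lambda>a b. \<not> E a b) t ((1 / 100) ^ B * real (card W)) Ls W))"
proof -
  define g where "g = (1 / 100) ^ B * real (card W)"
  have W: "finite W" using adm by (simp add: admissible_def)
  have n0: "0 < real (card W)" using W ne by (simp add: card_gt_0_iff)
  have g: "g \<le> real (card W) / 10000"
  proof -
    have "(1 / 100) ^ B \<le> (1 / 100 :: real) ^ 2" using B by (intro power_decreasing) auto
    then have "g \<le> (1 / 100) ^ 2 * real (card W)" unfolding g_def using n0 by (intro mult_right_mono) auto
    then show ?thesis by (simp add: power2_eq_square)
  qed
  \<comment> \<open>A size bound of at most 1 is met by a single vertex; otherwise rounding
    \<open>g\<close> up at most doubles it.\<close>
  show ?thesis
  proof (cases "g \<le> 1")
    case True
    obtain w where "w \<in> W" using ne by blast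
    then have "{w} \<subseteq> W" "restricted E (1 / 100) {w}" "g \<le> real (card {w})"
      using True by (simp_all add: restricted_singleton)
    then show ?thesis unfolding g_def by blast
  next
    case False
    from dich show ?thesis
    proof (elim disjE exE conjE)
      fix S assume S: "S \<subseteq> W" "restricted E ((1 / 100)\<^sup>2) S" "(1 / 100) ^ B * real (card W) \<le> real (card S)"
      have "restricted E (1 / 100) S" using S(2) by (rule restricted_mono) (simp add: power2_eq_square)
      then show ?thesis using S by blast
    next
      fix b assume b: "b \<subseteq> W" "card b = nat \<lceil>(1 / 100) ^ B * real (card W)\<rceil>"
        "real (card {v \<in> W. splits E t v b}) \<le> 1 / 100 * real (card W)"
      have cb: "g \<le> real (card b)" "real (card b) \<le> 2 * g" using b(2) False unfolding g_def by linarith+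
      have finb: "finite b" using b(1) W finite_subset by blast
      define R where "R = W - (b \<union> {v \<in> W. splits E t v b})"
      have RW: "R \<subseteq> W" by (auto simp: R_def)
      define R1 where "R1 = {v \<in> R. real (card (nbs E v b)) \<le> t}"
      define R2 where "R2 = {v \<in> R. real (card (nbs (\<lambda>a b. \<not> E a b) v b)) \<le> t}"
      have cR: "real (card W) / 2 \<le> real (card R)"
      proof -
        have "card (b \<union> {v \<in> W. splits E t v b}) \<le> card b + card {v \<in> W. splits E t v b}" by (rule card_Un_le)
        moreover have "card W - card (b \<union> {v \<in> W. splits E t v b}) \<le> card R"
          unfolding R_def using finb W by (intro diff_card_le_card_Diff) auto
        ultimately have "real (card W) \<le> real (card R) + real (card b) + real (card {v \<in> W. splits E t v b})"
          by linarith
        then show ?thesis using cb(2) b(3) g by linarith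
      qed
      have cover: "R \<subseteq> R1 \<union> R2"
      proof
        fix v assume v: "v \<in> R"
        have "nbs (\<lambda>a b. \<not> E a b) v b = b - nbs E v b" by (auto simp: nbs_def)
        moreover have "\<not> splits E t v b" using v by (auto simp: R_def)
        ultimately show "v \<in> R1 \<union> R2" using v by (auto simp: splits_def R1_def R2_def)
      qed
      have finR: "finite R1" "finite R2" using RW W by (auto simp: R1_def R2_def dest: finite_subset)
      have "card R \<le> card (R1 \<union> R2)" using cover finR by (intro card_mono) auto
      also have "\<dots> \<le> card R1 + card R2" by (rule card_Un_le)
      finally have "real (card W) / 4 \<le> real (card R1) \<or> real (card W) / 4 \<le> real (card R2)"
        using cR by linarith
      moreover have disj: "b \<inter> R1 = {}" "b \<inter> R2 = {}" "R1 \<subseteq> W" "R2 \<subseteq> W" using RW by (auto simp: R1_def R2_def R_def)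
      moreover have "blockade E t g [b, R1] W" if "real (card W) / 4 \<le> real (card R1)"
        unfolding blockade_def using that cb(1) g n0 b(1) disj by (auto simp: R1_def)
      moreover have "blockade (\<lambda>a b. \<not> E a b) t g [b, R2] W" if "real (card W) / 4 \<le> real (card R2)"
        unfolding blockade_def using that cb(1) g n0 b(1) disj by (auto simp: R2_def)
      moreover have "length [b, X] = 2" for X by simp
      ultimately show ?thesis unfolding g_def by metis
    qed
  qed
qed

text \<open>Counting edges from the side of \<open>b\<close> shows that few vertices of a sparse
  \<open>S\<close> see half of \<open>b\<close>; any other vertex that does not split
  \<open>b\<close> must be on its sparse side. The factor 4 adds the shares of \<open>b\<close> (1),
  of the splitting vertices (1) and of the vertices that see half of \<open>b\<close> (2).\<close>

lemma sparse_blockade_step: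
  assumes y: "0 < y" "y \<le> 1 / 100" and S: "finite S" "sparse E y S" and sym: "symp E"
    and R: "R \<subseteq> S" "real (card S) / 2 \<le> real (card R)"
    and b: "b \<subseteq> R" "real (card b) \<le> y * real (card S)" "b \<noteq> {}"
      "real (card {v \<in> R. splits E t v b}) \<le> y * real (card R)"
  obtains R' where "R' \<subseteq> R" "R' \<inter> b = {}" "real (card R) - 4 * y * real (card S) \<le> real (card R')"
    "\<And>v. v \<in> R' \<Longrightarrow> real (card (nbs E v b)) \<le> t"
proof -
  define X where "X = {v \<in> R. splits E t v b}"
  define Y where "Y = {v \<in> R. card b \<le> 2 * card (nbs E v b)}"
  define R' where "R' = R - (b \<union> X \<union> Y)"
  have finR: "finite R" using R(1) S(1) finite_subset by blast
  have finb: "finite b" using b(1) finR finite_subset by blast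
  have bS: "b \<subseteq> S" using b(1) R(1) by blast
  have finX: "finite X" "finite Y" using finR by (auto simp: X_def Y_def)
  have cb: "0 < card b" using b(3) finb by (simp add: card_gt_0_iff)
  have "card b * card Y = (\<Sum>v\<in>Y. card b)" by simp
  also have "\<dots> \<le> (\<Sum>v\<in>Y. 2 * card (nbs E v b))" by (intro sum_mono) (simp add: Y_def)
  also have "\<dots> \<le> (\<Sum>v\<in>S. 2 * card (nbs E v b))" using S(1) R(1) by (intro sum_mono2) (auto simp: Y_def)
  also have "\<dots> = 2 * (\<Sum>v\<in>S. card (nbs E v b))" by (simp only: sum_distrib_left)
  also have "\<dots> = 2 * (\<Sum>u\<in>b. card (nbs E u S))" using edge_count_sym[OF sym S(1) finb] by simp
  finally have "real (card b * card Y) \<le> real (2 * (\<Sum>u\<in>b. card (nbs E u S)))" by (simp only: of_nat_le_iff)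
  then have "real (card b) * real (card Y) \<le> 2 * (\<Sum>u\<in>b. real (card (nbs E u S)))" by simp
  also have "\<dots> \<le> 2 * (\<Sum>u\<in>b. y * real (card S))"
    using S(2) bS by (intro mult_left_mono sum_mono) (auto simp: sparse_def)
  also have "\<dots> = real (card b) * (2 * (y * real (card S)))" by simp
  finally have cY: "real (card Y) \<le> 2 * (y * real (card S))" using cb by simp
  have "y * real (card R) \<le> y * real (card S)" using R(1) S(1) y by (intro mult_left_mono) (auto intro: card_mono)
  then have cX: "real (card X) \<le> y * real (card S)" using b(4) unfolding X_def by linarith
  have "card (b \<union> X \<union> Y) \<le> card b + card X + card Y"
    using card_Un_le[of "b \<union> X" Y] card_Un_le[of b X] by linarith
  moreover have "card R - card (b \<union> X \<union> Y) \<le> card R'"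
    unfolding R'_def using finb finX by (intro diff_card_le_card_Diff) auto
  ultimately have "real (card R) \<le> real (card R') + real (card b) + real (card X) + real (card Y)" by linarith
  then have "real (card R) - 4 * y * real (card S) \<le> real (card R')" using b(2) cX cY by linarith
  moreover have "real (card (nbs E v b)) \<le> t" if v: "v \<in> R'" for v
  proof (rule ccontr)
    assume "\<not> ?thesis"
    then have t: "t < real (card (nbs E v b))" by simp
    have "v \<in> R" "\<not> splits E t v b" "\<not> card b \<le> 2 * card (nbs E v b)" using v by (auto simp: R'_def X_def Y_def)
    moreover have "card (b - nbs E v b) = card b - card (nbs E v b)"
      using nbs_subset[of E v b] finb by (simp add: card_Diff_subset)
    ultimately show False using t unfolding splits_def by linarith
  qed
  ultimately show thesis using that[of R'] by (auto simp: R'_def)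
qed

text \<open>Greedy choice of blocks: each step costs a share \<open>4 * y\<close> of
  \<open>S\<close>, so half of \<open>S\<close> is still available throughout
  \<open>1 / (8 * y)\<close> steps.\<close>

lemma sparse_blockade:
  assumes y: "0 < y" "y \<le> 1 / 100" and S: "finite S" "S \<noteq> {}" "sparse E y S" and sym: "symp E" and B: "2 \<le> B"
    and dich: "\<And>R. R \<subseteq> S \<Longrightarrow> R \<noteq> {} \<Longrightarrow>
      (\<exists>S'\<subseteq>R. restricted E (y\<^sup>2) S' \<and> y ^ B * real (card R) \<le> real (card S')) \<or>
      (\<exists>b\<subseteq>R. card b = nat \<lceil>y ^ B * real (card R)\<rceil> \<and> real (card {v \<in> R. splits E t v b}) \<le> y * real (card R))"
  shows "(\<exists>S'\<subseteq>S. restricted E (y\<^sup>2) S' \<and> y ^ (B + 1) * real (card S) \<le> real (card S')) \<or>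
    (\<exists>Ls. length Ls = nat \<lfloor>1 / (8 * y)\<rfloor> \<and> blockade E t (y ^ (B + 1) * real (card S)) Ls S)"
proof (rule ccontr)
  assume contra: "\<not> ?thesis"
  define n where "n = real (card S)"
  have n0: "0 < n" unfolding n_def using S by (simp add: card_gt_0_iff)
  have y1: "y \<le> 1" "0 \<le> y" using y by auto
  have yB: "y ^ B \<le> y * y"
    using power_decreasing[OF B, of y] y by (simp add: power2_eq_square)
  have no: "real (card S') < y ^ (B + 1) * n" if "S' \<subseteq> S" "restricted E (y\<^sup>2) S'" for S'
    using contra that unfolding n_def by (meson not_le)
  \<comment> \<open>Otherwise a single vertex would do. As a consequence, rounding up at most
    doubles the size of each block.\<close>
  have big: "1 < y ^ (B + 1) * n"
  proof -
    obtain w where "w \<in> S" using S(2) by blast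
    then show ?thesis using no[of "{w}"] by (simp add: restricted_singleton)
  qed
  have "\<exists>Ls R. length Ls = j \<and> R \<subseteq> S \<and> (1 - 4 * y * real j) * n \<le> real (card R) \<and>
      blockade E t (y ^ (B + 1) * n) Ls S \<and> (\<forall>A\<in>set Ls. A \<inter> R = {} \<and> (\<forall>v\<in>R. real (card (nbs E v A)) \<le> t))"
    if "real j \<le> 1 / (8 * y)" for j
    using that
  proof (induction j)
    case 0
    then show ?case by (intro exI[of _ "[]"] exI[of _ S]) (auto simp: blockade_def n_def)
  next
    case (Suc j)
    then have j: "real j \<le> 1 / (8 * y)" by simp
    obtain Ls R where L: "length Ls = j \<and> R \<subseteq> S \<and> (1 - 4 * y * real j) * n \<le> real (card R) \<and>
      blockade E t (y ^ (B + 1) * n) Ls S \<and> (\<forall>A\<in>set Ls. A \<inter> R = {} \<and> (\<forall>v\<in>R. real (card (nbs E v A)) \<le> t))"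
      using Suc.IH[OF j] by (elim exE) (erule that)
    then have IH: "length Ls = j" "R \<subseteq> S" "(1 - 4 * y * real j) * n \<le> real (card R)"
      "blockade E t (y ^ (B + 1) * n) Ls S" by blast+
    have IH5: "A \<inter> R = {}" if "A \<in> set Ls" for A using L that by blast
    have IH6: "real (card (nbs E v A)) \<le> t" if "A \<in> set Ls" "v \<in> R" for A v using L that by blast
    have "4 * y * real j \<le> 1 / 2" using j y by (simp add: field_simps)
    then have "1 / 2 * n \<le> (1 - 4 * y * real j) * n" using n0 by (intro mult_right_mono) auto
    then have cR: "n / 2 \<le> real (card R)" using IH(3) by simp
    then have Rne: "R \<noteq> {}" using n0 by auto
    have cRn: "real (card R) \<le> n" unfolding n_def using IH(2) S(1) by (simp add: card_mono)
    have yR: "y ^ (B + 1) * n \<le> y ^ B * real (card R)"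
    proof -
      have "y ^ (B + 1) * n = y ^ B * (y * n)" by simp
      also have "y * n \<le> 1 / 2 * n" using y n0 by (intro mult_right_mono) auto
      then have "y ^ B * (y * n) \<le> y ^ B * real (card R)" using cR y by (intro mult_left_mono) auto
      finally show ?thesis .
    qed
    have "\<not> (\<exists>S'\<subseteq>R. restricted E (y\<^sup>2) S' \<and> y ^ B * real (card R) \<le> real (card S'))"
    proof
      assume "\<exists>S'\<subseteq>R. restricted E (y\<^sup>2) S' \<and> y ^ B * real (card R) \<le> real (card S')"
      then obtain S' where S': "S' \<subseteq> R" "restricted E (y\<^sup>2) S'" "y ^ B * real (card R) \<le> real (card S')" by blast
      then show False using no[of S'] order_trans[OF S'(1) IH(2)] yR by linarith
    qed
    then obtain b where b: "b \<subseteq> R" "card b = nat \<lceil>y ^ B * real (card R)\<rceil>"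
      "real (card {v \<in> R. splits E t v b}) \<le> y * real (card R)"
      using dich[OF IH(2) Rne] by blast
    have cb: "y ^ B * real (card R) \<le> real (card b)" "real (card b) \<le> 2 * (y ^ B * real (card R))"
      using b(2) yR big by linarith+
    have cb1: "y ^ (B + 1) * n \<le> real (card b)" using cb(1) yR by linarith
    have cb2: "real (card b) \<le> y * real (card S)"
    proof -
      have "2 * (y ^ B * real (card R)) \<le> 2 * (y * y * n)" using yB cRn y by (intro mult_left_mono mult_mono) auto
      also have "\<dots> = (2 * y) * (y * n)" by simp
      also have "\<dots> \<le> 1 * (y * n)" using y n0 by (intro mult_right_mono) auto
      finally show ?thesis using cb(2) by (simp add: n_def)
    qed
    have bne: "b \<noteq> {}" using cb1 big by auto
    obtain R' where R': "R' \<subseteq> R" "R' \<inter> b = {}" "real (card R) - 4 * y * real (card S) \<le> real (card R')"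
      "\<And>v. v \<in> R' \<Longrightarrow> real (card (nbs E v b)) \<le> t"
      using sparse_blockade_step[OF y S(1,3) sym IH(2) _ b(1) cb2 bne b(3)] cR unfolding n_def by metis
    have bS: "b \<subseteq> S" using b(1) IH(2) by blast
    have "blockade E t (y ^ (B + 1) * n) (Ls @ [b]) S"
    proof -
      have "A \<inter> b = {} \<and> (\<forall>v\<in>b. real (card (nbs E v A)) \<le> t)" if "A \<in> set Ls" for A
        using IH5[OF that] IH6[OF that] b(1) by blast
      then show ?thesis using IH(4) bS cb1 unfolding blockade_def by (auto simp: sorted_wrt_append)
    qed
    moreover have "(1 - 4 * y * real (Suc j)) * n \<le> real (card R')"
      using IH(3) R'(3) by (simp add: n_def algebra_simps)
    moreover have "A \<inter> R' = {} \<and> (\<forall>v\<in>R'. real (card (nbs E v A)) \<le> t)" if "A \<in> set (Ls @ [b])" for A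
    proof (cases "A = b")
      case True then show ?thesis using R'(2,4) by blast
    next
      case False
      then have "A \<in> set Ls" using that by simp
      then show ?thesis using IH5[of A] IH6[of A] R'(1) by blast
    qed
    moreover have "length (Ls @ [b]) = Suc j" "R' \<subseteq> S" using IH(1,2) R'(1) by auto
    ultimately show ?case by blast
  qed
  moreover have "real (nat \<lfloor>1 / (8 * y)\<rfloor>) \<le> 1 / (8 * y)" using y by (simp add: of_nat_nat)
  ultimately obtain Ls where "length Ls = nat \<lfloor>1 / (8 * y)\<rfloor>" "blockade E t (y ^ (B + 1) * n) Ls S" by blast
  then show False using contra unfolding n_def by blast
qed

definition homogeneous_blockade :: "('v \<Rightarrow> 'v \<Rightarrow> bool) \<Rightarrow> real \<Rightarrow> real \<Rightarrow> 'v set list \<Rightarrow> 'v set \<Rightarrow> bool" where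
  "homogeneous_blockade E t s Ls W \<longleftrightarrow> blockade E t s Ls W \<or> blockade (\<lambda>a b. \<not> E a b) t s Ls W"

lemma homogeneous_blockade_mono:
  "homogeneous_blockade E t s Ls W \<Longrightarrow> W \<subseteq> W' \<Longrightarrow> s' \<le> s \<Longrightarrow> homogeneous_blockade E t s' Ls W'"
  unfolding homogeneous_blockade_def using blockade_mono by blast

text \<open>
  Start at density \<open>1 / 100\<close> and square it while possible. Since \<open>y\<^sup>B y\<^sup>B = (y\<^sup>2)\<^sup>B\<close>, the
  exponent in the size bound does not grow along the iteration.
\<close>

lemma chunk:
  fixes D e C :: nat
  obtains B :: nat where "1 \<le> B" "\<And>\<epsilon> E (W :: 'v set) t. 0 < \<epsilon> \<Longrightarrow> \<epsilon> \<le> 1 / 100 \<Longrightarrow> W \<noteq> {} \<Longrightarrow>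
    admissible D e C t E W \<Longrightarrow>
    (\<exists>S\<subseteq>W. restricted E \<epsilon> S \<and> \<epsilon> ^ B * real (card W) \<le> real (card S)) \<or>
    (\<exists>Ls. 2 \<le> length Ls \<and> real (length Ls) \<le> 1 / \<epsilon> \<and>
      homogeneous_blockade E t ((1 / real (length Ls)) ^ B * real (card W)) Ls W)"
proof (rule dichotomy[of D e C])
  fix B0 :: nat
  assume B0: "2 \<le> B0" and dich: "\<And>y E (W :: 'v set) t. 0 < y \<Longrightarrow> y \<le> 1 / 100 \<Longrightarrow> W \<noteq> {} \<Longrightarrow> admissible D e C t E W \<Longrightarrow>
    (\<exists>S\<subseteq>W. restricted E (y\<^sup>2) S \<and> y ^ B0 * real (card W) \<le> real (card S)) \<or>
    (\<exists>b\<subseteq>W. card b = nat \<lceil>y ^ B0 * real (card W)\<rceil> \<and> real (card {v \<in> W. splits E t v b}) \<le> y * real (card W))"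
  define B1 where "B1 = B0 + 1"
  \<comment> \<open>The factor 7 comes from the initial pair, where
    \<open>(1 / 2) ^ 7 \<le> 1 / 100\<close>. Longer sequences need only 4, because
    \<open>(1 / k)\<^sup>2 \<le> y\<close> for their length \<open>k\<close> and the size to be
    reached is \<open>y ^ (2 * B1) * n\<close>.\<close>
  show thesis
  proof (rule that[of "7 * B1"])
    show "1 \<le> 7 * B1" by (simp add: B1_def)
    fix \<epsilon> :: real and E and W :: "'v set" and t
    assume \<epsilon>: "0 < \<epsilon>" "\<epsilon> \<le> 1 / 100" and ne: "W \<noteq> {}" and adm: "admissible D e C t E W"
    define n where "n = real (card W)"
    have W: "finite W" and sym: "symp E" using adm by (auto simp: admissible_def)
    have n0: "0 \<le> n" by (simp add: n_def)
    have step: "(\<exists>S'\<subseteq>S. restricted E (y\<^sup>2) S' \<and> y ^ B1 * real (card S) \<le> real (card S')) \<or>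
        (\<exists>Ls. length Ls = nat \<lfloor>1 / (8 * y)\<rfloor> \<and> homogeneous_blockade E t (y ^ B1 * real (card S)) Ls S)"
      if y: "0 < y" "y \<le> 1 / 100" and S: "S \<subseteq> W" "S \<noteq> {}" and r: "restricted E y S" for y S
    proof -
      have finS: "finite S" using S W finite_subset by blast
      have main: "(\<exists>S'\<subseteq>S. restricted F (y\<^sup>2) S' \<and> y ^ B1 * real (card S) \<le> real (card S')) \<or>
        (\<exists>Ls. length Ls = nat \<lfloor>1 / (8 * y)\<rfloor> \<and> blockade F t (y ^ B1 * real (card S)) Ls S)"
        if F: "admissible D e C t F W" and sp: "sparse F y S" for F
      proof -
        have symF: "symp F" using F by (simp add: admissible_def)
        have dichF: "(\<exists>S'\<subseteq>R. restricted F (y\<^sup>2) S' \<and> y ^ B0 * real (card R) \<le> real (card S')) \<or>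
          (\<exists>b\<subseteq>R. card b = nat \<lceil>y ^ B0 * real (card R)\<rceil> \<and> real (card {v \<in> R. splits F t v b}) \<le> y * real (card R))"
          if "R \<subseteq> S" "R \<noteq> {}" for R
          using dich[OF y that(2) admissible_subset[OF F order_trans[OF that(1) S(1)]]] .
        show ?thesis unfolding B1_def
          by (rule sparse_blockade[OF y finS S(2) sp symF B0 dichF])
      qed
      from r consider "sparse E y S" | "sparse (\<lambda>a b. \<not> E a b) y S" unfolding restricted_def by blast
      then show ?thesis
      proof cases
        case 1
        then show ?thesis using main[OF adm] unfolding homogeneous_blockade_def by blast
      next
        case 2
        then show ?thesis using main[OF admissible_compl[OF adm]]
          unfolding homogeneous_blockade_def restricted_compl by blast
      qed
    qed
    define gmet where "gmet \<longleftrightarrow> (\<exists>S\<subseteq>W. restricted E \<epsilon> S \<and> \<epsilon> ^ (7 * B1) * n \<le> real (card S)) \<or>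
      (\<exists>Ls. 2 \<le> length Ls \<and> real (length Ls) \<le> 1 / \<epsilon> \<and>
        homogeneous_blockade E t ((1 / real (length Ls)) ^ (7 * B1) * n) Ls W)"
    define z where "z j = (1 / 100 :: real) ^ (2 ^ j)" for j :: nat
    have z0: "0 < z j" for j by (simp add: z_def)
    have z100: "z j \<le> 1 / 100" for j
      using power_decreasing[of 1 "2 ^ j" "1 / 100 :: real"] by (simp add: z_def)
    have zSuc: "z (Suc j) = (z j)\<^sup>2" for j by (simp add: z_def power_mult[symmetric] mult.commute)
    \<comment> \<open>The last squaring crosses \<open>\<epsilon>\<close> starting from some
      \<open>y \<ge> \<epsilon>\<close>, so the size is still at least
      \<open>\<epsilon> ^ (2 * B1) * n\<close>.\<close>
    have gmet1: gmet if S: "S \<subseteq> W" "restricted E y' S" "y' \<le> \<epsilon>" "y ^ (2 * B1) * n \<le> real (card S)" "\<epsilon> \<le> y" for S y y'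
    proof -
      have "\<epsilon> ^ (7 * B1) \<le> \<epsilon> ^ (2 * B1)" using \<epsilon> by (intro power_decreasing) auto
      also have "\<dots> \<le> y ^ (2 * B1)" using \<epsilon> S(5) by (intro power_mono) auto
      finally have "\<epsilon> ^ (7 * B1) * n \<le> y ^ (2 * B1) * n" using n0 by (intro mult_right_mono)
      then have "\<epsilon> ^ (7 * B1) * n \<le> real (card S)" using S(4) by linarith
      moreover have "restricted E \<epsilon> S" using S(2,3) by (rule restricted_mono)
      ultimately show gmet using S(1) unfolding gmet_def by blast
    qed
    have ind: "gmet \<or> (\<epsilon> \<le> z j \<and> (\<exists>S\<subseteq>W. restricted E (z j) S \<and> z j ^ B1 * n \<le> real (card S)))" for j
    proof (induction j)
      case 0
      have B0B1: "(1 / 100) ^ B1 * n \<le> (1 / 100) ^ B0 * n"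
        using n0 unfolding B1_def by (intro mult_right_mono power_decreasing) auto
      have "(\<exists>S\<subseteq>W. restricted E (1 / 100) S \<and> (1 / 100) ^ B0 * n \<le> real (card S)) \<or>
        (\<exists>Ls. length Ls = 2 \<and> homogeneous_blockade E t ((1 / 100) ^ B0 * n) Ls W)"
        using homogeneous_pair[OF ne adm B0 dich[OF _ _ ne adm, of "1 / 100"]]
        unfolding homogeneous_blockade_def n_def by simp
      then show ?case
      proof
        assume "\<exists>S\<subseteq>W. restricted E (1 / 100) S \<and> (1 / 100) ^ B0 * n \<le> real (card S)"
        then obtain S where S: "S \<subseteq> W" "restricted E (1 / 100) S" "(1 / 100) ^ B0 * n \<le> real (card S)" by blast
        then have "(1 / 100) ^ B1 * n \<le> real (card S)" using B0B1 by linarith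
        then show ?thesis using S \<epsilon> by (auto simp: z_def)
      next
        assume "\<exists>Ls. length Ls = 2 \<and> homogeneous_blockade E t ((1 / 100) ^ B0 * n) Ls W"
        then obtain Ls where Ls: "length Ls = 2" "homogeneous_blockade E t ((1 / 100) ^ B0 * n) Ls W" by blast
        have "(1 / 2 :: real) ^ (7 * B1) = (1 / 128) ^ B1"
        proof -
          have "(1 / 2 :: real) ^ 7 = 1 / 128" by (simp add: power_divide)
          then show ?thesis by (simp only: power_mult)
        qed
        also have "\<dots> \<le> (1 / 100) ^ B1" by (intro power_mono) auto
        finally have "(1 / 2) ^ (7 * B1) * n \<le> (1 / 100) ^ B1 * n" using n0 by (intro mult_right_mono)
        then have "(1 / 2) ^ (7 * B1) * n \<le> (1 / 100) ^ B0 * n" using B0B1 by linarith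
        then have "homogeneous_blockade E t ((1 / real (length Ls)) ^ (7 * B1) * n) Ls W"
          using homogeneous_blockade_mono[OF Ls(2) order_refl] Ls(1) by simp
        moreover have "2 \<le> length Ls" "real (length Ls) \<le> 1 / \<epsilon>" using Ls(1) \<epsilon> by (simp_all add: field_simps)
        ultimately have gmet unfolding gmet_def by blast
        then show ?thesis ..
      qed
    next
      case (Suc j)
      show ?case
      proof (cases gmet)
        case False
        then obtain S where S: "\<epsilon> \<le> z j" "S \<subseteq> W" "restricted E (z j) S" "z j ^ B1 * n \<le> real (card S)"
          using Suc.IH by blast
        define y where "y = z j"
        have y: "0 < y" "y \<le> 1 / 100" "\<epsilon> \<le> y" using z0 z100 S(1) by (auto simp: y_def)
        have npos: "0 < n" unfolding n_def using W ne by (simp add: card_gt_0_iff)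
        have "0 < y ^ B1 * n" using npos y by simp
        then have Sne: "S \<noteq> {}" using S(4) unfolding y_def by auto
        have yy: "y ^ (2 * B1) * n \<le> y ^ B1 * real (card S)"
        proof -
          have "y ^ (2 * B1) * n = y ^ B1 * (y ^ B1 * n)" by (simp add: mult_2 power_add)
          also have "\<dots> \<le> y ^ B1 * real (card S)" using S(4) y by (intro mult_left_mono) (auto simp: y_def)
          finally show ?thesis .
        qed
        from step[OF y(1,2) S(2) Sne S(3)[folded y_def]] show ?thesis
        proof
          assume "\<exists>S'\<subseteq>S. restricted E (y\<^sup>2) S' \<and> y ^ B1 * real (card S) \<le> real (card S')"
          then obtain S' where S': "S' \<subseteq> S" "restricted E (y\<^sup>2) S'" "y ^ B1 * real (card S) \<le> real (card S')" by blast
          have S'W: "S' \<subseteq> W" using S'(1) S(2) by blast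
          have cS': "y ^ (2 * B1) * n \<le> real (card S')" using yy S'(3) by linarith
          show ?thesis
          proof (cases "y\<^sup>2 \<le> \<epsilon>")
            case True
            then show ?thesis using gmet1[OF S'W S'(2) True cS' y(3)] by blast
          next
            case False
            have "y ^ (2 * B1) = (y\<^sup>2) ^ B1" by (simp add: power_mult)
            then show ?thesis using False S'W S'(2) cS' unfolding zSuc y_def by auto
          qed
        next
          assume "\<exists>Ls. length Ls = nat \<lfloor>1 / (8 * y)\<rfloor> \<and> homogeneous_blockade E t (y ^ B1 * real (card S)) Ls S"
          then obtain Ls where Ls: "length Ls = nat \<lfloor>1 / (8 * y)\<rfloor>"
            "homogeneous_blockade E t (y ^ B1 * real (card S)) Ls S" by blast
          define k where "k = real (length Ls)"
          have y8: "12 \<le> 1 / (8 * y)" using y by (simp add: field_simps)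
          then have k: "k \<le> 1 / (8 * y)" "1 / (8 * y) - 1 < k" "12 \<le> length Ls"
            unfolding k_def Ls(1) by linarith+
          have "1 / (8 * y) \<le> 1 / \<epsilon>" using y \<epsilon> by (intro frac_le) auto
          then have k\<epsilon>: "k \<le> 1 / \<epsilon>" using k(1) by linarith
          \<comment> \<open>Rounding down loses at most 1, which is less than
            \<open>1 / (8 * y) - 1 / (10 * y)\<close> because
            \<open>y \<le> 1 / 100\<close>.\<close>
          have "1 / (10 * y) \<le> 1 / (8 * y) - 1" using y by (simp add: field_simps)
          then have kl: "1 / (10 * y) \<le> k" using k(2) by linarith
          have ky: "(1 / k)\<^sup>2 \<le> y"
          proof -
            have "0 < k" using k(3) by (auto simp: k_def)
            then have "1 / k \<le> 1 / (1 / (10 * y))" using kl y by (intro divide_left_mono mult_pos_pos) auto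
            then have "1 / k \<le> 10 * y" using y by simp
            then have "(1 / k)\<^sup>2 \<le> (10 * y)\<^sup>2" using k(3) by (intro power_mono) (auto simp: k_def)
            also have "\<dots> = (100 * y) * y" by (simp add: power2_eq_square)
            also have "\<dots> \<le> 1 * y" using y by (intro mult_right_mono) auto
            finally show ?thesis by simp
          qed
          have "1 \<le> k" using k(3) by (simp add: k_def)
          then have k1: "0 \<le> 1 / k" "1 / k \<le> 1" by simp_all
          have "(1 / k) ^ (7 * B1) \<le> (1 / k) ^ (2 * (2 * B1))" using k1 by (intro power_decreasing) auto
          also have "\<dots> = ((1 / k)\<^sup>2) ^ (2 * B1)" by (rule power_mult)
          also have "\<dots> \<le> y ^ (2 * B1)" using ky by (intro power_mono) auto
          finally have "(1 / k) ^ (7 * B1) * n \<le> y ^ (2 * B1) * n" using n0 by (intro mult_right_mono)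
          then have "(1 / k) ^ (7 * B1) * n \<le> y ^ B1 * real (card S)" using yy by linarith
          then have "homogeneous_blockade E t ((1 / k) ^ (7 * B1) * n) Ls W"
            by (rule homogeneous_blockade_mono[OF Ls(2) S(2)])
          moreover have "2 \<le> length Ls" using k(3) by simp
          ultimately have gmet using k\<epsilon> unfolding gmet_def k_def by blast
          then show ?thesis ..
        qed
      qed blast
    qed
    have gmet
    proof (rule ccontr)
      assume nd: "\<not> gmet"
      obtain j where "(1 / 100 :: real) ^ j < \<epsilon>"
        using real_arch_pow_inv[OF \<epsilon>(1), of "1 / 100"] by auto
      moreover have "(1 / 100 :: real) ^ (2 ^ j) \<le> (1 / 100) ^ j"
        by (intro power_decreasing) (auto simp: less_imp_le[OF less_exp])
      ultimately show False using ind[of j] nd unfolding z_def by linarith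
    qed
    then show "(\<exists>S\<subseteq>W. restricted E \<epsilon> S \<and> \<epsilon> ^ (7 * B1) * real (card W) \<le> real (card S)) \<or>
      (\<exists>Ls. 2 \<le> length Ls \<and> real (length Ls) \<le> 1 / \<epsilon> \<and>
        homogeneous_blockade E t ((1 / real (length Ls)) ^ (7 * B1) * real (card W)) Ls W)"
      unfolding gmet_def n_def .
  qed
qed

section \<open>Long blockades\<close>

text \<open>Inside a block the trivial bound \<open>s ^ 2\<close> is used. A new front block
  receives few edges from each later vertex, and symmetry of \<open>E\<close> counts these edges
  once more from the front block; this is the term \<open>2 * l\<close> in
  \<open>(l + 1) ^ 2\<close>.\<close>

lemma blockade_edge_count:
  assumes "blockade E t r Ls W" "finite W" "symp E" "0 \<le> t" "\<And>A. A \<in> set Ls \<Longrightarrow> card A = s"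
  shows "card (\<Union>(set Ls)) = length Ls * s"
    "(\<Sum>v\<in>\<Union>(set Ls). real (card (nbs E v (\<Union>(set Ls))))) \<le> real (length Ls) * real s ^ 2 + real (length Ls) ^ 2 * real s * t"
proof -
  have "card (\<Union>(set Ls)) = length Ls * s \<and> (\<Sum>v\<in>\<Union>(set Ls). real (card (nbs E v (\<Union>(set Ls)))))
      \<le> real (length Ls) * real s ^ 2 + real (length Ls) ^ 2 * real s * t"
    using assms(1,5)
  proof (induction Ls)
    case (Cons A Ls)
    define U where "U = \<Union>(set Ls)"
    have bl: "blockade E t r Ls W" using Cons.prems(1) by (auto simp: blockade_def)
    have noise: "real (card (nbs E v A)) \<le> t" if "v \<in> U" for v
      using Cons.prems(1) that by (auto simp: blockade_def U_def)
    have AW: "A \<subseteq> W" "U \<subseteq> W" "A \<inter> U = {}" using Cons.prems(1) by (auto simp: blockade_def U_def)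
    have fin: "finite A" "finite U" using AW assms(2) finite_subset by blast+
    have cA: "card A = s" using Cons.prems(2) by simp
    have IH: "card U = length Ls * s"
      "(\<Sum>v\<in>U. real (card (nbs E v U))) \<le> real (length Ls) * real s ^ 2 + real (length Ls) ^ 2 * real s * t"
      using Cons.IH[OF bl] Cons.prems(2) unfolding U_def by auto
    have cN: "real (card (nbs E v (A \<union> U))) = real (card (nbs E v A)) + real (card (nbs E v U))" for v
    proof -
      have "nbs E v (A \<union> U) = nbs E v A \<union> nbs E v U" "nbs E v A \<inter> nbs E v U = {}"
        using AW(3) by (auto simp: nbs_def)
      then show ?thesis using fin by (simp add: card_Un_disjoint)
    qed
    have UA: "(\<Sum>v\<in>U. real (card (nbs E v A))) \<le> real (length Ls) * real s * t"
    proof -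
      have "(\<Sum>v\<in>U. real (card (nbs E v A))) \<le> (\<Sum>v\<in>U. t)" using noise by (rule sum_mono)
      then show ?thesis using IH(1) by simp
    qed
    have "(\<Sum>v\<in>A. card (nbs E v U)) = (\<Sum>v\<in>U. card (nbs E v A))"
      by (rule edge_count_sym[OF assms(3) fin])
    then have AU: "(\<Sum>v\<in>A. real (card (nbs E v U))) = (\<Sum>v\<in>U. real (card (nbs E v A)))"
      by (simp only: of_nat_sum[symmetric])
    have AA: "(\<Sum>v\<in>A. real (card (nbs E v A))) \<le> real s ^ 2"
    proof -
      have "real (card (nbs E v A)) \<le> real s" for v
        using fin(1) cA nbs_subset[of E v A] by (metis card_mono of_nat_le_iff)
      then have "(\<Sum>v\<in>A. real (card (nbs E v A))) \<le> (\<Sum>v\<in>A. real s)" by (intro sum_mono)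
      then show ?thesis using cA by (simp add: power2_eq_square)
    qed
    have "(\<Sum>v\<in>A \<union> U. real (card (nbs E v (A \<union> U)))) =
      (\<Sum>v\<in>A. real (card (nbs E v (A \<union> U)))) + (\<Sum>v\<in>U. real (card (nbs E v (A \<union> U))))"
      using fin AW(3) by (rule sum.union_disjoint)
    also have "\<dots> = (\<Sum>v\<in>A. real (card (nbs E v A))) + (\<Sum>v\<in>A. real (card (nbs E v U))) +
        ((\<Sum>v\<in>U. real (card (nbs E v A))) + (\<Sum>v\<in>U. real (card (nbs E v U))))"
      by (simp only: cN sum.distrib)
    also have "\<dots> \<le> real s ^ 2 + 2 * (real (length Ls) * real s * t) +
        (real (length Ls) * real s ^ 2 + real (length Ls) ^ 2 * real s * t)"
      using AA AU UA IH(2) by linarith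
    also have "\<dots> \<le> real (length (A # Ls)) * real s ^ 2 + real (length (A # Ls)) ^ 2 * real s * t"
    proof -
      have "real (length (A # Ls)) ^ 2 * real s * t =
          real (length Ls) ^ 2 * real s * t + 2 * (real (length Ls) * real s * t) + real s * t"
        by (simp add: power2_eq_square algebra_simps)
      moreover have "0 \<le> real s * t" using assms(4) by simp
      moreover have "real (length (A # Ls)) * real s ^ 2 = real (length Ls) * real s ^ 2 + real s ^ 2"
        by (simp add: algebra_simps)
      ultimately show ?thesis by linarith
    qed
    finally have "(\<Sum>v\<in>A \<union> U. real (card (nbs E v (A \<union> U)))) \<le> \<dots>" .
    moreover have "card (A \<union> U) = length (A # Ls) * s"
      using fin AW(3) cA IH(1) by (simp add: card_Un_disjoint)
    moreover have "\<Union>(set (A # Ls)) = A \<union> U" by (simp add: U_def)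
    ultimately show ?case by simp
  qed simp
  then show "card (\<Union>(set Ls)) = length Ls * s"
    "(\<Sum>v\<in>\<Union>(set Ls). real (card (nbs E v (\<Union>(set Ls))))) \<le> real (length Ls) * real s ^ 2 + real (length Ls) ^ 2 * real s * t"
    by blast+
qed

lemma blockade_trim:
  assumes "blockade E t r Ls W" "finite W" "l \<le> length Ls"
  obtains Ms where "length Ms = l" "blockade E t r Ms W" "\<And>A. A \<in> set Ms \<Longrightarrow> card A = nat \<lceil>r\<rceil>"
proof -
  have "\<exists>B. B \<subseteq> A \<and> card B = nat \<lceil>r\<rceil>" if A: "A \<in> set Ls" for A
  proof -
    have "nat \<lceil>r\<rceil> \<le> card A" using assms(1) A unfolding blockade_def by (metis of_nat_0_le_iff nat_ceiling_le_eq)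
    then show ?thesis by (metis obtain_subset_with_card_n)
  qed
  then obtain f where f: "\<And>A. A \<in> set Ls \<Longrightarrow> f A \<subseteq> A \<and> card (f A) = nat \<lceil>r\<rceil>" by metis
  define Ms where "Ms = map f (take l Ls)"
  have tk: "set (take l Ls) \<subseteq> set Ls" by (rule set_take_subset)
  have fin: "finite A" if "A \<in> set Ls" for A using assms(1,2) that unfolding blockade_def by (meson finite_subset)
  have "sorted_wrt (\<lambda>A B. A \<inter> B = {} \<and> (\<forall>v\<in>B. real (card (nbs E v A)) \<le> t)) (take l Ls)"
    using assms(1) unfolding blockade_def by (auto intro: sorted_wrt_take)
  then have "sorted_wrt (\<lambda>A B. f A \<inter> f B = {} \<and> (\<forall>v\<in>f B. real (card (nbs E v (f A))) \<le> t)) (take l Ls)"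
  proof (rule sorted_wrt_mono_rel[rotated])
    fix A B assume AB: "A \<in> set (take l Ls)" "B \<in> set (take l Ls)"
      "A \<inter> B = {} \<and> (\<forall>v\<in>B. real (card (nbs E v A)) \<le> t)"
    have A: "f A \<subseteq> A" "f B \<subseteq> B" "finite A" using f fin AB tk by blast+
    have "card (nbs E v (f A)) \<le> card (nbs E v A)" for v using A by (intro card_mono) (auto simp: nbs_def)
    then have "real (card (nbs E v (f A))) \<le> t" if "v \<in> f B" for v
      using AB(3) A(2) that by (meson of_nat_le_iff order_trans subsetD)
    then show "f A \<inter> f B = {} \<and> (\<forall>v\<in>f B. real (card (nbs E v (f A))) \<le> t)" using AB(3) A by blast
  qed
  then have sw: "sorted_wrt (\<lambda>A B. A \<inter> B = {} \<and> (\<forall>v\<in>B. real (card (nbs E v A)) \<le> t)) Ms"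
    unfolding Ms_def sorted_wrt_map .
  have "A \<subseteq> W \<and> card A = nat \<lceil>r\<rceil>" if A: "A \<in> set Ms" for A
  proof -
    obtain B where B: "B \<in> set Ls" "A = f B" using A tk by (auto simp: Ms_def)
    then have "B \<subseteq> W" using assms(1) by (auto simp: blockade_def)
    then show ?thesis using f[OF B(1)] B(2) by blast
  qed
  moreover have "r \<le> real (nat \<lceil>r\<rceil>)" by (rule real_nat_ceiling_ge)
  ultimately have "blockade E t r Ms W" using sw unfolding blockade_def by simp
  moreover have "length Ms = l" using assms(3) by (simp add: Ms_def)
  ultimately show thesis using that \<open>\<And>A. A \<in> set Ms \<Longrightarrow> A \<subseteq> W \<and> card A = nat \<lceil>r\<rceil>\<close> by blast
qed

text \<open>With \<open>t\<close> this small, the edges between blocks are no more numerous than the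
  trivial bound for those inside blocks, so the average degree in the union is at most twice the
  block size. By Markov's inequality half of the vertices have at most twice that degree.\<close>

lemma restricted_of_long_blockade:
  assumes \<epsilon>: "0 < \<epsilon>" "\<epsilon> \<le> 1 / 100" and bl: "blockade E t r Ls W" and W: "finite W" and sym: "symp E"
    and t: "0 \<le> t" "t \<le> \<epsilon>\<^sup>2 * r" and len: "1 / \<epsilon>\<^sup>2 \<le> real (length Ls)" and r: "0 < r"
  obtains S where "S \<subseteq> W" "sparse E \<epsilon> S" "r \<le> real (card S)"
proof -
  \<comment> \<open>At least \<open>8 / \<epsilon>\<close> blocks make a degree of
    \<open>4 * s\<close> at most the share \<open>\<epsilon>\<close> of half the union; at most
    \<open>1 / \<epsilon>\<^sup>2\<close> blocks keep \<open>l * t\<close> below the block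
    size.\<close>
  define l where "l = nat \<lceil>8 / \<epsilon>\<rceil>"
  have l: "8 / \<epsilon> \<le> real l" "real l \<le> 8 / \<epsilon> + 1" unfolding l_def using \<epsilon> by (simp_all add: of_nat_nat ceiling_correct)
  have "8 / \<epsilon> + 1 \<le> 1 / \<epsilon>\<^sup>2"
  proof -
    have "\<epsilon> * \<epsilon> \<le> \<epsilon> * (1 / 100)" using \<epsilon> by (intro mult_left_mono) auto
    then have "8 * \<epsilon> + \<epsilon> * \<epsilon> \<le> 1" using \<epsilon> by linarith
    then have "(8 * \<epsilon> + \<epsilon> * \<epsilon>) / (\<epsilon> * \<epsilon>) \<le> 1 / (\<epsilon> * \<epsilon>)" using \<epsilon> by (intro divide_right_mono) auto
    moreover have "(8 * \<epsilon> + \<epsilon> * \<epsilon>) / (\<epsilon> * \<epsilon>) = 8 / \<epsilon> + 1" using \<epsilon> by (simp add: field_simps)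
    ultimately show ?thesis by (simp add: power2_eq_square)
  qed
  then have l2: "real l \<le> 1 / \<epsilon>\<^sup>2" using l(2) by linarith
  then have "l \<le> length Ls" using len by linarith
  then obtain Ms where Ms: "length Ms = l" "blockade E t r Ms W" "\<And>A. A \<in> set Ms \<Longrightarrow> card A = nat \<lceil>r\<rceil>"
    using blockade_trim[OF bl W] by metis
  define s where "s = nat \<lceil>r\<rceil>"
  define U where "U = \<Union>(set Ms)"
  have rs: "r \<le> real s" unfolding s_def by (rule real_nat_ceiling_ge)
  have s0: "0 < real s" using rs r by linarith
  have UW: "U \<subseteq> W" using Ms(2) by (auto simp: U_def blockade_def)
  have finU: "finite U" using UW W finite_subset by blast
  have cU: "card U = l * s"
    using blockade_edge_count(1)[OF Ms(2) W sym t(1) Ms(3)] Ms(1) by (simp add: U_def s_def)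
  have "(\<Sum>v\<in>U. real (card (nbs E v U))) \<le> real l * real s ^ 2 + real l ^ 2 * real s * t"
    using blockade_edge_count(2)[OF Ms(2) W sym t(1) Ms(3)] Ms(1) by (simp add: U_def s_def)
  also have "real l ^ 2 * real s * t \<le> real l * real s ^ 2"
  proof -
    have "real l * t \<le> 1 / \<epsilon>\<^sup>2 * (\<epsilon>\<^sup>2 * r)" using l2 t by (intro mult_mono) auto
    also have "\<dots> = r" using \<epsilon> by simp
    finally have "real l * t \<le> real s" using rs by linarith
    then have "(real l * real s) * (real l * t) \<le> (real l * real s) * real s" by (intro mult_left_mono) auto
    then show ?thesis by (simp add: power2_eq_square mult_ac)
  qed
  finally have total: "(\<Sum>v\<in>U. real (card (nbs E v U))) \<le> 2 * (real l * real s ^ 2)" by simp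
  define S where "S = {v \<in> U. real (card (nbs E v U)) \<le> 4 * real s}"
  have SU: "S \<subseteq> U" by (auto simp: S_def)
  have "real (card (U - S)) * (4 * real s) = (\<Sum>v\<in>U - S. 4 * real s)" by simp
  also have "\<dots> \<le> (\<Sum>v\<in>U - S. real (card (nbs E v U)))" by (intro sum_mono) (auto simp: S_def)
  also have "\<dots> \<le> (\<Sum>v\<in>U. real (card (nbs E v U)))" using finU by (intro sum_mono2) auto
  also note total
  finally have "real (card (U - S)) * (4 * real s) \<le> (real l * real s / 2) * (4 * real s)"
    by (simp add: power2_eq_square)
  then have "real (card (U - S)) \<le> real l * real s / 2" using s0 by (simp only: mult_le_cancel_right)
  moreover have "real (card (U - S)) = real (card U) - real (card S)"
    using SU finU by (simp add: card_Diff_subset finite_subset of_nat_diff card_mono)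
  ultimately have cS: "real l * real s / 2 \<le> real (card S)" using cU by simp
  have l800: "8 \<le> real l"
  proof -
    have "8 \<le> 8 / \<epsilon>" using \<epsilon> by (simp add: field_simps)
    then show ?thesis using l by linarith
  qed
  show thesis
  proof (rule that[of S])
    show "S \<subseteq> W" using SU UW by blast
    have "8 / 2 * real s \<le> real l * real s / 2" using l800 s0 by simp
    then show "r \<le> real (card S)" using cS rs s0 by linarith
    show "sparse E \<epsilon> S"
      unfolding sparse_def
    proof
      fix v assume v: "v \<in> S"
      have "card (nbs E v S) \<le> card (nbs E v U)" using SU finU by (intro card_mono) (auto simp: nbs_def)
      then have "real (card (nbs E v S)) \<le> 4 * real s" using v by (auto simp: S_def)
      also have "\<dots> \<le> \<epsilon> * (real l * real s / 2)"
      proof -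
        have "8 \<le> \<epsilon> * real l" using l(1) \<epsilon> by (simp add: field_simps)
        then have "8 * real s \<le> \<epsilon> * real l * real s" using s0 by (intro mult_right_mono) auto
        then show ?thesis by simp
      qed
      also have "\<dots> \<le> \<epsilon> * real (card S)" using cS \<epsilon> by (intro mult_left_mono) auto
      finally show "real (card (nbs E v S)) \<le> \<epsilon> * real (card S)" .
    qed
  qed
qed

section \<open>Induction on the rank\<close>

lemma blockade_concat:
  assumes "blockade F t r Ls W" "finite W" "\<And>A. A \<in> set Ls \<Longrightarrow> blockade F t s (f A) A"
  shows "blockade F t s (concat (map f Ls)) W"
  using assms(1,3)
proof (induction Ls)
  case Nil
  then show ?case by (simp add: blockade_def)
next
  case (Cons A Ls)
  have "blockade F t r Ls W" using Cons.prems(1) by (auto simp: blockade_def)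
  then have IH: "blockade F t s (concat (map f Ls)) W" using Cons.IH Cons.prems(2) by simp
  have AW: "A \<subseteq> W" and cross: "\<And>A'. A' \<in> set Ls \<Longrightarrow> A \<inter> A' = {} \<and> (\<forall>v\<in>A'. real (card (nbs F v A)) \<le> t)"
    using Cons.prems(1) by (auto simp: blockade_def)
  have finA: "finite A" using AW assms(2) finite_subset by blast
  have bA: "blockade F t s (f A) A" using Cons.prems(2) by simp
  have "X \<inter> Y = {} \<and> (\<forall>v\<in>Y. real (card (nbs F v X)) \<le> t)"
    if XY: "X \<in> set (f A)" "Y \<in> set (concat (map f Ls))" for X Y
  proof -
    obtain A' where A': "A' \<in> set Ls" "Y \<in> set (f A')" using XY(2) by auto
    have XA: "X \<subseteq> A" using bA XY(1) by (auto simp: blockade_def)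
    have YA: "Y \<subseteq> A'" using Cons.prems(2)[of A'] A' by (auto simp: blockade_def)
    have "card (nbs F v X) \<le> card (nbs F v A)" for v using XA finA by (intro card_mono) (auto simp: nbs_def)
    then have "real (card (nbs F v X)) \<le> t" if "v \<in> Y" for v
      using cross[OF A'(1)] YA that by (meson of_nat_le_iff order_trans subsetD)
    then show ?thesis using cross[OF A'(1)] XA YA by blast
  qed
  moreover have "blockade F t s (f A) W" by (rule blockade_mono[OF bA AW order_refl])
  ultimately show ?case using IH unfolding blockade_def by (simp add: sorted_wrt_append ball_Un)
qed

text \<open>The inductive step of the cograph argument. The \<open>F\<close>-parts of all blocks are
  concatenated, while only a longest \<open>G\<close>-part, of length \<open>w\<close>, is kept. The
  product of the new lengths is then at least \<open>length Ls\<close> times the smallest product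
  \<open>m\<close> found in a block.\<close>

lemma merge_blockades:
  assumes bl: "blockade F t r Ls W" and W: "finite W" and Ls: "Ls \<noteq> []"
    and size: "real (card W) \<le> real (length Ls) ^ B * r" and s1: "0 \<le> s1"
    and sub: "\<And>A. A \<in> set Ls \<Longrightarrow> \<exists>La Lb. blockade F t s La A \<and> blockade G t s Lb A \<and>
      real (card A) \<le> s1 * (real (length La) * real (length Lb)) ^ B"
  shows "\<exists>La Lb. blockade F t s La W \<and> blockade G t s Lb W \<and>
      real (card W) \<le> s1 * (real (length La) * real (length Lb)) ^ B"
proof -
  obtain f g where fg: "\<And>A. A \<in> set Ls \<Longrightarrow> blockade F t s (f A) A"
    "\<And>A. A \<in> set Ls \<Longrightarrow> blockade G t s (g A) A"
    "\<And>A. A \<in> set Ls \<Longrightarrow> real (card A) \<le> s1 * (real (length (f A)) * real (length (g A))) ^ B"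
  proof -
    have "\<forall>A\<in>set Ls. \<exists>p. blockade F t s (fst p) A \<and> blockade G t s (snd p) A \<and>
      real (card A) \<le> s1 * (real (length (fst p)) * real (length (snd p))) ^ B"
      using sub by (metis fst_conv snd_conv)
    then obtain h where h: "\<forall>A\<in>set Ls. blockade F t s (fst (h A)) A \<and> blockade G t s (snd (h A)) A \<and>
      real (card A) \<le> s1 * (real (length (fst (h A))) * real (length (snd (h A)))) ^ B"
      by (rule bchoice[THEN exE])
    show thesis by (rule that[of "\<lambda>A. fst (h A)" "\<lambda>A. snd (h A)"]) (use h in blast)+
  qed
  define w where "w = Max ((\<lambda>A. length (g A)) ` set Ls)"
  define m where "m = Min ((\<lambda>A. length (f A) * length (g A)) ` set Ls)"
  have "w \<in> (\<lambda>A. length (g A)) ` set Ls" unfolding w_def using Ls by (intro Max_in) auto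
  then obtain A1 where A1: "A1 \<in> set Ls" "w = length (g A1)" by blast
  have "m \<in> (\<lambda>A. length (f A) * length (g A)) ` set Ls" unfolding m_def using Ls by (intro Min_in) auto
  then obtain A0 where A0: "A0 \<in> set Ls" "m = length (f A0) * length (g A0)" by blast
  have le: "m \<le> length (f A) * w" if "A \<in> set Ls" for A
  proof -
    have "m \<le> length (f A) * length (g A)" unfolding m_def using that by (intro Min_le) auto
    also have "\<dots> \<le> length (f A) * w" unfolding w_def using that by (intro mult_left_mono Max_ge) auto
    finally show ?thesis .
  qed
  have "length Ls * m \<le> length (concat (map f Ls)) * w" using le
    by (induction Ls) (simp_all add: add_mult_distrib add_mono)
  then have "real (length Ls * m) \<le> real (length (concat (map f Ls)) * w)" by (simp only: of_nat_le_iff)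
  then have km: "real (length Ls) * real m \<le> real (length (concat (map f Ls))) * real w" by simp
  have "r \<le> real (card A0)" using bl A0(1) by (auto simp: blockade_def)
  also have "\<dots> \<le> s1 * real m ^ B" using fg(3)[OF A0(1)] A0(2) by simp
  finally have "real (length Ls) ^ B * r \<le> real (length Ls) ^ B * (s1 * real m ^ B)" by (intro mult_left_mono) auto
  also have "\<dots> = s1 * (real (length Ls) * real m) ^ B" by (simp add: power_mult_distrib)
  also have "\<dots> \<le> s1 * (real (length (concat (map f Ls))) * real w) ^ B"
    using km s1 by (intro mult_left_mono power_mono) auto
  finally have "real (card W) \<le> s1 * (real (length (concat (map f Ls))) * real (length (g A1))) ^ B"
    using size unfolding A1(2)[symmetric] by linarith
  moreover have "blockade F t s (concat (map f Ls)) W" by (rule blockade_concat[OF bl W fg(1)])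
  moreover have "blockade G t s (g A1) W"
    using fg(2)[OF A1(1)] by (rule blockade_mono) (use bl A1(1) in \<open>auto simp: blockade_def\<close>)
  ultimately show ?thesis by blast
qed

text \<open>Recursion into the blocks until at most \<open>s1\<close> vertices are left, where a
  single block serves for both kinds. Only sets larger than \<open>s1\<close> are divided, and into
  at most \<open>1 / \<epsilon>\<close> blocks, so no block falls below
  \<open>\<epsilon> ^ B * s1\<close>.\<close>

lemma blockade_pair_product:
  assumes \<epsilon>: "0 < \<epsilon>" and s1: "0 < s1" and s: "s = \<epsilon> ^ B * s1" and V: "finite V"
    and chunks: "\<And>W. W \<subseteq> V \<Longrightarrow> s1 < real (card W) \<Longrightarrow> \<exists>Ls. 2 \<le> length Ls \<and> real (length Ls) \<le> 1 / \<epsilon> \<and>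
      homogeneous_blockade E t ((1 / real (length Ls)) ^ B * real (card W)) Ls W"
    and W: "W \<subseteq> V" "s \<le> real (card W)"
  shows "\<exists>La Lb. blockade E t s La W \<and> blockade (\<lambda>a b. \<not> E a b) t s Lb W \<and>
    real (card W) \<le> s1 * (real (length La) * real (length Lb)) ^ B"
  using W
proof (induction "card W" arbitrary: W rule: less_induct)
  case less
  have finW: "finite W" using less.prems(1) V finite_subset by blast
  show ?case
  proof (cases "real (card W) \<le> s1")
    case True
    have "blockade F t s [W] W" for F using less.prems(2) by (simp add: blockade_def)
    then show ?thesis using True by (intro exI[of _ "[W]"]) simp
  next
    case False
    then obtain Ls where Ls: "2 \<le> length Ls" "real (length Ls) \<le> 1 / \<epsilon>"
      "homogeneous_blockade E t ((1 / real (length Ls)) ^ B * real (card W)) Ls W"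
      using chunks[OF less.prems(1)] by force
    define r where "r = (1 / real (length Ls)) ^ B * real (card W)"
    have Lsne: "Ls \<noteq> []"
    proof
      assume "Ls = []"
      then show False using Ls(1) by simp
    qed
    then have k0: "0 < real (length Ls)" by simp
    have "\<epsilon> \<le> 1 / real (length Ls)" using Ls(2) k0 \<epsilon> by (simp add: field_simps)
    then have "\<epsilon> ^ B * s1 \<le> r" unfolding r_def using \<epsilon> s1 False by (intro mult_mono power_mono) auto
    then have sr: "s \<le> r" using s by simp
    have s0: "0 < s" using s s1 \<epsilon> by simp
    have size: "real (card W) \<le> real (length Ls) ^ B * r"
      using k0 by (simp add: r_def power_divide)
    have sub: "\<exists>La Lb. blockade E t s La A \<and> blockade (\<lambda>a b. \<not> E a b) t s Lb A \<and>
      real (card A) \<le> s1 * (real (length La) * real (length Lb)) ^ B"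
      if bl: "blockade F t r Ls W" and A: "A \<in> set Ls" for A F
    proof (rule less.hyps)
      have blk: "X \<subseteq> W" "s \<le> real (card X)" if "X \<in> set Ls" for X
        using bl that sr unfolding blockade_def by force+
      show "A \<subseteq> V" "s \<le> real (card A)" using blk[OF A] less.prems(1) by blast+
      obtain i where i: "i < length Ls" "Ls ! i = A" using A by (auto simp: in_set_conv_nth)
      \<comment> \<open>A second block, nonempty and disjoint from \<open>A\<close>, shows that
        \<open>A\<close> is a proper subset of \<open>W\<close>.\<close>
      define j where "j = (if i = 0 then 1 else 0 :: nat)"
      have j: "j < length Ls" "j \<noteq> i" using Ls(1) by (auto simp: j_def)
      have sw: "sorted_wrt (\<lambda>A B. A \<inter> B = {} \<and> (\<forall>v\<in>B. real (card (nbs F v A)) \<le> t)) Ls"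
        using bl by (simp add: blockade_def)
      have disj: "Ls ! j \<inter> A = {}"
        using sorted_wrt_nth_less[OF sw, of i j] sorted_wrt_nth_less[OF sw, of j i] i j
        by (cases "i < j") auto
      have "s \<le> real (card (Ls ! j))" "Ls ! j \<subseteq> W" using blk[of "Ls ! j"] j by auto
      then have "Ls ! j \<noteq> {}" using s0 by auto
      then have "A \<subset> W" using disj blk(1)[OF A] \<open>Ls ! j \<subseteq> W\<close> by blast
      then show "card A < card W" by (rule psubset_card_mono[OF finW])
    qed
    from Ls(3) consider "blockade E t r Ls W" | "blockade (\<lambda>a b. \<not> E a b) t r Ls W"
      unfolding homogeneous_blockade_def r_def by blast
    then show ?thesis
    proof cases
      case 1
      show ?thesis using merge_blockades[OF 1 finW Lsne size less_imp_le[OF s1] sub[OF 1]] .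
    next
      case 2
      have "\<exists>La Lb. blockade (\<lambda>a b. \<not> E a b) t s La W \<and> blockade E t s Lb W \<and>
        real (card W) \<le> s1 * (real (length La) * real (length Lb)) ^ B"
      proof (rule merge_blockades[OF 2 finW Lsne size less_imp_le[OF s1]])
        fix A assume "A \<in> set Ls"
        from sub[OF 2 this] show "\<exists>La Lb. blockade (\<lambda>a b. \<not> E a b) t s La A \<and> blockade E t s Lb A \<and>
          real (card A) \<le> s1 * (real (length La) * real (length Lb)) ^ B"
          by (metis mult.commute)
      qed
      then show ?thesis by (metis mult.commute)
    qed
  qed
qed

lemma rank_bound_Suc:
  fixes D e C :: nat
  obtains C' :: nat where "\<And>E :: 'v \<Rightarrow> 'v \<Rightarrow> bool. symp E \<Longrightarrow> rank_bound E D e C \<Longrightarrow> rank_bound E D (Suc e) C'"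
proof (rule chunk[of D e C])
  fix B :: nat
  assume B: "1 \<le> B" and chunk: "\<And>\<epsilon> E (W :: 'v set) t. 0 < \<epsilon> \<Longrightarrow> \<epsilon> \<le> 1 / 100 \<Longrightarrow> W \<noteq> {} \<Longrightarrow>
    admissible D e C t E W \<Longrightarrow>
    (\<exists>S\<subseteq>W. restricted E \<epsilon> S \<and> \<epsilon> ^ B * real (card W) \<le> real (card S)) \<or>
    (\<exists>Ls. 2 \<le> length Ls \<and> real (length Ls) \<le> 1 / \<epsilon> \<and>
      homogeneous_blockade E t ((1 / real (length Ls)) ^ B * real (card W)) Ls W)"
  \<comment> \<open>The share \<open>4 * B\<close> makes the product of the two lengths at least
    \<open>1 / \<epsilon> ^ 4\<close>, so that one of them reaches
    \<open>1 / \<epsilon>\<^sup>2\<close>. Another \<open>B\<close> leads from \<open>s1\<close> to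
    the block size \<open>s\<close>, and the final 2 gives
    \<open>t = \<epsilon>\<^sup>2 * s\<close>, the noise that
    \<open>restricted_of_long_blockade\<close> tolerates.\<close>
  define C' where "C' = 5 * B + 2"
  show thesis
  proof (rule that[of C'])
    fix E :: "'v \<Rightarrow> 'v \<Rightarrow> bool"
    assume sym: "symp E" and rb: "rank_bound E D e C"
    show "rank_bound E D (Suc e) C'"
      unfolding rank_bound_def
    proof (intro allI impI, rule ccontr)
      fix \<epsilon> :: real and V :: "'v set"
      assume \<epsilon>: "0 < \<epsilon>" "\<epsilon> \<le> 1 / 100" and V: "finite V" "V \<noteq> {}" and nosh: "no_shatter E V D"
        and notrob: "\<not> robust E (\<epsilon> ^ C' * real (card V)) (Suc e) V"
        and contra: "\<not> (\<exists>S\<subseteq>V. restricted E \<epsilon> S \<and> \<epsilon> ^ C' * real (card V) \<le> real (card S))"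
      define n where "n = real (card V)"
      define t where "t = \<epsilon> ^ C' * n"
      define s1 where "s1 = \<epsilon> ^ (4 * B) * n"
      define s where "s = \<epsilon> ^ B * s1"
      have n0: "0 < n" unfolding n_def using V by (simp add: card_gt_0_iff)
      have s1: "0 < s1" and s0: "0 < s" and t0: "0 \<le> t" using n0 \<epsilon> by (simp_all add: s1_def s_def t_def)
      have s_eq: "s = \<epsilon> ^ (5 * B) * n" by (simp add: s_def s1_def power_add[symmetric])
      have ts: "t = \<epsilon>\<^sup>2 * s" by (simp add: t_def s_eq C'_def power_add power2_eq_square)
      have "\<epsilon>\<^sup>2 * s \<le> 1 * s" using \<epsilon> s0 by (intro mult_right_mono) (auto intro: power_le_one)
      then have tles: "t \<le> s" using ts by simp
      have no: "real (card S) < s" if "S \<subseteq> V" "restricted E \<epsilon> S" for S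
      proof -
        have "real (card S) < t" using contra that unfolding t_def n_def by (meson not_le)
        then show ?thesis using tles by linarith
      qed
      have adm: "admissible D e C t E V"
        using V(1) sym rb nosh notrob by (simp add: admissible_def t_def n_def)
      have chunks: "\<exists>Ls. 2 \<le> length Ls \<and> real (length Ls) \<le> 1 / \<epsilon> \<and>
        homogeneous_blockade E t ((1 / real (length Ls)) ^ B * real (card W)) Ls W"
        if W: "W \<subseteq> V" "s1 < real (card W)" for W
      proof -
        have "W \<noteq> {}" using W(2) s1 by auto
        from chunk[OF \<epsilon> this admissible_subset[OF adm W(1)]] show ?thesis
        proof
          assume "\<exists>S\<subseteq>W. restricted E \<epsilon> S \<and> \<epsilon> ^ B * real (card W) \<le> real (card S)"
          then obtain S where S: "S \<subseteq> W" "restricted E \<epsilon> S" "\<epsilon> ^ B * real (card W) \<le> real (card S)" by blast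
          have "s \<le> \<epsilon> ^ B * real (card W)" unfolding s_def using W(2) \<epsilon> by (intro mult_left_mono) auto
          moreover have "real (card S) < s" using no[OF _ S(2)] S(1) W(1) by blast
          ultimately show ?thesis using S(3) by linarith
        qed
      qed
      have "s \<le> real (card V)"
      proof -
        have "\<epsilon> ^ (5 * B) * n \<le> 1 * n" using \<epsilon> n0 by (intro mult_right_mono power_le_one) auto
        then show ?thesis by (simp add: s_eq n_def)
      qed
      from blockade_pair_product[OF \<epsilon>(1) s1 s_def V(1) chunks order_refl this]
      obtain La Lb where L: "blockade E t s La V" "blockade (\<lambda>a b. \<not> E a b) t s Lb V"
        "n \<le> s1 * (real (length La) * real (length Lb)) ^ B" unfolding n_def by blast
      have long: "1 / \<epsilon>\<^sup>2 \<le> real (length La) \<or> 1 / \<epsilon>\<^sup>2 \<le> real (length Lb)"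
      proof (rule ccontr)
        assume "\<not> ?thesis"
        then have "real (length La) * real (length Lb) < 1 / \<epsilon>\<^sup>2 * (1 / \<epsilon>\<^sup>2)"
          by (intro mult_strict_mono') auto
        then have "(real (length La) * real (length Lb)) ^ B < (1 / \<epsilon>\<^sup>2 * (1 / \<epsilon>\<^sup>2)) ^ B"
          using B by (intro power_strict_mono) auto
        also have "\<dots> = (1 / \<epsilon> ^ 4) ^ B" by (simp add: power_add[symmetric])
        also have "\<dots> = 1 / \<epsilon> ^ (4 * B)" by (simp add: power_one_over power_mult)
        finally have "s1 * (real (length La) * real (length Lb)) ^ B < s1 * (1 / \<epsilon> ^ (4 * B))"
          using s1 by (intro mult_strict_left_mono)
        also have "\<dots> = n" using \<epsilon> by (simp add: s1_def)
        finally show False using L(3) by linarith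
      qed
      have fin: False if F: "blockade F t s Ls V" "symp F" "1 / \<epsilon>\<^sup>2 \<le> real (length Ls)"
        and r: "\<And>S. sparse F \<epsilon> S \<Longrightarrow> restricted E \<epsilon> S" for F Ls
      proof (rule restricted_of_long_blockade[OF \<epsilon> F(1) V(1) F(2) t0 _ F(3) s0])
        show "t \<le> \<epsilon>\<^sup>2 * s" using ts by simp
        fix S assume "S \<subseteq> V" "sparse F \<epsilon> S" "s \<le> real (card S)"
        then show False using no[of S] r by force
      qed
      from long show False
      proof
        assume "1 / \<epsilon>\<^sup>2 \<le> real (length La)"
        then show False using fin[OF L(1) sym] by (simp add: restricted_def)
      next
        assume *: "1 / \<epsilon>\<^sup>2 \<le> real (length Lb)"
        have "symp (\<lambda>a b. \<not> E a b)" using sym by (auto simp: symp_def)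
        from fin[OF L(2) this *] show False by (simp add: restricted_def)
      qed
    qed
  qed
qed

lemma rank_bound_exists: "\<exists>C. \<forall>E :: 'v \<Rightarrow> 'v \<Rightarrow> bool. symp E \<longrightarrow> rank_bound E D e C"
proof (induction e)
  case 0
  \<comment> \<open>The only pattern class of the empty tuple is all of \<open>V\<close>, so the
    tuple is robust and the bound holds vacuously.\<close>
  have "robust E (\<epsilon> ^ 0 * real (card V)) 0 V" for \<epsilon> and V :: "'v set" and E
    unfolding robust_def by (intro exI[of _ "[]"]) (auto simp: pattern_class_def)
  then show ?case by (intro exI[of _ 0]) (simp add: rank_bound_def)
next
  case (Suc e)
  then obtain C where C: "\<And>E :: 'v \<Rightarrow> 'v \<Rightarrow> bool. symp E \<Longrightarrow> rank_bound E D e C" by blast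
  show ?case
  proof (rule rank_bound_Suc[of D e C])
    fix C' assume "\<And>E :: 'v \<Rightarrow> 'v \<Rightarrow> bool. symp E \<Longrightarrow> rank_bound E D e C \<Longrightarrow> rank_bound E D (Suc e) C'"
    then show ?thesis using C by (intro exI[of _ C']) simp
  qed
qed

text \<open>A robust \<open>D\<close>-tuple realises every pattern. The pattern that is true at
  position \<open>i\<close> only shows its entries to be distinct, so they would form a shattered
  set of size \<open>D\<close>.\<close>

lemma not_robust_of_no_shatter:
  assumes sym: "symp E" and nosh: "no_shatter E V D" and \<tau>: "0 < \<tau>"
  shows "\<not> robust E \<tau> D V"
proof
  assume "robust E \<tau> D V"
  then obtain zs where zs: "length zs = D" "set zs \<subseteq> V"
    "\<And>bs. length bs = D \<Longrightarrow> \<tau> \<le> real (card (pattern_class E zs bs V))"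
    unfolding robust_def by blast
  have ex: "\<exists>u\<in>V. \<forall>i<D. E (zs ! i) u = bs ! i" if bs: "length bs = D" for bs
  proof -
    have "pattern_class E zs bs V \<noteq> {}" using zs(3)[OF bs] \<tau> by auto
    then show ?thesis using zs(1) bs by (auto simp: pattern_class_def list_all2_conv_all_nth)
  qed
  have "distinct zs"
    unfolding distinct_conv_nth
  proof (intro allI impI)
    fix i j assume ij: "i < length zs" "j < length zs" "i \<noteq> j"
    obtain u where u: "\<And>k. k < D \<Longrightarrow> E (zs ! k) u = map (\<lambda>k. k = i) [0..<D] ! k"
      using ex[of "map (\<lambda>k. k = i) [0..<D]"] by auto
    show "zs ! i \<noteq> zs ! j" using u[of i] u[of j] ij zs(1) by auto
  qed
  then have "card (set zs) = D" using zs(1) by (simp add: distinct_card)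
  then obtain P where P: "P \<subseteq> set zs" "\<And>v. v \<in> V \<Longrightarrow> nbs E v (set zs) \<noteq> P"
    using no_shatterD[OF nosh zs(2)] by metis
  obtain u where u: "u \<in> V" "\<And>k. k < D \<Longrightarrow> E (zs ! k) u = map (\<lambda>z. z \<in> P) zs ! k"
    using ex[of "map (\<lambda>z. z \<in> P) zs"] zs(1) by auto
  have "E u z \<longleftrightarrow> z \<in> P" if z: "z \<in> set zs" for z
  proof -
    obtain k where "k < D" "zs ! k = z" using z zs(1) by (auto simp: in_set_conv_nth)
    then have "E z u \<longleftrightarrow> z \<in> P" using u(2)[of k] zs(1) by simp
    then show ?thesis using sympD[OF sym] by blast
  qed
  then have "nbs E u (set zs) = P" using P(1) by (auto simp: nbs_def)
  then show False using P(2)[OF u(1)] by blast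
qed

section \<open>From nearly pure sets to homogeneous sets\<close>

lemma independent_subset:
  assumes S: "finite S" and sym: "symp F" and deg: "\<And>v. v \<in> S \<Longrightarrow> real (card (nbs F v S)) \<le> \<Delta>"
  obtains I where "I \<subseteq> S" "\<And>x y. x \<in> I \<Longrightarrow> y \<in> I \<Longrightarrow> x \<noteq> y \<Longrightarrow> \<not> F x y"
    "real (card S) \<le> real (card I) * (\<Delta> + 1)"
proof -
  define Q where "Q I \<longleftrightarrow> I \<subseteq> S \<and> (\<forall>x\<in>I. \<forall>y\<in>I. x \<noteq> y \<longrightarrow> \<not> F x y)" for I
  have bound: "\<forall>I. Q I \<longrightarrow> card I < Suc (card S)" using S by (auto simp: Q_def card_mono less_Suc_eq_le)
  have "Q {}" by (simp add: Q_def)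
  then obtain I where I: "Q I" "\<And>J. Q J \<Longrightarrow> card J \<le> card I"
    using ex_has_greatest_nat[OF \<open>Q {}\<close> bound] by metis
  have IS: "I \<subseteq> S" and ind: "\<And>x y. x \<in> I \<Longrightarrow> y \<in> I \<Longrightarrow> x \<noteq> y \<Longrightarrow> \<not> F x y" using I(1) by (auto simp: Q_def)
  have finI: "finite I" using IS S finite_subset by blast
  \<comment> \<open>A largest independent set dominates \<open>S\<close>: an uncovered vertex could
    be added to it.\<close>
  have cover: "S \<subseteq> (\<Union>v\<in>I. insert v (nbs F v S))"
  proof
    fix u assume u: "u \<in> S"
    show "u \<in> (\<Union>v\<in>I. insert v (nbs F v S))"
    proof (rule ccontr)
      assume n: "u \<notin> (\<Union>v\<in>I. insert v (nbs F v S))"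
      then have uI: "u \<notin> I" and nF: "\<And>v. v \<in> I \<Longrightarrow> \<not> F v u" using u by (auto simp: nbs_def)
      have nF': "\<not> F u v" if "v \<in> I" for v using nF[OF that] sympD[OF sym] by blast
      have "Q (insert u I)" unfolding Q_def using u IS ind nF nF' by blast
      then have "card (insert u I) \<le> card I" by (rule I(2))
      then show False using uI finI by simp
    qed
  qed
  have "card S \<le> card (\<Union>v\<in>I. insert v (nbs F v S))" using finI S by (intro card_mono cover) auto
  also have "\<dots> \<le> (\<Sum>v\<in>I. card (insert v (nbs F v S)))" by (rule card_UN_le[OF finI])
  finally have "real (card S) \<le> real (\<Sum>v\<in>I. card (insert v (nbs F v S)))" by (simp only: of_nat_le_iff)
  also have "\<dots> = (\<Sum>v\<in>I. real (card (insert v (nbs F v S))))" by simp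
  also have "\<dots> \<le> (\<Sum>v\<in>I. \<Delta> + 1)"
  proof (rule sum_mono)
    fix v assume "v \<in> I"
    then have "real (card (nbs F v S)) \<le> \<Delta>" using deg IS by blast
    moreover have "card (insert v (nbs F v S)) \<le> card (nbs F v S) + 1" using S by (simp add: card_insert_if)
    ultimately show "real (card (insert v (nbs F v S))) \<le> \<Delta> + 1" by linarith
  qed
  also have "\<dots> = real (card I) * (\<Delta> + 1)" by simp
  finally show thesis using that IS ind by blast
qed

text \<open>For \<open>m\<close> the power \<open>1 / (C + 1)\<close> of \<open>card V\<close> and
  \<open>\<epsilon> = 1 / m\<close>, the size bound \<open>\<epsilon> ^ C * card V\<close> equals
  \<open>m\<close>. Degrees in \<open>S\<close> are then at most \<open>card S / m\<close>, which
  leaves an independent set of at least \<open>m / 2\<close> vertices. The weaker factor 1 / 100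
  lets a single vertex settle the case \<open>m \<le> 100\<close>.\<close>

lemma large_homogeneous_set:
  obtains c :: real where "0 < c" "\<And>E (V :: 'v set). finite V \<Longrightarrow> symp E \<Longrightarrow> no_shatter E V D \<Longrightarrow>
    \<exists>I\<subseteq>V. (\<exists>b. \<forall>x\<in>I. \<forall>y\<in>I. x \<noteq> y \<longrightarrow> E x y = b) \<and> real (card V) powr c / 100 \<le> real (card I)"
proof -
  obtain C where C: "\<And>E :: 'v \<Rightarrow> 'v \<Rightarrow> bool. symp E \<Longrightarrow> rank_bound E D D C" using rank_bound_exists by blast
  define c where "c = 1 / (real C + 1)"
  have c0: "0 < c" by (simp add: c_def)
  show thesis
  proof (rule that[OF c0])
    fix E and V :: "'v set"
    assume V: "finite V" and sym: "symp E" and nosh: "no_shatter E V D"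
    define m where "m = real (card V) powr c"
    show "\<exists>I\<subseteq>V. (\<exists>b. \<forall>x\<in>I. \<forall>y\<in>I. x \<noteq> y \<longrightarrow> E x y = b) \<and> real (card V) powr c / 100 \<le> real (card I)"
    proof (cases "V = {}")
      case False
      then obtain w where w: "w \<in> V" by blast
      have n0: "0 < real (card V)" using V False by (simp add: card_gt_0_iff)
      have m0: "0 < m" using n0 by (simp add: m_def)
      show ?thesis
      proof (cases "m \<le> 100")
        case True
        then show ?thesis using w by (intro exI[of _ "{w}"]) (simp add: m_def)
      next
        case large: False
        define \<epsilon> where "\<epsilon> = 1 / m"
        have \<epsilon>: "0 < \<epsilon>" "\<epsilon> \<le> 1 / 100" using large by (auto simp: \<epsilon>_def field_simps)
        have "\<epsilon> ^ C * real (card V) = m"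
        proof -
          have "m ^ (C + 1) = real (card V) powr (c * real (C + 1))"
            using n0 by (simp only: m_def powr_powr[symmetric] powr_realpow[OF m0[unfolded m_def]])
          also have "c * real (C + 1) = 1" by (simp add: c_def add.commute)
          finally have "m ^ (C + 1) = real (card V)" using n0 by simp
          then show ?thesis using m0 by (simp add: \<epsilon>_def power_divide field_simps)
        qed
        moreover have "\<not> robust E m D V" by (rule not_robust_of_no_shatter[OF sym nosh m0])
        ultimately obtain S where S: "S \<subseteq> V" "restricted E \<epsilon> S" "m \<le> real (card S)"
          using rank_boundD[OF C[OF sym] \<epsilon> V False nosh] by metis
        have finS: "finite S" using S(1) V finite_subset by blast
        have main: "\<exists>I\<subseteq>S. (\<forall>x\<in>I. \<forall>y\<in>I. x \<noteq> y \<longrightarrow> \<not> F x y) \<and> m / 100 \<le> real (card I)"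
          if F: "symp F" "sparse F \<epsilon> S" for F
        proof -
          obtain I where I: "I \<subseteq> S" "\<And>x y. x \<in> I \<Longrightarrow> y \<in> I \<Longrightarrow> x \<noteq> y \<Longrightarrow> \<not> F x y"
            "real (card S) \<le> real (card I) * (\<epsilon> * real (card S) + 1)"
            using independent_subset[OF finS F(1), of "\<epsilon> * real (card S)"] F(2) unfolding sparse_def by metis
          have "1 \<le> \<epsilon> * real (card S)" using S(3) m0 by (simp add: \<epsilon>_def)
          then have "real (card I) * (\<epsilon> * real (card S) + 1) \<le> real (card I) * (2 * (\<epsilon> * real (card S)))"
            by (intro mult_left_mono) auto
          then have "1 * real (card S) \<le> (real (card I) * (2 * \<epsilon>)) * real (card S)" using I(3) by (simp add: mult_ac)
          moreover have "0 < real (card S)" using S(3) m0 by linarith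
          ultimately have "1 \<le> real (card I) * (2 * \<epsilon>)" by (simp only: mult_le_cancel_right)
          then have "m \<le> 2 * real (card I)" using m0 by (simp add: \<epsilon>_def field_simps)
          then have "m / 100 \<le> real (card I)" using m0 by linarith
          then show ?thesis using I(1,2) by blast
        qed
        have symc: "symp (\<lambda>a b. \<not> E a b)" using sym by (auto simp: symp_def)
        from S(2) consider "sparse E \<epsilon> S" | "sparse (\<lambda>a b. \<not> E a b) \<epsilon> S" unfolding restricted_def by blast
        then show ?thesis
        proof cases
          case 1
          from main[OF sym 1] obtain I where "I \<subseteq> S" "\<forall>x\<in>I. \<forall>y\<in>I. x \<noteq> y \<longrightarrow> \<not> E x y" "m / 100 \<le> real (card I)"
            by blast
          then show ?thesis using S(1) by (intro exI[of _ I]) (auto simp: m_def)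
        next
          case 2
          from main[OF symc 2] obtain I where "I \<subseteq> S" "\<forall>x\<in>I. \<forall>y\<in>I. x \<noteq> y \<longrightarrow> E x y" "m / 100 \<le> real (card I)"
            by blast
          then show ?thesis using S(1) by (intro exI[of _ I]) (auto simp: m_def)
        qed
      qed
    qed simp
  qed
qed

section \<open>Bipartite patterns\<close>

lemma induced_index_bigraph:
  fixes U V :: "'a set"
  assumes G: "finite_bipartite_graph (U, V, E)"
    and u: "inj_on u {1..k}" "u ` {1..k} \<subseteq> U"
    and v: "inj_on v {1..k}" "v ` {1..k} \<subseteq> V"
    and R: "\<And>i j. i \<in> {1..k} \<Longrightarrow> j \<in> {1..k} \<Longrightarrow> {u i, v j} \<in> E \<longleftrightarrow> R i j"
  shows "\<exists>U' V' E'. induced_subgraph (U', V', E') (U, V, E) \<and> card U' = k \<and> card V' = k \<and>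
    isomorphic (U', V', E') (index_bigraph R k)"
proof -
  define U' where "U' = u ` {1..k}"
  define V' where "V' = v ` {1..k}"
  define E' where "E' = {e \<in> E. e \<subseteq> U' \<union> V'}"
  define f where "f x = (if x \<in> U' then Inl (inv_into {1..k} u x) else Inr (inv_into {1..k} v x))" for x
  have disj: "U \<inter> V = {}" and E: "E \<subseteq> {{a, b} | a b. a \<in> U \<and> b \<in> V}"
    using G by auto
  have fu: "f (u i) = Inl i" if "i \<in> {1..k}" for i
    using that u by (auto simp: f_def U'_def)
  have fv: "f (v i) = Inr i" if "i \<in> {1..k}" for i
  proof -
    have "v i \<in> V" using that v by auto
    then have "v i \<notin> U'" using u disj by (auto simp: U'_def)
    then show ?thesis using that v by (auto simp: f_def)
  qed
  have fU: "f ` U' = Inl ` {1..k}" unfolding U'_def image_image using fu by (intro image_cong) auto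
  have fV: "f ` V' = Inr ` {1..k}" unfolding V'_def image_image using fv by (intro image_cong) auto
  have inj: "inj_on f (U' \<union> V')"
  proof (rule inj_onI)
    fix x y assume "x \<in> U' \<union> V'" "y \<in> U' \<union> V'" "f x = f y"
    then show "x = y" unfolding U'_def V'_def using fu fv by auto
  qed
  have noloop: "{a, b} \<notin> E" if "a \<in> U \<and> b \<in> U \<or> a \<in> V \<and> b \<in> V" for a b
  proof
    assume "{a, b} \<in> E"
    then obtain p q where "{a, b} = {p, q}" "p \<in> U" "q \<in> V" using E by blast
    then show False using that disj by (auto simp: doubleton_eq_iff)
  qed
  have adj: "adjacent (U', V', E') x y \<longleftrightarrow> adjacent (index_bigraph R k) (f x) (f y)"
    if "x \<in> U' \<union> V'" "y \<in> U' \<union> V'" for x y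
  proof -
    have xy: "{x, y} \<subseteq> U' \<union> V'" using that by auto
    consider i j where "i \<in> {1..k}" "j \<in> {1..k}" "x = u i" "y = v j"
      | i j where "i \<in> {1..k}" "j \<in> {1..k}" "x = v i" "y = u j"
      | i j where "i \<in> {1..k}" "j \<in> {1..k}" "x = u i" "y = u j"
      | i j where "i \<in> {1..k}" "j \<in> {1..k}" "x = v i" "y = v j"
      using \<open>x \<in> U' \<union> V'\<close> \<open>y \<in> U' \<union> V'\<close> unfolding U'_def V'_def by blast
    then show ?thesis
    proof cases
      case 1 then show ?thesis using R[of i j] fu fv xy
        by (auto simp: E'_def index_bigraph_def doubleton_eq_iff)
    next
      case 2 then show ?thesis using R[of j i] fu fv xy
        by (auto simp: E'_def index_bigraph_def doubleton_eq_iff insert_commute)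
    next
      case 3
      then have "x \<in> U" "y \<in> U" using u(2) by blast+
      then have "{x, y} \<notin> E" using noloop by blast
      then show ?thesis using 3 fu by (auto simp: E'_def index_bigraph_def doubleton_eq_iff)
    next
      case 4
      then have "x \<in> V" "y \<in> V" using v(2) by blast+
      then have "{x, y} \<notin> E" using noloop by blast
      then show ?thesis using 4 fv by (auto simp: E'_def index_bigraph_def doubleton_eq_iff)
    qed
  qed
  have bij: "bij_betw f (U' \<union> V') (Inl ` {1..k} \<union> Inr ` {1..k})"
    using inj fU fV by (auto simp: bij_betw_def image_Un)
  have "isomorphic (U', V', E') (index_bigraph R k)"
    using bij fU fV adj unfolding index_bigraph_def isomorphic.simps by blast
  moreover have "card U' = k" "card V' = k" using u v by (simp_all add: U'_def V'_def card_image)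
  moreover have "induced_subgraph (U', V', E') (U, V, E)"
    using u v by (auto simp: U'_def V'_def E'_def)
  ultimately show ?thesis by blast
qed

text \<open>Removing \<open>a\<close> from a set of least size makes the traces of two elements of
  \<open>B\<close> coincide, so these two differ at \<open>a\<close> only; \<open>v\<close> is the
  one with \<open>a\<close> in \<open>N v\<close>.\<close>

lemma minimal_distinguishing_set:
  assumes "finite A" and sep: "inj_on (\<lambda>v. N v \<inter> A) B"
  obtains A' where "A' \<subseteq> A" "inj_on (\<lambda>v. N v \<inter> A') B"
    "\<And>a. a \<in> A' \<Longrightarrow> \<exists>v\<in>B. \<exists>w\<in>B. N v \<inter> A' - N w = {a} \<and> N w \<inter> A' \<subseteq> N v"
proof -
  let ?P = "\<lambda>S. S \<subseteq> A \<and> inj_on (\<lambda>v. N v \<inter> S) B"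
  obtain A' where A': "?P A'" and min: "\<And>S. ?P S \<Longrightarrow> card A' \<le> card S"
    using ex_has_least_nat[of ?P A card] sep by blast
  have fin: "finite A'" using A' \<open>finite A\<close> finite_subset by blast
  have "\<exists>v\<in>B. \<exists>w\<in>B. N v \<inter> A' - N w = {a} \<and> N w \<inter> A' \<subseteq> N v" if a: "a \<in> A'" for a
  proof -
    have "card (A' - {a}) < card A'" using fin a by (meson card_Diff1_less)
    then have "\<not> inj_on (\<lambda>v. N v \<inter> (A' - {a})) B" using min[of "A' - {a}"] A' by auto
    then obtain v w where vw: "v \<in> B" "w \<in> B" "v \<noteq> w" "N v \<inter> (A' - {a}) = N w \<inter> (A' - {a})"
      by (auto simp: inj_on_def)
    moreover have "N v \<inter> A' \<noteq> N w \<inter> A'" using A' vw(1-3) by (auto simp: inj_on_def)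
    ultimately have diff: "(a \<in> N v) \<noteq> (a \<in> N w)" by auto
    show ?thesis
    proof (cases "a \<in> N v")
      case True
      then have "N v \<inter> A' - N w = {a}" "N w \<inter> A' \<subseteq> N v" using vw diff a by auto
      then show ?thesis using vw by blast
    next
      case False
      then have "N w \<inter> A' - N v = {a}" "N v \<inter> A' \<subseteq> N w" using vw diff a by auto
      then show ?thesis using vw by blast
    qed
  qed
  then show ?thesis using that A' by blast
qed

text \<open>
  In a shattered set of \<open>2 * D\<close> indices, either the lower half is shattered by larger indices or the
  upper half by smaller ones.
\<close>

lemma no_shatter_min_max:
  fixes X :: "nat set"
  assumes X: "finite X" and M: "no_shatter M X D" and Mt: "no_shatter (\<lambda>i j. M j i) X D"
  shows "no_shatter (\<lambda>i j. M (min i j) (max i j)) X (2 * D)"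
proof (rule no_shatterI)
  fix Y assume Y: "Y \<subseteq> X" "card Y = 2 * D"
  have finY: "finite Y" using Y(1) X finite_subset by blast
  define xs where "xs = sorted_list_of_set Y"
  have xs: "set xs = Y" "distinct xs" "sorted xs" "length xs = 2 * D"
    using finY Y(2) by (simp_all add: xs_def)
  define L where "L = set (take D xs)"
  define H where "H = set (drop D xs)"
  have YLH: "Y = L \<union> H" unfolding L_def H_def by (metis append_take_drop_id set_append xs(1))
  have cL: "card L = D" "card H = D"
    unfolding L_def H_def using xs by (simp_all add: distinct_card)
  have LH: "a < b" if "a \<in> L" "b \<in> H" for a b
  proof -
    have "sorted (take D xs @ drop D xs)" "distinct (take D xs @ drop D xs)" using xs by simp_all
    then have "a \<le> b" "a \<noteq> b" using that unfolding L_def H_def sorted_append distinct_append by blast+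
    then show ?thesis by simp
  qed
  obtain P where P: "P \<subseteq> L" "\<And>v. v \<in> X \<Longrightarrow> nbs (\<lambda>i j. M j i) v L \<noteq> P"
    using no_shatterD[OF Mt _ cL(1)] YLH Y(1) by (metis Un_subset_iff)
  obtain Q where Q: "Q \<subseteq> H" "\<And>v. v \<in> X \<Longrightarrow> nbs M v H \<noteq> Q"
    using no_shatterD[OF M _ cL(2)] YLH Y(1) by (metis Un_subset_iff)
  let ?E = "\<lambda>i j. M (min i j) (max i j)"
  have "nbs ?E v Y \<noteq> P \<union> Q" if v: "v \<in> X" for v
  proof
    assume eq: "nbs ?E v Y = P \<union> Q"
    have PQ: "P \<inter> H = {}" "Q \<inter> L = {}" using LH P(1) Q(1) by fastforce+
    \<comment> \<open>Either \<open>v\<close> is at or above all of \<open>L\<close>, or it is below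
      some \<open>a\<close> in \<open>L\<close> and hence below all of \<open>H\<close>. A tie with
      \<open>v\<close> is harmless, as both orders of the arguments then agree.\<close>
    show False
    proof (cases "\<forall>a\<in>L. a \<le> v")
      case True
      have "nbs (\<lambda>i j. M j i) v L = nbs ?E v Y \<inter> L"
        using True YLH by (auto simp: nbs_def min_absorb2 max_absorb1)
      also have "\<dots> = P" using eq PQ P(1) by blast
      finally show False using P(2)[OF v] by blast
    next
      case False
      then obtain a where a: "a \<in> L" "v < a" by force
      have vb: "v \<le> b" if "b \<in> H" for b using LH[OF a(1) that] a(2) by simp
      have "nbs M v H = nbs ?E v Y \<inter> H"
        using vb YLH by (auto simp: nbs_def min_absorb1 max_absorb2)
      also have "\<dots> = Q" using eq PQ Q(1) by blast
      finally show False using Q(2)[OF v] by blast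
    qed
  qed
  moreover have "P \<union> Q \<subseteq> Y" using P(1) Q(1) YLH by blast
  ultimately show "\<exists>P\<subseteq>Y. \<forall>v\<in>X. nbs ?E v Y \<noteq> P" by (intro exI[of _ "P \<union> Q"]) simp
qed

lemma increasing_enumeration:
  fixes I :: "nat set"
  assumes "finite I"
  obtains f where "\<And>p. p \<in> {1..card I} \<Longrightarrow> f p \<in> I" "\<And>p q. 1 \<le> p \<Longrightarrow> p < q \<Longrightarrow> q \<le> card I \<Longrightarrow> f p < f q"
proof -
  define xs where "xs = sorted_list_of_set I"
  have xs: "set xs = I" "distinct xs" "sorted xs" "length xs = card I"
    using assms by (simp_all add: xs_def)
  show thesis
  proof (rule that[of "\<lambda>p. xs ! (p - 1)"])
    fix p assume "p \<in> {1..card I}"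
    then have "p - 1 < length xs" using xs(4) by auto
    then show "xs ! (p - 1) \<in> I" using xs(1) nth_mem by blast
  next
    fix p q assume pq: "1 \<le> p" "p < q" "q \<le> card I"
    then have *: "p - 1 < q - 1" "q - 1 < length xs" using xs(4) by auto
    then have "xs ! (p - 1) \<le> xs ! (q - 1)" using xs(3) by (intro sorted_nth_mono) auto
    moreover have "xs ! (p - 1) \<noteq> xs ! (q - 1)" using * xs(2) by (simp add: nth_eq_iff_index_eq)
    ultimately show "xs ! (p - 1) < xs ! (q - 1)" by simp
  qed
qed

text \<open>Sorting the arguments turns each triangle of \<open>M\<close> into a symmetric relation.
  The second relation is treated inside the set found for the first, whence the nested
  powers.\<close>

lemma constant_triangles:
  fixes D :: nat
  obtains c :: real where "0 < c" "\<And>M k. no_shatter M {0..<k} D \<Longrightarrow> no_shatter (\<lambda>i j. M j i) {0..<k} D \<Longrightarrow>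
    \<exists>f m \<alpha> \<beta>. (\<forall>p\<in>{1..m}. f p < k) \<and>
      (\<forall>p q. 1 \<le> p \<longrightarrow> p < q \<longrightarrow> q \<le> m \<longrightarrow> f p < f q \<and> M (f p) (f q) = \<alpha> \<and> M (f q) (f p) = \<beta>) \<and>
      (real k powr c / 100) powr c / 100 \<le> real m"
proof (rule large_homogeneous_set[of "2 * D"])
  fix c :: real
  assume c: "0 < c" and hom: "\<And>E (V :: nat set). finite V \<Longrightarrow> symp E \<Longrightarrow> no_shatter E V (2 * D) \<Longrightarrow>
    \<exists>I\<subseteq>V. (\<exists>b. \<forall>x\<in>I. \<forall>y\<in>I. x \<noteq> y \<longrightarrow> E x y = b) \<and> real (card V) powr c / 100 \<le> real (card I)"
  show thesis
  proof (rule that[OF c])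
    fix M :: "nat \<Rightarrow> nat \<Rightarrow> bool" and k
    assume M: "no_shatter M {0..<k} D" and Mt: "no_shatter (\<lambda>i j. M j i) {0..<k} D"
    let ?E1 = "\<lambda>i j. M (min i j) (max i j)" and ?E2 = "\<lambda>i j. M (max i j) (min i j)"
    have sym: "symp ?E1" "symp ?E2" by (simp_all add: symp_def min.commute max.commute)
    have ns: "no_shatter ?E1 {0..<k} (2 * D)" "no_shatter ?E2 {0..<k} (2 * D)"
      using no_shatter_min_max[OF _ M Mt] no_shatter_min_max[OF _ Mt M] by simp_all
    obtain I1 a where I1: "I1 \<subseteq> {0..<k}" "\<And>x y. x \<in> I1 \<Longrightarrow> y \<in> I1 \<Longrightarrow> x \<noteq> y \<Longrightarrow> ?E1 x y = a"
      "real k powr c / 100 \<le> real (card I1)"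
      using hom[OF _ sym(1) ns(1)] by (metis card_atLeastLessThan diff_zero finite_atLeastLessThan)
    have fin1: "finite I1" using I1(1) finite_subset by blast
    obtain I b where I: "I \<subseteq> I1" "\<And>x y. x \<in> I \<Longrightarrow> y \<in> I \<Longrightarrow> x \<noteq> y \<Longrightarrow> ?E2 x y = b"
      "real (card I1) powr c / 100 \<le> real (card I)"
      using hom[OF fin1 sym(2) no_shatter_subset[OF ns(2) I1(1)]] by metis
    have finI: "finite I" using I(1) fin1 finite_subset by blast
    have "(real k powr c / 100) powr c \<le> real (card I1) powr c" using I1(3) c by (intro powr_mono2) auto
    then have size: "(real k powr c / 100) powr c / 100 \<le> real (card I)" using I(3) by linarith
    obtain f where f: "\<And>p. p \<in> {1..card I} \<Longrightarrow> f p \<in> I" "\<And>p q. 1 \<le> p \<Longrightarrow> p < q \<Longrightarrow> q \<le> card I \<Longrightarrow> f p < f q"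
      using increasing_enumeration[OF finI] by metis
    have "f p < f q \<and> M (f p) (f q) = a \<and> M (f q) (f p) = b" if pq: "1 \<le> p" "p < q" "q \<le> card I" for p q
    proof -
      have lt: "f p < f q" by (rule f(2)[OF pq])
      have mem: "f p \<in> I" "f q \<in> I" using f(1)[of p] f(1)[of q] pq by auto
      then have ne: "f p \<noteq> f q" using lt by simp
      have "?E1 (f p) (f q) = a" by (rule I1(2)[OF subsetD[OF I(1) mem(1)] subsetD[OF I(1) mem(2)] ne])
      moreover have "?E2 (f p) (f q) = b" by (rule I(2)[OF mem ne])
      ultimately show ?thesis using lt by (simp add: min_absorb1 max_absorb2)
    qed
    moreover have "f p < k" if "p \<in> {1..card I}" for p using f(1)[OF that] I(1) I1(1) by auto
    ultimately show "\<exists>f m \<alpha> \<beta>. (\<forall>p\<in>{1..m}. f p < k) \<and>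
      (\<forall>p q. 1 \<le> p \<longrightarrow> p < q \<longrightarrow> q \<le> m \<longrightarrow> f p < f q \<and> M (f p) (f q) = \<alpha> \<and> M (f q) (f p) = \<beta>) \<and>
      (real k powr c / 100) powr c / 100 \<le> real m"
      using size by (intro exI[of _ f] exI[of _ "card I"] exI[of _ a] exI[of _ b] conjI ballI allI impI) simp_all
  qed
qed

section \<open>From the bipartite graph to an index matrix and its patterns\<close>

lemma not_shatters_of_vc_dim:
  assumes G: "finite_bipartite_graph (U, V, E)" and vc: "graph_vc_dim (U, V, E) \<le> d"
    and S: "S \<subseteq> U \<union> V" "card S = Suc d"
  shows "\<not> shatters {neighbours (U, V, E) x | x. x \<in> U \<union> V} S"
proof
  define F where "F = {neighbours (U, V, E) x | x. x \<in> U \<union> V}"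
  assume "shatters {neighbours (U, V, E) x | x. x \<in> U \<union> V} S"
  then have sh: "shatters F S" by (simp only: F_def)
  have fin: "finite (U \<union> V)" using G by simp
  have "{S \<inter> T | T. T \<in> F} = Pow S"
  proof (intro equalityI subsetI)
    fix P assume "P \<in> Pow S"
    then have "\<exists>A\<in>F. A \<inter> S = P" using sh[unfolded shatters_def, rule_format] by simp
    then show "P \<in> {S \<inter> T | T. T \<in> F}" by blast
  qed blast
  moreover have "finite S" using S(1) fin finite_subset by blast
  ultimately have "shattered F S" by (simp only: shattered_def card_Pow)
  then have mem: "card S \<in> {card Y | Y. Y \<subseteq> U \<union> V \<and> shattered F Y}" using S(1) by blast
  have "{card Y | Y. Y \<subseteq> U \<union> V \<and> shattered F Y} \<subseteq> {0..card (U \<union> V)}"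
    using fin by (auto intro: card_mono)
  then have "finite {card Y | Y. Y \<subseteq> U \<union> V \<and> shattered F Y}" by (rule finite_subset) simp
  from Max_ge[OF this mem] have "card S \<le> graph_vc_dim (U, V, E)"
    unfolding graph_vc_dim_def vc_dim_def verts.simps F_def .
  then show False using vc S(2) by simp
qed

text \<open>Injectivity of \<open>u\<close> and \<open>v\<close> is read off from \<open>R\<close>:
  equal vertices have equal rows or columns, and for the patterns in question it suffices to compare
  these at the positions \<open>p\<close> and \<open>q\<close>.\<close>

lemma induced_index_bigraph_of_distinguishing:
  fixes U V :: "'a set"
  assumes G: "finite_bipartite_graph (U, V, E)"
    and uv: "\<And>p. p \<in> {1..m} \<Longrightarrow> u p \<in> U" "\<And>p. p \<in> {1..m} \<Longrightarrow> v p \<in> V"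
    and R: "\<And>i j. i \<in> {1..m} \<Longrightarrow> j \<in> {1..m} \<Longrightarrow> {u i, v j} \<in> E \<longleftrightarrow> R i j"
    and rows: "\<And>p q. p \<in> {1..m} \<Longrightarrow> q \<in> {1..m} \<Longrightarrow> R p p = R q p \<Longrightarrow> R p q = R q q \<Longrightarrow> p = q"
    and cols: "\<And>p q. p \<in> {1..m} \<Longrightarrow> q \<in> {1..m} \<Longrightarrow> R p p = R p q \<Longrightarrow> R q p = R q q \<Longrightarrow> p = q"
  shows "\<exists>U' V' E'. induced_subgraph (U', V', E') (U, V, E) \<and> card U' = m \<and> card V' = m \<and>
    isomorphic (U', V', E') (index_bigraph R m)"
proof (rule induced_index_bigraph[OF G _ _ _ _ R])
  show "inj_on u {1..m}"
  proof (rule inj_onI)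
    fix p q assume pq: "p \<in> {1..m}" "q \<in> {1..m}" "u p = u q"
    then have "R p p = R q p" "R p q = R q q" using R by metis+
    then show "p = q" by (rule rows[OF pq(1,2)])
  qed
  show "inj_on v {1..m}"
  proof (rule inj_onI)
    fix p q assume pq: "p \<in> {1..m}" "q \<in> {1..m}" "v p = v q"
    then have "R p p = R p q" "R q p = R q q" using R by metis+
    then show "p = q" by (rule cols[OF pq(1,2)])
  qed
qed (use uv in auto)

text \<open>The diagonal belonging to the \<open>v p\<close> consists of edges. If both triangles
  are full as well, the graph is complete bipartite, and exchanging each \<open>v p\<close> for
  \<open>w p\<close> deletes exactly the diagonal.\<close>

lemma pattern_of_constant_triangles:
  fixes U V :: "'a set"
  assumes G: "finite_bipartite_graph (U, V, E)"
    and u: "\<And>p. p \<in> {1..m} \<Longrightarrow> u p \<in> U" and v: "\<And>p. p \<in> {1..m} \<Longrightarrow> v p \<in> V"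
    and w: "\<And>p. p \<in> {1..m} \<Longrightarrow> w p \<in> V"
    and diag: "\<And>p. p \<in> {1..m} \<Longrightarrow> {u p, v p} \<in> E" "\<And>p. p \<in> {1..m} \<Longrightarrow> {u p, w p} \<notin> E"
    and vw: "\<And>p q. p \<in> {1..m} \<Longrightarrow> q \<in> {1..m} \<Longrightarrow> p \<noteq> q \<Longrightarrow> {u q, w p} \<in> E \<longleftrightarrow> {u q, v p} \<in> E"
    and up: "\<And>p q. 1 \<le> p \<Longrightarrow> p < q \<Longrightarrow> q \<le> m \<Longrightarrow> {u q, v p} \<in> E \<longleftrightarrow> \<alpha>"
    and low: "\<And>p q. 1 \<le> p \<Longrightarrow> p < q \<Longrightarrow> q \<le> m \<Longrightarrow> {u p, v q} \<in> E \<longleftrightarrow> \<beta>"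
  shows "\<exists>U' V' E'. induced_subgraph (U', V', E') (U, V, E) \<and> card U' = m \<and> card V' = m \<and>
    (isomorphic (U', V', E') (matching m) \<or> isomorphic (U', V', E') (co_matching m) \<or>
     isomorphic (U', V', E') (half_graph m))"
proof -
  have e: "{u i, v j} \<in> E \<longleftrightarrow> (if i = j then True else if i < j then \<beta> else \<alpha>)"
    if "i \<in> {1..m}" "j \<in> {1..m}" for i j
    using that diag(1)[of i] up[of j i] low[of i j] by (cases i j rule: linorder_cases) auto
  consider (matching) "\<not> \<alpha>" "\<not> \<beta>" | (co) \<alpha> \<beta> | (half) "\<not> \<alpha>" \<beta> | (rev) \<alpha> "\<not> \<beta>" by blast
  then show ?thesis
  proof cases
    case matching
    have e': "{u i, v j} \<in> E \<longleftrightarrow> i = j" if "i \<in> {1..m}" "j \<in> {1..m}" for i j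
      using e[OF that] matching by auto
    have "\<exists>U' V' E'. induced_subgraph (U', V', E') (U, V, E) \<and> card U' = m \<and> card V' = m \<and>
      isomorphic (U', V', E') (index_bigraph (\<lambda>i j. i = j) m)"
      by (rule induced_index_bigraph_of_distinguishing[OF G u v e']) auto
    then show ?thesis unfolding matching_def by blast
  next
    case co
    have e': "{u i, w j} \<in> E \<longleftrightarrow> i \<noteq> j" if "i \<in> {1..m}" "j \<in> {1..m}" for i j
      using e[OF that] vw[of j i] diag(2)[of i] that co by (cases "i = j") auto
    have "\<exists>U' V' E'. induced_subgraph (U', V', E') (U, V, E) \<and> card U' = m \<and> card V' = m \<and>
      isomorphic (U', V', E') (index_bigraph (\<lambda>i j. i \<noteq> j) m)"
      by (rule induced_index_bigraph_of_distinguishing[OF G u w e']) auto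
    then show ?thesis unfolding co_matching_def by blast
  next
    case half
    have e': "{u i, v j} \<in> E \<longleftrightarrow> i \<le> j" if "i \<in> {1..m}" "j \<in> {1..m}" for i j
      using e[OF that] half by auto
    have "\<exists>U' V' E'. induced_subgraph (U', V', E') (U, V, E) \<and> card U' = m \<and> card V' = m \<and>
      isomorphic (U', V', E') (index_bigraph (\<lambda>i j. i \<le> j) m)"
      by (rule induced_index_bigraph_of_distinguishing[OF G u v e']) auto
    then show ?thesis unfolding half_graph_def by blast
  next
    case rev
    \<comment> \<open>Here edges are the pairs with \<open>i \<ge> j\<close>; reversing the indices
      on both sides gives the half-graph.\<close>
    have r: "Suc m - i \<in> {1..m}" if "i \<in> {1..m}" for i using that by auto
    have e': "{u (Suc m - i), v (Suc m - j)} \<in> E \<longleftrightarrow> i \<le> j" if "i \<in> {1..m}" "j \<in> {1..m}" for i j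
      using e[OF r[OF that(1)] r[OF that(2)]] rev that by auto
    have "\<exists>U' V' E'. induced_subgraph (U', V', E') (U, V, E) \<and> card U' = m \<and> card V' = m \<and>
      isomorphic (U', V', E') (index_bigraph (\<lambda>i j. i \<le> j) m)"
      by (rule induced_index_bigraph_of_distinguishing[OF G u[OF r] v[OF r] e']) auto
    then show ?thesis unfolding half_graph_def by blast
  qed
qed

lemma large_pattern:
  fixes d :: nat
  assumes c: "0 < c" and triangles: "\<And>M k. no_shatter M {0..<k} (Suc d) \<Longrightarrow> no_shatter (\<lambda>i j. M j i) {0..<k} (Suc d) \<Longrightarrow>
    \<exists>f m \<alpha> \<beta>. (\<forall>p\<in>{1..m}. f p < k) \<and>
      (\<forall>p q. 1 \<le> p \<longrightarrow> p < q \<longrightarrow> q \<le> m \<longrightarrow> f p < f q \<and> M (f p) (f q) = \<alpha> \<and> M (f q) (f p) = \<beta>) \<and>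
      (real k powr c / 100) powr c / 100 \<le> real m"
    and G: "finite_bipartite_graph (U, V, E)" and vc: "graph_vc_dim (U, V, E) \<le> d"
    and tw: "\<forall>x\<in>V. \<forall>y\<in>V. \<not> twins (U, V, E) x y"
  obtains k m U' V' E' where "card V \<le> (k + 1) ^ Suc d" "(real k powr c / 100) powr c / 100 \<le> real m"
    "induced_subgraph (U', V', E') (U, V, E)" "card U' = m" "card V' = m"
    "isomorphic (U', V', E') (matching m) \<or> isomorphic (U', V', E') (co_matching m) \<or>
     isomorphic (U', V', E') (half_graph m)"
proof -
  define N where "N = neighbours (U, V, E)"
  have fin: "finite U" "finite V" and disj: "U \<inter> V = {}" and E: "E \<subseteq> {{a, b} | a b. a \<in> U \<and> b \<in> V}"
    using G by auto
  have N: "y \<in> N x \<longleftrightarrow> y \<in> U \<union> V \<and> {x, y} \<in> E" for x y by (auto simp: N_def neighbours_def)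
  have NV: "N x \<subseteq> U" if "x \<in> V" for x
  proof
    fix y assume "y \<in> N x"
    then have "{x, y} \<in> E" using N by blast
    then obtain a b where "{x, y} = {a, b}" "a \<in> U" "b \<in> V" using E by blast
    then show "y \<in> U" using that disj by (auto simp: doubleton_eq_iff)
  qed
  have "inj_on (\<lambda>v. N v \<inter> U) V"
  proof (rule inj_onI)
    fix x y assume xy: "x \<in> V" "y \<in> V" "N x \<inter> U = N y \<inter> U"
    then have "N x = N y" using NV[of x] NV[of y] by blast
    then show "x = y" using tw xy(1,2) unfolding twins_def N_def by blast
  qed
  then obtain A where A: "A \<subseteq> U" "inj_on (\<lambda>v. N v \<inter> A) V"
    "\<And>a. a \<in> A \<Longrightarrow> \<exists>v\<in>V. \<exists>w\<in>V. N v \<inter> A - N w = {a} \<and> N w \<inter> A \<subseteq> N v"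
    using minimal_distinguishing_set[OF fin(1), of N V] by metis
  have finA: "finite A" using A(1) fin(1) finite_subset by blast
  define k where "k = card A"
  obtain u where u: "bij_betw u {0..<k} A" using ex_bij_betw_nat_finite[OF finA] unfolding k_def by blast
  have uA: "u i \<in> A" if "i < k" for i using u that bij_betwE by fastforce
  have u_eq: "u i = u j \<longleftrightarrow> i = j" if "i < k" "j < k" for i j
    using u that by (auto simp: bij_betw_def inj_on_def)
  have nosh: "\<exists>P\<subseteq>S. \<forall>x\<in>U \<union> V. N x \<inter> S \<noteq> P" if S: "S \<subseteq> U \<union> V" "card S = Suc d" for S
  proof (rule ccontr)
    assume contra: "\<not> (\<exists>P\<subseteq>S. \<forall>x\<in>U \<union> V. N x \<inter> S \<noteq> P)"
    have "shatters {neighbours (U, V, E) x | x. x \<in> U \<union> V} S"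
      unfolding shatters_def
    proof (intro allI impI)
      fix P assume "P \<subseteq> S"
      with contra obtain x where "x \<in> U \<union> V" "N x \<inter> S = P" by blast
      then show "\<exists>A\<in>{neighbours (U, V, E) x | x. x \<in> U \<union> V}. A \<inter> S = P" unfolding N_def by blast
    qed
    then show False using not_shatters_of_vc_dim[OF G vc S] by simp
  qed
  have card_V: "card V \<le> (k + 1) ^ Suc d"
  proof -
    have "card V = card ((\<lambda>v. N v \<inter> A) ` V)" using A(2) by (simp add: card_image)
    also have "\<dots> \<le> (card A + 1) ^ Suc d"
    proof (rule card_le_of_not_shatters[OF finA])
      show "(\<lambda>v. N v \<inter> A) ` V \<subseteq> Pow A" by blast
      fix S assume S: "S \<subseteq> A" "card S = Suc d"
      then obtain P where P: "P \<subseteq> S" "\<And>x. x \<in> U \<union> V \<Longrightarrow> N x \<inter> S \<noteq> P"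
        using nosh[of S] A(1) by blast
      show "\<not> shatters ((\<lambda>v. N v \<inter> A) ` V) S"
      proof
        assume "shatters ((\<lambda>v. N v \<inter> A) ` V) S"
        then have "\<exists>B\<in>(\<lambda>v. N v \<inter> A) ` V. B \<inter> S = P" using P(1) unfolding shatters_def by simp
        then obtain v where "v \<in> V" "N v \<inter> A \<inter> S = P" by blast
        moreover from this have "N v \<inter> S = P" using S(1) by blast
        ultimately show False using P(2)[of v] by blast
      qed
    qed
    finally show ?thesis by (simp only: k_def)
  qed
  have "\<forall>i. \<exists>x. i < k \<longrightarrow> fst x \<in> V \<and> snd x \<in> V \<and> N (fst x) \<inter> A - N (snd x) = {u i} \<and> N (snd x) \<inter> A \<subseteq> N (fst x)"
    using A(3) uA by (metis fst_conv snd_conv)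
  then obtain h where h: "\<And>i. i < k \<Longrightarrow> fst (h i) \<in> V \<and> snd (h i) \<in> V \<and>
      N (fst (h i)) \<inter> A - N (snd (h i)) = {u i} \<and> N (snd (h i)) \<inter> A \<subseteq> N (fst (h i))"
    by metis
  define v where "v i = fst (h i)" for i
  define w where "w i = snd (h i)" for i
  have vwV: "v i \<in> V" "w i \<in> V" if "i < k" for i using h[OF that] by (simp_all add: v_def w_def)
  have edge: "{u j, x} \<in> E \<longleftrightarrow> u j \<in> N x" if "j < k" for j x
    using N uA[OF that] A(1) by (auto simp: insert_commute)
  have diag: "{u i, v i} \<in> E" "{u i, w i} \<notin> E" if "i < k" for i
    using h[OF that] unfolding edge[OF that] v_def w_def by blast+
  have vw: "{u j, w i} \<in> E \<longleftrightarrow> {u j, v i} \<in> E" if "i < k" "j < k" "i \<noteq> j" for i j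
  proof -
    have "u j \<in> A" "u j \<noteq> u i" using uA u_eq that by auto
    then show ?thesis using h[OF that(1)] unfolding edge[OF that(2)] v_def w_def by blast
  qed
  \<comment> \<open>Row \<open>i\<close> belongs to \<open>v i\<close> and column \<open>j\<close>
    to \<open>u j\<close>. Both triangles will be read in either direction, so shattering has to be
    excluded for \<open>M\<close> and for its transpose.\<close>
  define M where "M i j \<longleftrightarrow> {u j, v i} \<in> E" for i j
  have M_N: "M i j \<longleftrightarrow> u j \<in> N (v i)" if "j < k" for i j using edge[OF that] by (simp add: M_def)
  have M_N': "M i j \<longleftrightarrow> v i \<in> N (u j)" if "i < k" for i j
    using N vwV[OF that] by (auto simp: M_def)
  have "no_shatter M {0..<k} (Suc d)"
  proof (rule no_shatterI, rule ccontr)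
    fix Y assume Y: "Y \<subseteq> {0..<k}" "card Y = Suc d"
    assume "\<not> (\<exists>P\<subseteq>Y. \<forall>i\<in>{0..<k}. nbs M i Y \<noteq> P)"
    then have sh: "\<exists>i\<in>{0..<k}. nbs M i Y = P" if "P \<subseteq> Y" for P using that by blast
    have "inj_on u Y" using u Y(1) by (meson bij_betw_def inj_on_subset)
    then have cS: "card (u ` Y) = Suc d" using Y(2) by (simp add: card_image)
    have sub: "u ` Y \<subseteq> U \<union> V" using Y(1) uA A(1) by fastforce
    obtain P where P: "P \<subseteq> u ` Y" "\<And>x. x \<in> U \<union> V \<Longrightarrow> N x \<inter> u ` Y \<noteq> P"
      using nosh[OF sub cS] by metis
    obtain i where i: "i < k" "nbs M i Y = {j \<in> Y. u j \<in> P}" using sh[of "{j \<in> Y. u j \<in> P}"] by auto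
    have "u j \<in> N (v i) \<longleftrightarrow> u j \<in> P" if "j \<in> Y" for j
    proof -
      have "j < k" using that Y(1) by auto
      then show ?thesis using i(2) that M_N[of j i] by (auto simp: nbs_def)
    qed
    then have "N (v i) \<inter> u ` Y = P" using P(1) by blast
    then show False using P(2)[of "v i"] vwV[OF i(1)] by blast
  qed
  moreover have "no_shatter (\<lambda>i j. M j i) {0..<k} (Suc d)"
  proof (rule no_shatterI, rule ccontr)
    fix Y assume Y: "Y \<subseteq> {0..<k}" "card Y = Suc d"
    assume "\<not> (\<exists>P\<subseteq>Y. \<forall>i\<in>{0..<k}. nbs (\<lambda>i j. M j i) i Y \<noteq> P)"
    then have sh: "\<exists>i\<in>{0..<k}. nbs (\<lambda>i j. M j i) i Y = P" if "P \<subseteq> Y" for P using that by blast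
    \<comment> \<open>Different indices may share the same \<open>v i\<close>, but not inside a
      shattered set, where some trace separates them.\<close>
    have inj: "inj_on v Y"
    proof (rule inj_onI, rule ccontr)
      fix a b assume ab: "a \<in> Y" "b \<in> Y" "v a = v b" "a \<noteq> b"
      obtain i where "nbs (\<lambda>i j. M j i) i Y = {a}" using sh[of "{a}"] ab(1) by auto
      then have "M a i" "\<not> M b i" using ab by (auto simp: nbs_def)
      then show False using ab(3) by (simp add: M_def)
    qed
    then have cS: "card (v ` Y) = Suc d" using Y(2) by (simp add: card_image)
    have sub: "v ` Y \<subseteq> U \<union> V" using Y(1) vwV by fastforce
    obtain P where P: "P \<subseteq> v ` Y" "\<And>x. x \<in> U \<union> V \<Longrightarrow> N x \<inter> v ` Y \<noteq> P"
      using nosh[OF sub cS] by metis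
    obtain i where i: "i < k" "nbs (\<lambda>i j. M j i) i Y = {j \<in> Y. v j \<in> P}" using sh[of "{j \<in> Y. v j \<in> P}"] by auto
    have "v j \<in> N (u i) \<longleftrightarrow> v j \<in> P" if "j \<in> Y" for j
    proof -
      have "j < k" using that Y(1) by auto
      then show ?thesis using i(2) that M_N'[of j i] by (auto simp: nbs_def)
    qed
    then have "N (u i) \<inter> v ` Y = P" using P(1) by blast
    then show False using P(2)[of "u i"] uA[OF i(1)] A(1) by blast
  qed
  ultimately obtain f m \<alpha> \<beta> where f: "\<And>p. p \<in> {1..m} \<Longrightarrow> f p < k"
    "\<And>p q. 1 \<le> p \<Longrightarrow> p < q \<Longrightarrow> q \<le> m \<Longrightarrow> f p < f q \<and> M (f p) (f q) = \<alpha> \<and> M (f q) (f p) = \<beta>"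
    and m: "(real k powr c / 100) powr c / 100 \<le> real m"
    using triangles[of M k] by blast
  have f_ne: "f p \<noteq> f q" if "p \<in> {1..m}" "q \<in> {1..m}" "p \<noteq> q" for p q
    using f(2)[of p q] f(2)[of q p] that by (cases p q rule: linorder_cases) auto
  have "\<exists>U' V' E'. induced_subgraph (U', V', E') (U, V, E) \<and> card U' = m \<and> card V' = m \<and>
    (isomorphic (U', V', E') (matching m) \<or> isomorphic (U', V', E') (co_matching m) \<or>
     isomorphic (U', V', E') (half_graph m))"
  proof (rule pattern_of_constant_triangles[OF G, of m "\<lambda>p. u (f p)" "\<lambda>p. v (f p)" "\<lambda>p. w (f p)" \<alpha> \<beta>])
    fix p assume p: "p \<in> {1..m}"
    show "u (f p) \<in> U" using uA[OF f(1)[OF p]] A(1) by blast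
    show "v (f p) \<in> V" "w (f p) \<in> V" using vwV[OF f(1)[OF p]] .
    show "{u (f p), v (f p)} \<in> E" "{u (f p), w (f p)} \<notin> E" using diag[OF f(1)[OF p]] .
  next
    fix p q assume "p \<in> {1..m}" "q \<in> {1..m}" "p \<noteq> q"
    then show "({u (f q), w (f p)} \<in> E) = ({u (f q), v (f p)} \<in> E)" by (intro vw f(1) f_ne)
  next
    fix p q assume pq: "1 \<le> p" "p < q" "q \<le> m"
    show "({u (f q), v (f p)} \<in> E) = \<alpha>" "({u (f p), v (f q)} \<in> E) = \<beta>" using f(2)[OF pq] by (simp_all add: M_def)
  qed
  then show thesis using that[OF card_V m] by blast
qed

theorem theorem2:
  fixes d :: nat
  shows "\<exists>c C :: real. c > 0 \<and> C > 0 \<and>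
    (\<forall>(U :: 'a set) V E.
       finite_bipartite_graph (U, V, E) \<and> U \<noteq> {} \<and>
       graph_vc_dim (U, V, E) \<le> d \<and>
       (\<forall>x\<in>V. \<forall>y\<in>V. \<not> twins (U, V, E) x y) \<longrightarrow>
       (\<exists>U' V' E'.
          induced_subgraph (U', V', E') (U, V, E) \<and>
          card U' = card V' \<and>
          real (card U') \<ge> C * real (card V) powr c \<and>
          (isomorphic (U', V', E') (matching (card U')) \<or>
           isomorphic (U', V', E') (co_matching (card U')) \<or>
           isomorphic (U', V', E') (half_graph (card U')))))"
proof (rule constant_triangles[of "Suc d"])
  fix c :: real
  assume c: "0 < c" and triangles: "\<And>M k. no_shatter M {0..<k} (Suc d) \<Longrightarrow> no_shatter (\<lambda>i j. M j i) {0..<k} (Suc d) \<Longrightarrow>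
    \<exists>f m \<alpha> \<beta>. (\<forall>p\<in>{1..m}. f p < k) \<and>
      (\<forall>p q. 1 \<le> p \<longrightarrow> p < q \<longrightarrow> q \<le> m \<longrightarrow> f p < f q \<and> M (f p) (f q) = \<alpha> \<and> M (f q) (f p) = \<beta>) \<and>
      (real k powr c / 100) powr c / 100 \<le> real m"
  \<comment> \<open>The distinguishing set has size \<open>k\<close> at least half the power
    \<open>a\<close> of \<open>card V\<close>, which is the origin of 1 / 2 in \<open>C\<close>; the
    two homogeneous subsets then cost a power \<open>c\<close> each.\<close>
  define a where "a = 1 / real (Suc d)"
  define c' where "c' = a * c * c"
  define C where "C = ((1 / 2) powr c / 100) powr c / 100"
  have a0: "0 < a" by (simp add: a_def)
  have c'0: "0 < c'" using a0 c by (simp add: c'_def)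
  have C0: "0 < C" by (simp add: C_def)
  have C1: "C \<le> 1"
  proof -
    have "(1 / 2 :: real) powr c \<le> 1 powr c" using c by (intro powr_mono2) auto
    then have "((1 / 2) powr c / 100) powr c \<le> 1 powr c" using c by (intro powr_mono2) auto
    then show ?thesis by (simp add: C_def)
  qed
  have "\<exists>U' V' E'. induced_subgraph (U', V', E') (U, V, E) \<and> card U' = card V' \<and>
      real (card U') \<ge> C * real (card V) powr c' \<and>
      (isomorphic (U', V', E') (matching (card U')) \<or>
       isomorphic (U', V', E') (co_matching (card U')) \<or>
       isomorphic (U', V', E') (half_graph (card U')))"
    if G: "finite_bipartite_graph (U, V, E)" and ne: "U \<noteq> {}" and vc: "graph_vc_dim (U, V, E) \<le> d"
      and tw: "\<forall>x\<in>V. \<forall>y\<in>V. \<not> twins (U, V, E) x y" for U V :: "'a set" and E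
  proof (cases "card V \<le> 1")
    case True
    \<comment> \<open>With at most one vertex in \<open>V\<close> the distinguishing set may be
      empty and \<open>k\<close> gives no bound, so a pattern of size \<open>card V\<close> is built
      by hand: a single edge is a matching and a single non-edge a co-matching. The vertex on the
      side of \<open>U\<close> comes from \<open>ne\<close>.\<close>
    define m where "m = card V"
    obtain x where x: "x \<in> U" using ne by blast
    have "\<exists>y. m = 1 \<longrightarrow> y \<in> V" unfolding m_def by (metis card.empty equals0I zero_neq_one)
    then obtain y where y: "m = 1 \<Longrightarrow> y \<in> V" by blast
    have m1: "m \<le> 1" using True by (simp add: m_def)
    have "\<exists>U' V' E'. induced_subgraph (U', V', E') (U, V, E) \<and> card U' = m \<and> card V' = m \<and>
      isomorphic (U', V', E') (index_bigraph (\<lambda>i j. if {x, y} \<in> E then i = j else i \<noteq> j) m)"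
      by (rule induced_index_bigraph_of_distinguishing[OF G, of m "\<lambda>_. x" "\<lambda>_. y"])
        (use x y m1 in \<open>auto simp: le_Suc_eq\<close>)
    then obtain U' V' E' where *: "induced_subgraph (U', V', E') (U, V, E)" "card U' = m" "card V' = m"
      "isomorphic (U', V', E') (index_bigraph (\<lambda>i j. if {x, y} \<in> E then i = j else i \<noteq> j) m)" by blast
    have "isomorphic (U', V', E') (matching m) \<or> isomorphic (U', V', E') (co_matching m)"
      using *(4) by (cases "{x, y} \<in> E") (simp_all only: if_True if_False matching_def co_matching_def simp_thms)
    moreover have "C * real (card V) powr c' \<le> real m"
      using m1 C1 unfolding m_def[symmetric] by (cases m) auto
    ultimately have "induced_subgraph (U', V', E') (U, V, E) \<and> card U' = card V' \<and>
      C * real (card V) powr c' \<le> real (card U') \<and>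
      (isomorphic (U', V', E') (matching (card U')) \<or>
       isomorphic (U', V', E') (co_matching (card U')) \<or>
       isomorphic (U', V', E') (half_graph (card U')))"
      unfolding *(2,3) using *(1) by blast
    then show ?thesis by blast
  next
    case False
    obtain k m U' V' E' where k: "card V \<le> (k + 1) ^ Suc d" "(real k powr c / 100) powr c / 100 \<le> real m"
      and *: "induced_subgraph (U', V', E') (U, V, E)" "card U' = m" "card V' = m"
      "isomorphic (U', V', E') (matching m) \<or> isomorphic (U', V', E') (co_matching m) \<or>
       isomorphic (U', V', E') (half_graph m)"
      using large_pattern[OF c triangles G vc tw] by blast
    have "0 < k" using k(1) False by (cases k) auto
    then have "k + 1 \<le> 2 * k" by simp
    then have "(k + 1) ^ Suc d \<le> (2 * k) ^ Suc d" by (rule power_mono) simp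
    then have "card V \<le> (2 * k) ^ Suc d" using k(1) by linarith
    then have "real (card V) \<le> real ((2 * k) ^ Suc d)" by (simp only: of_nat_le_iff)
    then have "real (card V) \<le> (2 * real k) powr real (Suc d)"
      using \<open>0 < k\<close> by (simp add: powr_realpow del: power_Suc of_nat_Suc)
    then have "real (card V) powr a \<le> ((2 * real k) powr real (Suc d)) powr a"
      using a0 by (intro powr_mono2) auto
    also have "\<dots> = 2 * real k" using \<open>0 < k\<close> by (simp add: powr_powr a_def del: of_nat_Suc)
    finally have "1 / 2 * real (card V) powr a \<le> real k" by simp
    then have "(1 / 2 * real (card V) powr a) powr c \<le> real k powr c" using c by (intro powr_mono2) auto
    then have "((1 / 2 * real (card V) powr a) powr c / 100) powr c \<le> (real k powr c / 100) powr c"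
      using c by (intro powr_mono2) auto
    moreover have "((1 / 2 * real (card V) powr a) powr c / 100) powr c = ((1 / 2) powr c / 100) powr c * real (card V) powr c'"
    proof -
      have "(1 / 2 * real (card V) powr a) powr c = (1 / 2) powr c * real (card V) powr (a * c)"
        by (subst powr_mult) (simp_all add: powr_powr)
      then have "(1 / 2 * real (card V) powr a) powr c / 100 = ((1 / 2) powr c / 100) * real (card V) powr (a * c)"
        by simp
      then show ?thesis by (simp only: c'_def) (subst powr_mult, simp_all add: powr_powr)
    qed
    ultimately have "C * real (card V) powr c' \<le> real m" using k(2) by (simp add: C_def)
    then have "induced_subgraph (U', V', E') (U, V, E) \<and> card U' = card V' \<and>
      C * real (card V) powr c' \<le> real (card U') \<and>
      (isomorphic (U', V', E') (matching (card U')) \<or>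
       isomorphic (U', V', E') (co_matching (card U')) \<or>
       isomorphic (U', V', E') (half_graph (card U')))"
      unfolding *(2,3) using *(1,4) by blast
    then show ?thesis by blast
  qed
  then show ?thesis using c'0 C0 by (intro exI[of _ c'] exI[of _ C]) blast
qed

end
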